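(* Let $p$ be an odd prime, $k\in\mathbb{Z}_p^\times$, $l\ge1$, $m=2l$ and $d=2m-1=4l-1$. On $\mathbb{Z}^d$ place one $\mathbb{Z}_p$ qudit on every $m$-cell. For each $(m-1)$-cell $r$ set $$G^{(k)}_r=X_{\delta\boldsymbol r}\prod_{s'}Z_{s'}^{\,k\int\delta\boldsymbol r\cup_1\boldsymbol s'},$$ and for each $m$-cell $s$ set $$\overline Z_s=Z_s\prod_{r}\big(G^{(k)}_r\big)^{\frac1{2k}\int\boldsymbol r\cup\boldsymbol s},\qquad \overline X_s=X_s\prod_{s'}\Big[\prod_r\big(G^{(k)}_r\big)^{-\frac12\int\boldsymbol r\cup\boldsymbol s'}\Big]^{\int\boldsymbol s'\cup_1\boldsymbol s},$$ where $r$ runs over $(m-1)$-cells, $s'$ over $m$-cells, and $\frac1{2k},\frac12$ are inverses in $\mathbb{Z}_p$. Then, for all $m$-cells $s,s'$, the operators $\overline Z_s,\overline Z_{s'}$ commute, $\overline X_s,\overline X_{s'}$ commute, and $\overline Z_s\overline X_{s'}=e^{2\pi i\,\delta_{s,s'}/p}\,\overline X_{s'}\overline Z_s$; and the assignment $X_s\mapsto\overline X_s$, $Z_s\mapsto\overline Z_s$ (modulo phases) defines a Clifford QCA, i.e. a locality-preserving, commutation-preserving automorphism of the group of Pauli operators modulo phases.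
   Context: Generalized Pauli operators satisfy $X^p=Z^p=1$, $ZX=e^{2\pi i/p}XZ$ on each qudit. Products of Pauli operators are taken modulo phases. An $n$-cell of $\mathbb{Z}^d$ is a pair $(v,I)$, $v\in\mathbb{Z}^d$, $I=\{i_1<\dots<i_n\}\subset[d]=\{1,\dots,d\}$, representing the cube $v+\{\sum_{i\in I}t_ie_i:t_i\in[0,1]\}$; bold $\boldsymbol s$ is the indicator cochain of the cell $s$. The boundary is $\partial(v,I)=\sum_{r=1}^{n}(-1)^{r}\big[(v,I\setminus\{i_r\})-(v+e_{i_r},I\setminus\{i_r\})\big]$, and $\delta a(c)=a(\partial c)$. For disjoint $J,I$ put $\mathrm{inv}(J,I)=\#\{(j,i)\in J\times I: j<i\}$, and $e_I=\sum_{i\in I}e_i$. For cochains $a,b$ of degrees $p',q'$: if $p'+q'=d$, $(a\cup b)(v,[d])=\sum_{I\sqcup J=[d],|I|=p'}(-1)^{\mathrm{inv}(J,I)}a(v,I)\,b(v+e_I,J)$; if $p'+q'=d+1$, $(a\cup_1b)(v,[d])=\sum_{c\in[d]}\sum_{I'\sqcup J'=[d]\setminus\{c\},|I'|=p'-1}(-1)^{q'-1+\mathrm{inv}(J',I')}a\big(v+\sum_{j\in J',j>c}e_j,I'\cup\{c\}\big)\,b\big(v+\sum_{i\in I',i<c}e_i,J'\cup\{c\}\big)$. $\int$ is the sum of values over all $d$-cells; exponents are read mod $p$. $X_{\delta\boldsymbol r}=\prod_sX_s^{(\delta\boldsymbol r)(s)}$. "Locality-preserving" means supports grow by at most a fixed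 finite radius. This QCA is associated with the topological action $\frac kp\int A_{2l}\cup A_{2l}$. *)

theory Defs
  imports
    Complex_Main
    "HOL-Library.FuncSet"
    "HOL-Library.Indicator_Function"
    "HOL-Library.Poly_Mapping"
    "HOL-Number_Theory.Modular_Inverse"
    "HOL-Algebra.Coset"
    "HOL-Algebra.Bij"
    "HOL-Algebra.Generated_Groups"
    "HOL-Algebra.Free_Abelian_Groups"
begin

section \<open>Cells and cochains of the cubical lattice\<close>

text \<open>A cell \<open>(v, I)\<close> of the \<open>d\<close>-dimensional lattice: coordinates are indexed by
  \<open>{1..d}\<close>, and \<open>v\<close> is set to \<open>0\<close> at all other indices.\<close>

type_synonym cell = "(nat \<Rightarrow> int) \<times> nat set"
type_synonym cochain = "cell \<Rightarrow> int"

definition cells :: "nat \<Rightarrow> nat \<Rightarrow> cell set" where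
  "cells d n = {(v, I). (\<forall>i. i \<notin> {1..d} \<longrightarrow> v i = 0) \<and> I \<subseteq> {1..d} \<and> card I = n}"

text \<open>\<open>shift v I\<close> is \<open>v + e_I\<close>.\<close>

definition shift :: "(nat \<Rightarrow> int) \<Rightarrow> nat set \<Rightarrow> nat \<Rightarrow> int" where
  "shift v I = (\<lambda>i. v i + of_bool (i \<in> I))"

definition inv_count :: "nat set \<Rightarrow> nat set \<Rightarrow> nat" where
  "inv_count J I = card {(j, i). j \<in> J \<and> i \<in> I \<and> j < i}"

text \<open>The position \<open>r\<close> of \<open>i\<close> in \<open>I = {i_1 < ... < i_n}\<close> is \<open>card {j \<in> I. j \<le> i}\<close>.\<close>

definition boundary :: "cell \<Rightarrow> (cell \<Rightarrow>\<^sub>0 int)" where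
  "boundary = (\<lambda>(v, I). \<Sum>i\<in>I. frag_cmul ((-1) ^ card {j \<in> I. j \<le> i})
     (frag_of (v, I - {i}) - frag_of (shift v {i}, I - {i})))"

definition coboundary :: "cochain \<Rightarrow> cochain" where
  "coboundary a = (\<lambda>c. \<Sum>e\<in>Poly_Mapping.keys (boundary c). Poly_Mapping.lookup (boundary c) e * a e)"

text \<open>Cochains do not carry their degree, so the products take the degrees of their arguments
  as parameters. On the top cells \<open>(v, {1..d})\<close> these are the cup product of degrees \<open>p'\<close> and
  \<open>d - p'\<close>, and the cup-1 product of degrees \<open>p'\<close> and \<open>q'\<close> with \<open>p' + q' = d + 1\<close>.\<close>

definition cup :: "nat \<Rightarrow> cochain \<Rightarrow> cochain \<Rightarrow> cochain" where
  "cup p' a b = (\<lambda>(v, K). \<Sum>I | I \<subseteq> K \<and> card I = p'.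
     (-1) ^ inv_count (K - I) I * a (v, I) * b (shift v I, K - I))"

definition cup1 :: "nat \<Rightarrow> nat \<Rightarrow> cochain \<Rightarrow> cochain \<Rightarrow> cochain" where
  "cup1 p' q' a b = (\<lambda>(v, K). \<Sum>c\<in>K. \<Sum>I | I \<subseteq> K - {c} \<and> card I = p' - 1.
     (let J = K - {c} - I in
       (-1) ^ (q' - 1 + inv_count J I)
         * a (shift v {j \<in> J. c < j}, insert c I)
         * b (shift v {i \<in> I. i < c}, insert c J)))"

text \<open>The integrands below are finitely supported; summing over the support avoids that a sum
  over an infinite set is \<open>0\<close> by convention.\<close>

definition integral_top :: "nat \<Rightarrow> cochain \<Rightarrow> int" where
  "integral_top d f = (\<Sum>c | c \<in> cells d d \<and> f c \<noteq> 0. f c)"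


section \<open>Pauli operators on a set of qudits\<close>

text \<open>The operators act on the complex functions of the classical configurations
  \<open>Q \<rightarrow> {0..<p}\<close>. The restrictions make them elements of the group of bijections of this
  space.\<close>

definition configs :: "'q set \<Rightarrow> nat \<Rightarrow> ('q \<Rightarrow> int) set" where
  "configs Q p = Q \<rightarrow>\<^sub>E {0..<int p}"

definition states :: "'q set \<Rightarrow> nat \<Rightarrow> (('q \<Rightarrow> int) \<Rightarrow> complex) set" where
  "states Q p = configs Q p \<rightarrow>\<^sub>E UNIV"

type_synonym 'q operator = "(('q \<Rightarrow> int) \<Rightarrow> complex) \<Rightarrow> (('q \<Rightarrow> int) \<Rightarrow> complex)"

definition X_op :: "'q set \<Rightarrow> nat \<Rightarrow> 'q \<Rightarrow> 'q operator" where
  "X_op Q p s = (\<lambda>\<psi>\<in>states Q p. \<lambda>\<phi>\<in>configs Q p. \<psi> (\<phi>(s := (\<phi> s - 1) mod int p)))"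

definition Z_op :: "'q set \<Rightarrow> nat \<Rightarrow> 'q \<Rightarrow> 'q operator" where
  "Z_op Q p s = (\<lambda>\<psi>\<in>states Q p. \<lambda>\<phi>\<in>configs Q p.
     exp (2 * of_real pi * \<i> / of_nat p) powi (\<phi> s) * \<psi> \<phi>)"

definition phase_op :: "'q set \<Rightarrow> nat \<Rightarrow> complex \<Rightarrow> 'q operator" where
  "phase_op Q p u = (\<lambda>\<psi>\<in>states Q p. \<lambda>\<phi>\<in>configs Q p. u * \<psi> \<phi>)"

definition phases :: "'q set \<Rightarrow> nat \<Rightarrow> 'q operator set" where
  "phases Q p = {phase_op Q p u | u. cmod u = 1}"

definition pauli_group :: "'q set \<Rightarrow> nat \<Rightarrow> 'q operator monoid" where
  "pauli_group Q p = (BijGroup (states Q p))\<lparr>carrier :=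
     generate (BijGroup (states Q p)) (phases Q p \<union> X_op Q p ` Q \<union> Z_op Q p ` Q)\<rparr>"

definition pauli_mod :: "'q set \<Rightarrow> nat \<Rightarrow> 'q operator set monoid" where
  "pauli_mod Q p = pauli_group Q p Mod phases Q p"

definition X_cls :: "'q set \<Rightarrow> nat \<Rightarrow> 'q \<Rightarrow> 'q operator set" where
  "X_cls Q p s = phases Q p #>\<^bsub>pauli_group Q p\<^esub> X_op Q p s"

definition Z_cls :: "'q set \<Rightarrow> nat \<Rightarrow> 'q \<Rightarrow> 'q operator set" where
  "Z_cls Q p s = phases Q p #>\<^bsub>pauli_group Q p\<^esub> Z_op Q p s"

text \<open>Elements of \<open>pauli_mod\<close> are sets of operators, and commutation relations between them
  are relations between all representatives: \<open>A B = u B A\<close>.\<close>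

definition commute_with_phase ::
  "'q set \<Rightarrow> nat \<Rightarrow> complex \<Rightarrow> 'q operator set \<Rightarrow> 'q operator set \<Rightarrow> bool" where
  "commute_with_phase Q p u g h \<longleftrightarrow> (\<forall>A\<in>g. \<forall>B\<in>h.
     A \<otimes>\<^bsub>pauli_group Q p\<^esub> B
       = phase_op Q p u \<otimes>\<^bsub>pauli_group Q p\<^esub> (B \<otimes>\<^bsub>pauli_group Q p\<^esub> A))"

definition supported_on :: "'q set \<Rightarrow> nat \<Rightarrow> 'q operator set \<Rightarrow> 'q set \<Rightarrow> bool" where
  "supported_on Q p g S \<longleftrightarrow> g \<in> generate (pauli_mod Q p) (X_cls Q p ` S \<union> Z_cls Q p ` S)"


section \<open>Clifford QCAs\<close>

definition neighbourhood :: "cell set \<Rightarrow> nat \<Rightarrow> cell set \<Rightarrow> cell set" where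
  "neighbourhood Q R S = {t \<in> Q. \<exists>s\<in>S. \<forall>i. \<bar>fst t i - fst s i\<bar> \<le> int R}"

definition locality_preserving ::
  "cell set \<Rightarrow> nat \<Rightarrow> (cell operator set \<Rightarrow> cell operator set) \<Rightarrow> bool" where
  "locality_preserving Q p \<alpha> \<longleftrightarrow> (\<exists>R. \<forall>S g. S \<subseteq> Q \<longrightarrow> supported_on Q p g S \<longrightarrow>
     supported_on Q p (\<alpha> g) (neighbourhood Q R S))"

definition commutation_preserving ::
  "'q set \<Rightarrow> nat \<Rightarrow> ('q operator set \<Rightarrow> 'q operator set) \<Rightarrow> bool" where
  "commutation_preserving Q p \<alpha> \<longleftrightarrow>
     (\<forall>g\<in>carrier (pauli_mod Q p). \<forall>h\<in>carrier (pauli_mod Q p). \<forall>u. cmod u = 1 \<longrightarrow>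
        (commute_with_phase Q p u (\<alpha> g) (\<alpha> h) \<longleftrightarrow> commute_with_phase Q p u g h))"

definition clifford_QCA ::
  "cell set \<Rightarrow> nat \<Rightarrow> (cell operator set \<Rightarrow> cell operator set) \<Rightarrow> bool" where
  "clifford_QCA Q p \<alpha> \<longleftrightarrow>
     \<alpha> \<in> auto (pauli_mod Q p) \<and> commutation_preserving Q p \<alpha> \<and> locality_preserving Q p \<alpha>"


section \<open>The operators of the construction\<close>

text \<open>Here \<open>d = 4 l - 1\<close> and \<open>m = 2 l\<close>. All products are in the Pauli group modulo phases;
  \<open>gfinprod\<close> is the product of a family with finitely many nontrivial factors.\<close>

definition qudits :: "nat \<Rightarrow> cell set" where
  "qudits l = cells (4 * l - 1) (2 * l)"

definition gauge_cells :: "nat \<Rightarrow> cell set" where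
  "gauge_cells l = cells (4 * l - 1) (2 * l - 1)"

text \<open>\<open>int_cup l r s\<close> is the integral of the cup product of the indicator cochains of an
  \<open>(m-1)\<close>-cell and an \<open>m\<close>-cell; \<open>int_cup1 l a b\<close> is the integral of the cup-1 product of two
  cochains of degree \<open>m\<close>.\<close>

definition int_cup :: "nat \<Rightarrow> cell \<Rightarrow> cell \<Rightarrow> int" where
  "int_cup l r s = integral_top (4 * l - 1) (cup (2 * l - 1) (indicator {r}) (indicator {s}))"

definition int_cup1 :: "nat \<Rightarrow> cochain \<Rightarrow> cochain \<Rightarrow> int" where
  "int_cup1 l a b = integral_top (4 * l - 1) (cup1 (2 * l) (2 * l) a b)"

definition gauge_op :: "nat \<Rightarrow> nat \<Rightarrow> int \<Rightarrow> cell \<Rightarrow> cell operator set" where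
  "gauge_op l p k r = (let Q = qudits l; P = pauli_mod Q p in
     gfinprod P (\<lambda>s. X_cls Q p s [^]\<^bsub>P\<^esub> coboundary (indicator {r}) s) Q
     \<otimes>\<^bsub>P\<^esub> gfinprod P (\<lambda>s'. Z_cls Q p s' [^]\<^bsub>P\<^esub>
           (k * int_cup1 l (coboundary (indicator {r})) (indicator {s'}))) Q)"

definition Z_bar :: "nat \<Rightarrow> nat \<Rightarrow> int \<Rightarrow> cell \<Rightarrow> cell operator set" where
  "Z_bar l p k s = (let Q = qudits l; P = pauli_mod Q p in
     Z_cls Q p s \<otimes>\<^bsub>P\<^esub> gfinprod P (\<lambda>r. gauge_op l p k r [^]\<^bsub>P\<^esub>
           (modular_inverse (int p) (2 * k) * int_cup l r s)) (gauge_cells l))"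

definition X_bar :: "nat \<Rightarrow> nat \<Rightarrow> int \<Rightarrow> cell \<Rightarrow> cell operator set" where
  "X_bar l p k s = (let Q = qudits l; P = pauli_mod Q p in
     X_cls Q p s \<otimes>\<^bsub>P\<^esub> gfinprod P (\<lambda>s'.
       (gfinprod P (\<lambda>r. gauge_op l p k r [^]\<^bsub>P\<^esub>
           (- modular_inverse (int p) 2 * int_cup l r s')) (gauge_cells l))
         [^]\<^bsub>P\<^esub> int_cup1 l (indicator {s'}) (indicator {s})) Q)"

end

theory Submission
  imports Defs
begin

text \<open>Modulo phases a Pauli operator is a pair \<open>(x, z)\<close> of finitely supported cochains, its
  X-exponents and its Z-exponents, and two such operators commute up to the root of unity
  \<open>exp (2 \<pi> \<i> / p)\<close> raised to \<open>\<langle>z, x'\<rangle> - \<langle>z', x\<rangle>\<close>. The theorem is therefore one of linear algebra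
  over the integers modulo \<open>p\<close>: a local map has to preserve this form and be surjective.

  For each \<open>m\<close>-cell \<open>s\<close> exactly one \<open>(m-1)\<close>-cell \<open>r\<close> has a nonzero integral of \<open>r \<union> s\<close>, and the
  integral is a sign. Let \<open>D s\<close> be this sign times the coboundary of \<open>r\<close> (\<open>dual_cob\<close>), and let
  \<open>U\<close> and \<open>W\<close> be the two adjoints of the bilinear form \<open>u(a, b)\<close>, the integral of the
  cup-1 product of \<open>a\<close> and \<open>b\<close> (\<open>cup1_right\<close>, \<open>cup1_left\<close>). Both families of operators in the
  theorem are the images of the generators under one map,
  \<open>F (x, z) = (x + q, z + k U q)\<close> with \<open>q = D (z / (2 k) - W x / 2)\<close>; see \<open>Z_bar_eq\<close> and \<open>X_bar_eq\<close>.

  Two identities of cochains carry the proof.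
  \<^item> \<open>u(D s, D t) = (D s)(t) - (D t)(s)\<close> (\<open>cup1_dual_cob\<close>). The cup-1 product is a homotopy between
    the cup product and the cup product with exchanged factors; on coboundaries of
    \<open>(m-1)\<close>-cells this says that \<open>u\<close> is the antisymmetrisation of a cup product with a coboundary.
  \<^item> The transpose of \<open>D\<close> is \<open>\<tau> D\<close>, where \<open>\<tau>\<close> translates by \<open>(1, ..., 1)\<close> (\<open>dual_cob_transpose\<close>).
    Integration by parts moves the coboundary to the other factor, and exchanging the factors of
    a cup product of total degree \<open>d\<close> shifts one of them by \<open>(1, ..., 1)\<close>.

  The first identity makes all correction terms in the form of two images cancel
  (\<open>commutator_form_F\<close>). On an infinite lattice this gives injectivity only. Together the two
  identities give \<open>D (U - W) D \<tau> = 2 (D - D \<tau>)\<close> (\<open>D_UW_D_T\<close>), and hence an explicit preimage: replace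
  \<open>q\<close> by \<open>- D \<tau> (z / (2 k) - W x / 2)\<close> (\<open>F_surj\<close>).

  The first identity is proved cell by cell. If the directions \<open>I\<close> and \<open>I'\<close> of two \<open>(m-1)\<close>-cells are
  disjoint, they miss one direction \<open>y\<close>; the cup-1 terms that share the direction \<open>t\<close> are differences of
  consecutive values of a step function of \<open>t\<close>, so they telescope up to a jump at \<open>y\<close>, and what is
  left at the two ends is one cup product each. If \<open>I\<close> and \<open>I'\<close> have one common direction, two terms
  survive and cancel; otherwise there are none.\<close>

section \<open>Finitely supported integer cochains\<close>

abbreviation coef :: "('a \<Rightarrow>\<^sub>0 int) \<Rightarrow> 'a \<Rightarrow> int" where "coef \<equiv> Poly_Mapping.lookup"
abbreviation supp :: "('a \<Rightarrow>\<^sub>0 int) \<Rightarrow> 'a set" where "supp \<equiv> Poly_Mapping.keys"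

definition pair :: "('a \<Rightarrow>\<^sub>0 int) \<Rightarrow> ('a \<Rightarrow> int) \<Rightarrow> int" where
  "pair z f = (\<Sum>i\<in>supp z. coef z i * f i)"

lemma pair_superset: "finite A \<Longrightarrow> supp z \<subseteq> A \<Longrightarrow> pair z f = (\<Sum>i\<in>A. coef z i * f i)"
  unfolding pair_def by (rule sum.mono_neutral_left) (auto simp: in_keys_iff)

lemma pair_zero [simp]: "pair 0 f = 0"
  by (simp add: pair_def)

lemma pair_frag_of [simp]: "pair (frag_of a) f = f a"
  by (simp add: pair_def)

lemma pair_add: "pair (a + b) f = pair a f + pair b f"
proof -
  have "finite (supp a \<union> supp b)" by simp
  then show ?thesis
    using pair_superset[of "supp a \<union> supp b" "a+b" f] pair_superset[of "supp a \<union> supp b" a f]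
      pair_superset[of "supp a \<union> supp b" b f] Poly_Mapping.keys_add[of a b]
    by (simp add: lookup_add algebra_simps sum.distrib)
qed

lemma pair_cmul: "pair (frag_cmul c a) f = c * pair a f"
  using pair_superset[of "supp a" "frag_cmul c a" f] keys_cmul[of c a]
  by (simp add: pair_def sum_distrib_left mult.assoc)

lemma pair_minus: "pair (- a) f = - pair a f"
  using pair_cmul[of "-1" a f] by simp

lemma pair_diff: "pair (a - b) f = pair a f - pair b f"
  using pair_add[of a "- b" f] by (simp add: pair_minus)

lemma pair_sum: "pair (\<Sum>i\<in>I. a i) f = (\<Sum>i\<in>I. pair (a i) f)"
  by (induction I rule: infinite_finite_induct) (auto simp: pair_add)

lemmas pair_linear = pair_add pair_cmul pair_minus pair_diff pair_sum

lemma pair_cong: "(\<And>i. i \<in> supp z \<Longrightarrow> f i = g i) \<Longrightarrow> pair z f = pair z g"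
  unfolding pair_def by (rule sum.cong) auto

lemma pair_commute: "pair z (coef x) = pair x (coef z)"
  using pair_superset[of "supp x \<union> supp z" x "coef z"] pair_superset[of "supp x \<union> supp z" z "coef x"]
  by (simp add: mult.commute)

lemma pair_frag_extend: "pair (frag_extend M x) f = pair x (\<lambda>s. pair (M s) f)"
  by (simp add: frag_extend_def pair_sum pair_cmul pair_def[of x])

lemma coef_frag_extend: "coef (frag_extend M x) t = pair x (\<lambda>s. coef (M s) t)"
  by (simp add: frag_extend_def lookup_sum pair_def)

lemma pair_coef_frag_of [simp]: "pair x (coef (frag_of a)) = coef x a"
  by (subst pair_commute) simp


section \<open>Inversion counts and signs\<close>

definition count_below :: "nat set \<Rightarrow> nat \<Rightarrow> nat" where "count_below I j = card {i\<in>I. i < j}"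
definition count_above :: "nat set \<Rightarrow> nat \<Rightarrow> nat" where "count_above I j = card {i\<in>I. j < i}"

lemma count_below_plus_above:
  assumes "finite I" "j \<notin> I" shows "count_below I j + count_above I j = card I"
proof -
  have "i < j \<or> j < i" if "i \<in> I" for i
  proof -
    have "i \<noteq> j" using that assms by blast
    then show ?thesis by linarith
  qed
  then have "{i\<in>I. i < j} \<union> {i\<in>I. j < i} = I" by fast
  moreover have "card ({i\<in>I. i < j} \<union> {i\<in>I. j < i}) = count_below I j + count_above I j"
    unfolding count_below_def count_above_def by (rule card_Un_disjoint) (auto simp: assms(1))
  ultimately show ?thesis by simp
qed

lemma count_below_insert: "finite I \<Longrightarrow> a \<notin> I \<Longrightarrow> count_below (insert a I) j = count_below I j + of_bool (a < j)"
proof -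
  assume "finite I" "a \<notin> I"
  moreover have "{i \<in> insert a I. i < j} = (if a < j then insert a {i\<in>I. i < j} else {i\<in>I. i < j})" by auto
  ultimately show ?thesis by (simp add: count_below_def)
qed

lemma card_le_insert: "finite I \<Longrightarrow> j \<notin> I \<Longrightarrow> card {i\<in>insert j I. i \<le> j} = Suc (count_below I j)"
proof -
  assume "finite I" "j \<notin> I"
  moreover have "{i\<in>insert j I. i \<le> j} = insert j {i\<in>I. i < j}" using \<open>j \<notin> I\<close> by (auto simp: le_less)
  ultimately show ?thesis by (simp add: count_below_def)
qed

lemma inv_count_finite: "finite J \<Longrightarrow> finite I \<Longrightarrow> finite {(j, i). j \<in> J \<and> i \<in> I \<and> j < (i::nat)}"
  by (rule finite_subset[of _ "J \<times> I"]) auto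

lemma inv_count_insert_left:
  assumes "finite J" "finite I" "a \<notin> J"
  shows "inv_count (insert a J) I = inv_count J I + count_above I a"
proof -
  have "{(j, i). j \<in> insert a J \<and> i \<in> I \<and> j < i} = {(j, i). j \<in> J \<and> i \<in> I \<and> j < i} \<union> Pair a ` {i\<in>I. a < i}"
    by auto
  moreover have "card (\<dots>) = inv_count J I + card (Pair a ` {i\<in>I. a < i})"
    unfolding inv_count_def
    by (rule card_Un_disjoint) (use assms inv_count_finite in auto)
  ultimately show ?thesis by (simp add: inv_count_def count_above_def card_image inj_on_def)
qed

lemma inv_count_insert_right:
  assumes "finite J" "finite I" "a \<notin> I"
  shows "inv_count J (insert a I) = inv_count J I + count_below J a"
proof -
  have "{(j, i). j \<in> J \<and> i \<in> insert a I \<and> j < i} = {(j, i). j \<in> J \<and> i \<in> I \<and> j < i} \<union> (\<lambda>j. (j, a)) ` {j\<in>J. j < a}"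
    by auto
  moreover have "card (\<dots>) = inv_count J I + card ((\<lambda>j. (j, a)) ` {j\<in>J. j < a})"
    unfolding inv_count_def
    by (rule card_Un_disjoint) (use assms inv_count_finite in auto)
  ultimately show ?thesis by (simp add: inv_count_def count_below_def card_image inj_on_def)
qed

lemma inv_count_swap:
  assumes "finite J" "finite I" "J \<inter> I = {}"
  shows "inv_count J I + inv_count I J = card J * card I"
proof -
  have "J \<times> I = {(j, i). j \<in> J \<and> i \<in> I \<and> j < i} \<union> prod.swap ` {(i, j). i \<in> I \<and> j \<in> J \<and> i < j}"
    using assms by (auto simp: image_iff nat_neq_iff)
  moreover have "card (\<dots>) = inv_count J I + card (prod.swap ` {(i, j). i \<in> I \<and> j \<in> J \<and> i < j})"
    unfolding inv_count_def
    by (rule card_Un_disjoint) (use assms inv_count_finite in auto)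
  ultimately show ?thesis
    using card_cartesian_product[of J I] by (simp add: inv_count_def card_image)
qed

lemma sign_eqI: "even (a + b) \<Longrightarrow> (-1) ^ a = ((-1) ^ b :: int)"
  by (auto simp: minus_one_power_iff)
lemma sign_minusI: "odd (a + b) \<Longrightarrow> (-1) ^ a = - ((-1) ^ b :: int)"
  by (auto simp: minus_one_power_iff)


section \<open>Coboundaries and cup-1 products of cells\<close>

definition unshift :: "(nat \<Rightarrow> int) \<Rightarrow> nat set \<Rightarrow> nat \<Rightarrow> int" where
  "unshift v I = (\<lambda>i. v i - of_bool (i \<in> I))"

text \<open>The coboundary of the indicator cochain of a cell, as a finite sum of cells; its values agree
  with \<open>coboundary\<close> by \<open>coboundary_indicator\<close>.\<close>

definition cob :: "nat \<Rightarrow> cell \<Rightarrow> (cell \<Rightarrow>\<^sub>0 int)" where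
  "cob d = (\<lambda>(v, I). \<Sum>j\<in>{1..d} - I. frag_cmul ((-1) ^ Suc (count_below I j))
     (frag_of (v, insert j I) - frag_of (unshift v {j}, insert j I)))"

text \<open>The integral of the cup-1 product of two \<open>(n+1)\<close>-cells with \<open>d = 2 n + 1\<close>. A sum over the common
  directions \<open>c\<close> stands in for a case distinction: it has at most one nonzero term.\<close>

definition cup1_entry :: "nat \<Rightarrow> nat \<Rightarrow> cell \<Rightarrow> cell \<Rightarrow> int" where
  "cup1_entry d n = (\<lambda>(w, K) (w', L). \<Sum>c\<in>K \<inter> L. of_bool (K \<union> L = {1..d} \<and> K \<inter> L = {c} \<and>
       unshift w {j\<in>L. c < j} = unshift w' {i\<in>K. i < c}) * (-1) ^ (n + inv_count (L - {c}) (K - {c})))"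

lemma cup1_entry_0: assumes "K \<union> L \<noteq> {1..d} \<or> card (K \<inter> L) \<noteq> 1" shows "cup1_entry d n (w, K) (w', L) = 0"
proof -
  have "\<not> (K \<union> L = {1..d} \<and> K \<inter> L = {c} \<and> unshift w {j\<in>L. c < j} = unshift w' {i\<in>K. i < c})" for c
    using assms by auto
  then show ?thesis unfolding cup1_entry_def prod.case
    by (simp only: of_bool_eq(1) mult_zero_left sum.neutral_const)
qed

lemma cup1_entry_1: assumes "K \<union> L = {1..d}" "K \<inter> L = {c}"
  shows "cup1_entry d n (w, K) (w', L) = of_bool (\<forall>i. w i - w' i = of_bool (i \<in> L \<and> c < i) - of_bool (i \<in> K \<and> i < c))
     * (-1) ^ (n + inv_count (L - {c}) (K - {c}))"
proof -
  have "unshift w {j\<in>L. c < j} = unshift w' {i\<in>K. i < c} \<longleftrightarrow>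
     (\<forall>i. w i - w' i = of_bool (i \<in> L \<and> c < i) - of_bool (i \<in> K \<and> i < c))"
    unfolding unshift_def fun_eq_iff by (intro all_cong1) auto
  with assms show ?thesis unfolding cup1_entry_def by simp
qed

text \<open>The part of the cup-1 product of the coboundaries of two \<open>n\<close>-cells that extends the first
  cell in direction \<open>j\<close> and the second in direction \<open>j'\<close>: a signed sum over two faces each.\<close>

definition cube_sum :: "nat \<Rightarrow> nat \<Rightarrow> cell \<Rightarrow> cell \<Rightarrow> nat \<Rightarrow> nat \<Rightarrow> int" where
  "cube_sum d n = (\<lambda>(v, I) (v', I') j j'. (-1) ^ (count_below I j + count_below I' j') *
     (cup1_entry d n (v, insert j I) (v', insert j' I') - cup1_entry d n (unshift v {j}, insert j I) (v', insert j' I')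
      - cup1_entry d n (v, insert j I) (unshift v' {j'}, insert j' I')
      + cup1_entry d n (unshift v {j}, insert j I) (unshift v' {j'}, insert j' I')))"

lemma pair_cob_cob:
  "pair (cob d r) (\<lambda>s. pair (cob d r') (\<lambda>s'. cup1_entry d n s s')) =
    (\<Sum>j\<in>{1..d} - snd r. \<Sum>j'\<in>{1..d} - snd r'. cube_sum d n r r' j j')"
  by (cases r; cases r')
     (simp add: cob_def pair_linear cube_sum_def sum_subtractf [symmetric] sum_distrib_left
        algebra_simps power_add)

lemma split_forall2: "(\<forall>k. P k) \<longleftrightarrow> P y \<and> P i \<and> (\<forall>k. k \<noteq> y \<and> k \<noteq> i \<longrightarrow> P k)"
  by metis
lemma split_forall1: "(\<forall>k. P k) \<longleftrightarrow> P y \<and> (\<forall>k. k \<noteq> y \<longrightarrow> P k)"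
  by metis

section \<open>Telescoping for cells with disjoint directions\<close>

locale complementary =
  fixes d n :: nat and v v' :: "nat \<Rightarrow> int" and I I' :: "nat set" and y :: nat
  assumes n: "card I = n" "card I' = n"
    and I: "I \<inter> I' = {}" "y \<notin> I" "y \<notin> I'" "insert y (I \<union> I') = {1..d}"
begin

lemma fin: "finite I" "finite I'"
  using I(4) by (metis finite_Un finite_atLeastAtMost finite_insert)+

text \<open>The position of the two cells relative to each other in all directions but \<open>y\<close>. As \<open>t\<close> grows,
  this condition moves from the position where the second cell precedes the first (\<open>t = 0\<close>) to
  the opposite one (\<open>t = d\<close>), changing one direction at a time.\<close>

definition step :: "nat \<Rightarrow> int" where
  "step t = of_bool (\<forall>i. i \<noteq> y \<longrightarrow> v i - v' i = (if i \<in> I \<and> i \<le> t then -1 else if i \<in> I' \<and> t < i then 1 else 0))"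

definition sg :: int where "sg = (-1) ^ (count_below I y + count_below I' y + n + inv_count I' I)"

abbreviation "T \<equiv> cube_sum d n (v, I) (v', I')"

text \<open>The three families of nonzero terms carry the same sign \<open>sg\<close>; this independence of the shared
  direction is what makes the sum telescope.\<close>

lemma T_middle: "T y y = sg * step y * (2 * of_bool (v y = v' y) - of_bool (v y - v' y = 1) - of_bool (v y - v' y = -1))"
proof -
  have 1: "insert y I \<union> insert y I' = {1..d}" "insert y I \<inter> insert y I' = {y}" using I by auto
  have 2: "insert y I - {y} = I" "insert y I' - {y} = I'" using I by auto
  have *: "of_bool (\<forall>i. (v i - a * of_bool (i = y)) - (v' i - b * of_bool (i = y)) = of_bool (i \<in> insert y I' \<and> y < i) - of_bool (i \<in> insert y I \<and> i < y))
      = step y * of_bool (v y - v' y = a - b)" for a b :: int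
    unfolding step_def
    by (subst split_forall1[of _ y]) (use I in \<open>auto simp: of_bool_def\<close>)
  note ** = *[of 0 0] *[of 0 1] *[of 1 0] *[of 1 1]
  show ?thesis
    unfolding cube_sum_def prod.case cup1_entry_1[OF 1] 2
    using ** by (simp add: unshift_def sg_def power_add algebra_simps)
qed


lemma step_before: "i \<in> I \<or> i \<in> I' \<Longrightarrow> step (i - 1) =
   of_bool (\<forall>k. k \<noteq> y \<and> k \<noteq> i \<longrightarrow> v k - v' k = (if k \<in> I \<and> k \<le> i then -1 else if k \<in> I' \<and> i < k then 1 else 0))
   * of_bool (v i - v' i = of_bool (i \<in> I'))"
proof -
  assume i: "i \<in> I \<or> i \<in> I'"
  then have "i \<in> {1..d}" using I(4) by blast
  then have 1: "k \<le> i - 1 \<longleftrightarrow> k < i" "i - 1 < k \<longleftrightarrow> i \<le> k" for k by auto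
  have "i \<noteq> y" "\<not> (i \<in> I \<and> i \<in> I')" using i I by auto
  then have A: "(i \<noteq> y \<longrightarrow> v i - v' i = (if i \<in> I \<and> i < i then -1 else if i \<in> I' \<and> i \<le> i then 1 else 0))
      \<longleftrightarrow> v i - v' i = of_bool (i \<in> I')" by simp
  have B: "(\<forall>k. k \<noteq> i \<longrightarrow> k \<noteq> y \<longrightarrow> v k - v' k = (if k \<in> I \<and> k < i then -1 else if k \<in> I' \<and> i \<le> k then 1 else 0)) \<longleftrightarrow>
      (\<forall>k. k \<noteq> y \<and> k \<noteq> i \<longrightarrow> v k - v' k = (if k \<in> I \<and> k \<le> i then -1 else if k \<in> I' \<and> i < k then 1 else 0))"
    by (intro all_cong1) (auto simp: le_less)
  show ?thesis unfolding step_def 1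
    by (subst split_forall1[of _ i]) (simp only: A B of_bool_conj mult.commute)
qed

lemma step_after: "i \<in> I \<or> i \<in> I' \<Longrightarrow> step i =
   of_bool (\<forall>k. k \<noteq> y \<and> k \<noteq> i \<longrightarrow> v k - v' k = (if k \<in> I \<and> k \<le> i then -1 else if k \<in> I' \<and> i < k then 1 else 0))
   * of_bool (v i - v' i = - of_bool (i \<in> I))"
proof -
  assume i: "i \<in> I \<or> i \<in> I'"
  show ?thesis unfolding step_def
    by (subst split_forall1[of _ i]) (use i I in \<open>auto simp: of_bool_def\<close>)
qed

definition side :: "nat \<Rightarrow> int" where
  "side t = (if t < y then of_bool (v y = v' y) - of_bool (v y - v' y = 1)
     else of_bool (v y - v' y = -1) - of_bool (v y = v' y))"

lemma T_left:
  assumes i: "i \<in> I" shows "T y i = sg * (step (i - 1) - step i) * side i"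
proof -
  have [simp]: "i \<noteq> y" "y \<noteq> i" "i \<notin> I'" using i I by auto
  have 1: "insert y I \<union> insert i I' = {1..d}" "insert y I \<inter> insert i I' = {i}" using I i by auto
  have 2: "insert y I - {i} = insert y (I - {i})" "insert i I' - {i} = I'" using i I by auto
  define O' :: int where "O' = of_bool (\<forall>k. k \<noteq> y \<and> k \<noteq> i \<longrightarrow> v k - v' k = (if k \<in> I \<and> k \<le> i then -1 else if k \<in> I' \<and> i < k then 1 else 0))"
  have disj: "\<not> (k \<in> I \<and> k \<in> I')" for k using I by blast
  have *: "of_bool (\<forall>k. (v k - a * of_bool (k = y)) - (v' k - b * of_bool (k = i)) = of_bool (k \<in> insert i I' \<and> i < k) - of_bool (k \<in> insert y I \<and> k < i))
      = O' * of_bool (v y - v' y = a - of_bool (y < i)) * of_bool (v i - v' i = - b)"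
    (is "of_bool (\<forall>k. ?P k) = _ * of_bool ?Y * of_bool ?Q") for a b :: int
  proof -
    have Y: "?P y \<longleftrightarrow> ?Y" and Q: "?P i \<longleftrightarrow> ?Q" using i I by auto
    have R: "(\<forall>k. k \<noteq> y \<and> k \<noteq> i \<longrightarrow> ?P k) \<longleftrightarrow>
        (\<forall>k. k \<noteq> y \<and> k \<noteq> i \<longrightarrow> v k - v' k = (if k \<in> I \<and> k \<le> i then -1 else if k \<in> I' \<and> i < k then 1 else 0))"
      using disj by (intro all_cong1) (auto simp: le_less)
    show ?thesis unfolding O'_def
      by (subst split_forall2[of _ y i], unfold Y Q R) (simp only: of_bool_conj mult_ac)
  qed
  note ** = *[of 0 0] *[of 0 1] *[of 1 0] *[of 1 1]
  have sgn: "(-1) ^ (count_below I y + count_below I' i + (n + inv_count I' (insert y (I - {i})))) = sg"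
  proof -
    have "inv_count I' (insert y (I - {i})) + count_below I' i = inv_count I' I + count_below I' y"
      using inv_count_insert_right[of I' "I - {i}" i] inv_count_insert_right[of I' "I - {i}" y] fin i I
      by (simp add: insert_absorb)
    then show ?thesis unfolding sg_def by (intro sign_eqI) presburger
  qed
  have st: "step (i - 1) = O' * of_bool (v i = v' i)" "step i = O' * of_bool (v i - v' i = - 1)"
    using step_before[of i] step_after[of i] i by (simp_all add: O'_def)
  have "T y i = (-1) ^ (count_below I y + count_below I' i + (n + inv_count I' (insert y (I - {i})))) *
     (O' * of_bool (v i = v' i) - O' * of_bool (v i - v' i = - 1)) * side i"
    unfolding cube_sum_def prod.case cup1_entry_1[OF 1] 2
    using ** i I by (cases "i < y") (simp_all add: unshift_def side_def power_add algebra_simps)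
  then show ?thesis unfolding sgn st .
qed

lemma T_right:
  assumes i: "i \<in> I'" shows "T i y = sg * (step (i - 1) - step i) * side i"
proof -
  have [simp]: "i \<noteq> y" "y \<noteq> i" "i \<notin> I" using i I by auto
  have 1: "insert i I \<union> insert y I' = {1..d}" "insert i I \<inter> insert y I' = {i}" using I i by auto
  have 2: "insert i I - {i} = I" "insert y I' - {i} = insert y (I' - {i})" using i I by auto
  define O' :: int where "O' = of_bool (\<forall>k. k \<noteq> y \<and> k \<noteq> i \<longrightarrow> v k - v' k = (if k \<in> I \<and> k \<le> i then -1 else if k \<in> I' \<and> i < k then 1 else 0))"
  have disj: "\<not> (k \<in> I \<and> k \<in> I')" for k using I by blast
  have *: "of_bool (\<forall>k. (v k - a * of_bool (k = i)) - (v' k - b * of_bool (k = y)) = of_bool (k \<in> insert y I' \<and> i < k) - of_bool (k \<in> insert i I \<and> k < i))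
      = O' * of_bool (v y - v' y = of_bool (i < y) - b) * of_bool (v i - v' i = a)"
    (is "of_bool (\<forall>k. ?P k) = _ * of_bool ?Y * of_bool ?Q") for a b :: int
  proof -
    have Y: "?P y \<longleftrightarrow> ?Y" and Q: "?P i \<longleftrightarrow> ?Q" using i I by auto
    have R: "(\<forall>k. k \<noteq> y \<and> k \<noteq> i \<longrightarrow> ?P k) \<longleftrightarrow>
        (\<forall>k. k \<noteq> y \<and> k \<noteq> i \<longrightarrow> v k - v' k = (if k \<in> I \<and> k \<le> i then -1 else if k \<in> I' \<and> i < k then 1 else 0))"
      using disj by (intro all_cong1) (auto simp: le_less)
    show ?thesis unfolding O'_def
      by (subst split_forall2[of _ y i], unfold Y Q R) (simp only: of_bool_conj mult_ac)
  qed
  note ** = *[of 0 0] *[of 0 1] *[of 1 0] *[of 1 1]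
  have sgn: "(-1) ^ (count_below I i + count_below I' y + (n + inv_count (insert y (I' - {i})) I)) = sg"
  proof -
    have "inv_count (insert y (I' - {i})) I + count_above I i = inv_count I' I + count_above I y"
      using inv_count_insert_left[of "I' - {i}" I i] inv_count_insert_left[of "I' - {i}" I y] fin i I
      by (simp add: insert_absorb)
    moreover have "count_below I i + count_above I i = count_below I y + count_above I y"
      using count_below_plus_above[of I] fin I by simp
    ultimately show ?thesis unfolding sg_def by (intro sign_eqI) presburger
  qed
  have st: "step (i - 1) = O' * of_bool (v i - v' i = 1)" "step i = O' * of_bool (v i = v' i)"
    using step_before[of i] step_after[of i] i by (simp_all add: O'_def)
  have "T i y = (-1) ^ (count_below I i + count_below I' y + (n + inv_count (insert y (I' - {i})) I)) *
     (O' * of_bool (v i - v' i = 1) - O' * of_bool (v i = v' i)) * side i"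
    unfolding cube_sum_def prod.case cup1_entry_1[OF 1] 2
    using ** i I by (cases "i < y") (simp_all add: unshift_def side_def power_add algebra_simps)
  then show ?thesis unfolding sgn st .
qed

lemma T_other: assumes "i \<in> I" "i' \<in> I'" shows "T i' i = 0"
proof -
  have "y \<notin> insert i' I \<union> insert i I'" using I(2,3) assms by auto
  then have "insert i' I \<union> insert i I' \<noteq> {1..d}" using I(4) by blast
  then show ?thesis unfolding cube_sum_def by (simp add: cup1_entry_0)
qed

lemma telescope: "a \<le> b \<Longrightarrow> (\<Sum>t\<in>{a<..b}. step (t - 1) - step t) = step a - step (b::nat)"
proof (induction b)
  case (Suc b)
  show ?case
  proof (cases "a = Suc b")
    case False
    then have "{a<..Suc b} = insert (Suc b) {a<..b}" using Suc.prems by auto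
    then show ?thesis using Suc False by simp
  qed simp
qed simp

text \<open>The factor \<open>side\<close> jumps from one first difference in direction \<open>y\<close> to the adjacent one, and the
  middle term is the second difference that compensates for the jump; only \<open>step 0\<close> and \<open>step d\<close>
  remain.\<close>

lemma sum_T: "(\<Sum>j\<in>{1..d} - I. \<Sum>j'\<in>{1..d} - I'. T j j') =
   sg * (step 0 * (of_bool (v y = v' y) - of_bool (v y - v' y = 1))
       + step d * (of_bool (v y = v' y) - of_bool (v y - v' y = -1)))"
proof -
  have eq: "{1..d} - I = insert y I'" "{1..d} - I' = insert y I" using I by auto
  have "y \<in> {1..d}" using I(4) by blast
  then have y: "1 \<le> y" "y \<le> d" by auto
  have un: "I \<union> I' = {0<..y - 1} \<union> {y<..d}"
  proof -
    have "I \<union> I' = {1..d} - {y}" using I by auto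
    moreover have "{1..d} - {y} = {0<..y - 1} \<union> {y<..d}" using y by auto
    ultimately show ?thesis by simp
  qed
  let ?a = "of_bool (v y = v' y) - of_bool (v y - v' y = 1) :: int"
  let ?b = "of_bool (v y - v' y = -1) - of_bool (v y = v' y) :: int"
  have "(\<Sum>j\<in>{1..d} - I. \<Sum>j'\<in>{1..d} - I'. T j j') =
      T y y + (\<Sum>i\<in>I. T y i) + (\<Sum>i'\<in>I'. T i' y)"
    unfolding eq using fin I by (simp add: T_other)
  also have "(\<Sum>i\<in>I. T y i) = (\<Sum>i\<in>I. sg * (step (i - 1) - step i) * side i)"
    by (rule sum.cong) (auto simp: T_left)
  also have "(\<Sum>i\<in>I'. T i y) = (\<Sum>i\<in>I'. sg * (step (i - 1) - step i) * side i)"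
    by (rule sum.cong) (auto simp: T_right)
  also have "T y y + (\<Sum>i\<in>I. sg * (step (i - 1) - step i) * side i) + (\<Sum>i\<in>I'. sg * (step (i - 1) - step i) * side i)
     = T y y + (\<Sum>i\<in>I \<union> I'. sg * (step (i - 1) - step i) * side i)"
    using fin I by (subst sum.union_disjoint) auto
  also have "(\<Sum>i\<in>I \<union> I'. sg * (step (i - 1) - step i) * side i) =
      (\<Sum>i\<in>{0<..y - 1}. sg * (step (i - 1) - step i) * side i) + (\<Sum>i\<in>{y<..d}. sg * (step (i - 1) - step i) * side i)"
    unfolding un by (subst sum.union_disjoint) auto
  also have "(\<Sum>i\<in>{0<..y - 1}. sg * (step (i - 1) - step i) * side i) = sg * ?a * (\<Sum>i\<in>{0<..y - 1}. step (i - 1) - step i)"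
    unfolding sum_distrib_left by (rule sum.cong) (use y in \<open>auto simp: side_def\<close>)
  also have "(\<Sum>i\<in>{y<..d}. sg * (step (i - 1) - step i) * side i) = sg * ?b * (\<Sum>i\<in>{y<..d}. step (i - 1) - step i)"
    unfolding sum_distrib_left by (rule sum.cong) (auto simp: side_def)
  also have "(\<Sum>i\<in>{0<..y - 1}. step (i - 1) - step i) = step 0 - step (y - 1)" by (rule telescope) simp
  also have "(\<Sum>i\<in>{y<..d}. step (i - 1) - step i) = step y - step d" using y by (intro telescope) simp
  also have "step (y - 1) = step y"
  proof -
    have "i \<noteq> y \<Longrightarrow> i \<le> y - 1 \<longleftrightarrow> i \<le> y" "i \<noteq> y \<Longrightarrow> y - 1 < i \<longleftrightarrow> y < i" for i using y by auto
    then show ?thesis unfolding step_def by (intro arg_cong[of _ _ of_bool] all_cong1) auto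
  qed
  finally show ?thesis unfolding T_middle by (simp add: algebra_simps)
qed

end

lemma coef_cob_insert:
  assumes "j \<in> {1..d} - I"
  shows "coef (cob d (v, I)) (v', insert j I) = (-1) ^ Suc (count_below I j) * (of_bool (v' = v) - of_bool (v' = unshift v {j}))"
proof -
  have "coef (cob d (v, I)) (v', insert j I) = (\<Sum>i\<in>{1..d} - I. if i = j then
      (-1) ^ Suc (count_below I j) * (of_bool (v' = v) - of_bool (v' = unshift v {j})) else 0)"
    unfolding cob_def prod.case lookup_sum
  proof (rule sum.cong)
    fix i assume "i \<in> {1..d} - I"
    then have "insert j I = insert i I \<longleftrightarrow> i = j" using assms by blast
    then show "coef (frag_cmul ((- 1) ^ Suc (count_below I i)) (frag_of (v, insert i I) - frag_of (unshift v {i}, insert i I))) (v', insert j I) =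
       (if i = j then (-1) ^ Suc (count_below I j) * (of_bool (v' = v) - of_bool (v' = unshift v {j})) else 0)"
      by (simp add: lookup_minus)
  qed simp
  also have "\<dots> = (-1) ^ Suc (count_below I j) * (of_bool (v' = v) - of_bool (v' = unshift v {j}))"
    using assms by (subst sum.delta) auto
  finally show ?thesis .
qed

lemma coef_cob_0:
  assumes "\<And>j. j \<in> {1..d} - I \<Longrightarrow> J \<noteq> insert j I"
  shows "coef (cob d (v, I)) (v', J) = 0"
  unfolding cob_def prod.case lookup_sum
  by (rule sum.neutral) (use assms in \<open>auto simp: lookup_minus\<close>)

section \<open>The cup-1 product of two coboundaries\<close>

context complementary begin

text \<open>The parity of \<open>n\<close> enters here: exchanging two sets of \<open>n\<close> directions changes an inversion count
  by \<open>n * n\<close>, and moving \<open>y\<close> past one of them changes it by \<open>n\<close>.\<close>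

lemma sgn_right:
  assumes "odd n" shows "sg = (-1) ^ inv_count (insert y I) I' * (-1) ^ Suc (count_below I y)"
proof -
  have "inv_count (insert y I) I' = inv_count I I' + count_above I' y"
    using inv_count_insert_left[of I I' y] fin I by simp
  moreover have "count_below I' y + count_above I' y = n" using count_below_plus_above[of I' y] fin I n by simp
  moreover have "inv_count I I' + inv_count I' I = n * n" using inv_count_swap[of I I'] fin I n by simp
  moreover have "odd (n * n)" using assms by simp
  ultimately show ?thesis using assms unfolding sg_def power_add[symmetric]
    by (intro sign_eqI) presburger
qed

lemma sgn_left:
  assumes "odd n" shows "sg = - ((-1) ^ inv_count (insert y I') I * (-1) ^ Suc (count_below I' y))"
proof -
  have "inv_count (insert y I') I = inv_count I' I + count_above I y"
    using inv_count_insert_left[of I' I y] fin I by simp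
  moreover have "count_below I y + count_above I y = n" using count_below_plus_above[of I y] fin I n by simp
  ultimately show ?thesis using assms unfolding sg_def power_add[symmetric]
    by (intro sign_minusI) presburger
qed

lemma step_0: "step 0 * of_bool (v y - v' y = a) = of_bool (\<forall>i. v i - v' i = (if i = y then a else of_bool (i \<in> I')))"
proof -
  have "0 \<notin> insert y (I \<union> I')" unfolding I(4) by simp
  then have "\<not> (i \<in> I \<and> i \<le> 0)" "i \<in> I' \<and> 0 < i \<longleftrightarrow> i \<in> I'" for i
    by (cases "i = 0"; simp)+
  then have "(\<forall>i. i \<noteq> y \<longrightarrow> v i - v' i = (if i \<in> I \<and> i \<le> 0 then -1 else if i \<in> I' \<and> 0 < i then 1 else 0))
     \<longleftrightarrow> (\<forall>i. i \<noteq> y \<longrightarrow> v i - v' i = (if i = y then a else of_bool (i \<in> I')))"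
    by (intro all_cong1) auto
  then show ?thesis unfolding step_def
    by (subst split_forall1[of _ y]) (simp add: mult.commute flip: of_bool_conj)
qed

lemma step_d: "step d * of_bool (v y - v' y = a) = of_bool (\<forall>i. v i - v' i = (if i = y then a else - of_bool (i \<in> I)))"
proof -
  have "i \<le> d" if "i \<in> insert y (I \<union> I')" for i using that unfolding I(4) by simp
  then have "i \<in> I \<and> i \<le> d \<longleftrightarrow> i \<in> I" "\<not> (i \<in> I' \<and> d < i)" for i
    by (auto simp: not_less)
  then have "(\<forall>i. i \<noteq> y \<longrightarrow> v i - v' i = (if i \<in> I \<and> i \<le> d then -1 else if i \<in> I' \<and> d < i then 1 else 0))
     \<longleftrightarrow> (\<forall>i. i \<noteq> y \<longrightarrow> v i - v' i = (if i = y then a else - of_bool (i \<in> I)))"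
    by (intro all_cong1) auto
  then show ?thesis unfolding step_def
    by (subst split_forall1[of _ y]) (simp add: mult.commute flip: of_bool_conj)
qed

lemma sum_T_cup:
  assumes "odd n"
  shows "(\<Sum>j\<in>{1..d} - I. \<Sum>j'\<in>{1..d} - I'. T j j') =
    (-1) ^ inv_count ({1..d} - I') I' * coef (cob d (v, I)) (shift v' I', {1..d} - I')
    - (-1) ^ inv_count ({1..d} - I) I * coef (cob d (v', I')) (shift v I, {1..d} - I)"
proof -
  have eq: "{1..d} - I = insert y I'" "{1..d} - I' = insert y I" using I by auto
  have y: "y \<in> {1..d} - I" "y \<in> {1..d} - I'" using I by auto
  have 1: "shift v' I' = v \<longleftrightarrow> (\<forall>i. v i - v' i = (if i = y then 0 else of_bool (i \<in> I')))"
    "shift v' I' = unshift v {y} \<longleftrightarrow> (\<forall>i. v i - v' i = (if i = y then 1 else of_bool (i \<in> I')))"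
    "shift v I = v' \<longleftrightarrow> (\<forall>i. v i - v' i = (if i = y then 0 else - of_bool (i \<in> I)))"
    "shift v I = unshift v' {y} \<longleftrightarrow> (\<forall>i. v i - v' i = (if i = y then -1 else - of_bool (i \<in> I)))"
    unfolding shift_def unshift_def fun_eq_iff by (intro all_cong1; use I in auto)+
  have 0: "of_bool (v y = v' y) = (of_bool (v y - v' y = 0) :: int)" by simp
  show ?thesis unfolding eq coef_cob_insert[OF y(1)] coef_cob_insert[OF y(2)]
    unfolding sum_T[unfolded eq] 0 right_diff_distrib step_0 step_d 1
    using sgn_right[OF assms] sgn_left[OF assms] by (simp add: algebra_simps)
qed

end

text \<open>With one common direction \<open>c\<close> and two missing directions \<open>y\<close> and \<open>z\<close>, each missing direction has to be
  added to a different cell. In direction \<open>y\<close> both assignments give the same first difference up to a sign,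
  likewise in direction \<open>z\<close>, and the exchange of \<open>y\<close> and \<open>z\<close> in the orientation contributes the remaining sign.\<close>

lemma sum_T_overlap:
  assumes n: "card I = n" "card I' = n" and sub: "I \<subseteq> {1..d}" "I' \<subseteq> {1..d}"
    and c: "I \<inter> I' = {c}" and yz: "{1..d} - (I \<union> I') = {y, z}" "y \<noteq> z"
  shows "cube_sum d n (v, I) (v', I') y z = - cube_sum d n (v, I) (v', I') z y"
proof -
  have fin: "finite I" "finite I'" using sub finite_subset by blast+
  have cc: "c \<in> I" "c \<in> I'" "y \<noteq> c" "z \<noteq> c" "y \<notin> I" "y \<notin> I'" "z \<notin> I" "z \<notin> I'" using c yz by auto
  define A B where "A = I - {c}" and "B = I' - {c}"
  have I: "I = insert c A" "I' = insert c B" "c \<notin> A" "c \<notin> B" "y \<notin> A" "y \<notin> B" "z \<notin> A" "z \<notin> B" "A \<inter> B = {}"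
    using cc c by (auto simp: A_def B_def)
  have finAB: "finite A" "finite B" using fin by (auto simp: A_def B_def)
  have tot: "{1..d} = insert y (insert z (I \<union> I'))" using yz(1) sub by (metis Diff_partition Un_insert_right Un_least sup_bot_right)
  have un: "insert y I \<union> insert z I' = {1..d}" "insert z I \<union> insert y I' = {1..d}" unfolding tot by auto
  have int: "insert y I \<inter> insert z I' = {c}" "insert z I \<inter> insert y I' = {c}" using c yz by auto
  have rem: "insert y I - {c} = insert y A" "insert z I - {c} = insert z A"
     "insert y I' - {c} = insert y B" "insert z I' - {c} = insert z B" using I cc by auto
  define O' :: int where "O' = of_bool (\<forall>k. k \<noteq> y \<and> k \<noteq> z \<longrightarrow> v k - v' k = of_bool (k \<in> I' \<and> c < k) - of_bool (k \<in> I \<and> k < c))"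
  have key: "cube_sum d n (v, I) (v', I') y z =
     (-1) ^ (count_below I y + count_below I' z + (n + inv_count (insert z B) (insert y A))) * O' *
       (of_bool (v y - v' y = - of_bool (y < c)) - of_bool (v y - v' y = 1 - of_bool (y < c))) *
       (of_bool (v z - v' z = of_bool (c < z)) - of_bool (v z - v' z = of_bool (c < z) - 1))"
    if un: "insert y I \<union> insert z I' = {1..d}" and int: "insert y I \<inter> insert z I' = {c}" and "y \<noteq> z"
      and ny: "y \<notin> I" "y \<notin> I'" "z \<notin> I" "z \<notin> I'"
      and rem: "insert y I - {c} = insert y A" "insert z I' - {c} = insert z B"
      and O': "O' = of_bool (\<forall>k. k \<noteq> y \<and> k \<noteq> z \<longrightarrow> v k - v' k = of_bool (k \<in> I' \<and> c < k) - of_bool (k \<in> I \<and> k < c))"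
    for y z
  proof -
    have [simp]: "z \<noteq> y" using that by simp
    have *: "of_bool (\<forall>k. (v k - a * of_bool (k = y)) - (v' k - b * of_bool (k = z)) = of_bool (k \<in> insert z I' \<and> c < k) - of_bool (k \<in> insert y I \<and> k < c))
      = O' * of_bool (v y - v' y = a - of_bool (y < c)) * of_bool (v z - v' z = of_bool (c < z) - b)"
      (is "of_bool (\<forall>k. ?P k) = _ * of_bool ?Y * of_bool ?Q") for a b :: int
    proof -
      have Y: "?P y \<longleftrightarrow> ?Y" and Q: "?P z \<longleftrightarrow> ?Q" using ny \<open>y \<noteq> z\<close> by auto
      have R: "(\<forall>k. k \<noteq> y \<and> k \<noteq> z \<longrightarrow> ?P k) \<longleftrightarrow>
        (\<forall>k. k \<noteq> y \<and> k \<noteq> z \<longrightarrow> v k - v' k = of_bool (k \<in> I' \<and> c < k) - of_bool (k \<in> I \<and> k < c))"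
        by (intro all_cong1) auto
      show ?thesis unfolding O'
        by (subst split_forall2[of _ y z], unfold Y Q R) (simp only: of_bool_conj mult_ac)
    qed
    note ** = *[of 0 0] *[of 0 1] *[of 1 0] *[of 1 1]
    show ?thesis
      unfolding cube_sum_def prod.case cup1_entry_1[OF un int] rem
      using ** by (simp add: unshift_def power_add algebra_simps)
  qed
  have O'2: "O' = of_bool (\<forall>k. k \<noteq> z \<and> k \<noteq> y \<longrightarrow> v k - v' k = of_bool (k \<in> I' \<and> c < k) - of_bool (k \<in> I \<and> k < c))"
    unfolding O'_def by (intro arg_cong[of _ _ of_bool] all_cong1) auto
  have k1: "cube_sum d n (v, I) (v', I') y z = (-1) ^ (count_below I y + count_below I' z + (n + inv_count (insert z B) (insert y A))) * O' *
       (of_bool (v y - v' y = - of_bool (y < c)) - of_bool (v y - v' y = 1 - of_bool (y < c))) *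
       (of_bool (v z - v' z = of_bool (c < z)) - of_bool (v z - v' z = of_bool (c < z) - 1))"
    by (rule key) (use un int rem cc yz O'_def in auto)
  have k2: "cube_sum d n (v, I) (v', I') z y = (-1) ^ (count_below I z + count_below I' y + (n + inv_count (insert y B) (insert z A))) * O' *
       (of_bool (v z - v' z = - of_bool (z < c)) - of_bool (v z - v' z = 1 - of_bool (z < c))) *
       (of_bool (v y - v' y = of_bool (c < y)) - of_bool (v y - v' y = of_bool (c < y) - 1))"
    by (rule key) (use un int rem cc yz O'2 in auto)
  have flip: "of_bool (a = of_bool (c < x)) - of_bool (a = of_bool (c < x) - (1::int)) =
      - (of_bool (a = - of_bool (x < c)) - of_bool (a = 1 - of_bool (x < c)) :: int)" if "x \<noteq> c" for a x
    using that by (cases "x < c") auto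
  have sgn: "(-1) ^ (count_below I y + count_below I' z + (n + inv_count (insert z B) (insert y A))) =
     - ((-1) ^ (count_below I z + count_below I' y + (n + inv_count (insert y B) (insert z A))) :: int)"
  proof (rule sign_minusI)
    have 1: "inv_count (insert z B) (insert y A) = inv_count B A + count_below B y + count_above A z + of_bool (z < y)"
      if "z \<notin> B" "y \<notin> A" for y z using that finAB
      by (simp add: inv_count_insert_left inv_count_insert_right count_below_insert)
    have 2: "count_below I y = count_below A y + of_bool (c < y)" "count_below I' y = count_below B y + of_bool (c < y)" for y
      unfolding I(1,2) using I finAB by (simp_all add: count_below_insert)
    have 3: "count_below A y + count_above A y = card A" "count_below A z + count_above A z = card A" using I finAB count_below_plus_above by auto
    have 4: "of_bool (z < y) + of_bool (y < z) = (1::nat)" using yz by auto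
    show "odd (count_below I y + count_below I' z + (n + inv_count (insert z B) (insert y A)) + (count_below I z + count_below I' y + (n + inv_count (insert y B) (insert z A))))"
      using 3 4 unfolding 1[OF I(8,5)] 1[OF I(6,7)] 2 by presburger
  qed
  show ?thesis unfolding k1 k2 sgn flip[OF cc(3)] flip[OF cc(4)] by (simp add: algebra_simps)
qed

lemma cube_sum_0: assumes "insert j I \<union> insert j' I' \<noteq> {1..d} \<or> card (insert j I \<inter> insert j' I') \<noteq> 1"
  shows "cube_sum d n (v, I) (v', I') j j' = 0"
  using assms unfolding cube_sum_def by (simp add: cup1_entry_0)

text \<open>On coboundaries the cup-1 product is the difference of the two orders of the cup product.
  The right-hand side evaluates the coboundary of one cell on the unique cell whose cup product
  with the other one is nonzero.\<close>

lemma cup1_cob: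
  assumes d: "d = 2 * n + 1" "odd n" and n: "card I = n" "card I' = n" and sub: "I \<subseteq> {1..d}" "I' \<subseteq> {1..d}"
  shows "pair (cob d (v, I)) (\<lambda>s. pair (cob d (v', I')) (\<lambda>s'. cup1_entry d n s s')) =
    (-1) ^ inv_count ({1..d} - I') I' * coef (cob d (v, I)) (shift v' I', {1..d} - I')
    - (-1) ^ inv_count ({1..d} - I) I * coef (cob d (v', I')) (shift v I, {1..d} - I)"
proof -
  have fin: "finite I" "finite I'" using sub finite_subset by blast+
  have c1: "card (I \<union> I') + card (I \<inter> I') = 2 * n" using card_Un_Int[OF fin] n by simp
  have "card ({1..d} - (I \<union> I')) + card (I \<union> I') = d"
    using card_Diff_subset[of "I \<union> I'" "{1..d}"] fin sub card_mono[of "{1..d}" "I \<union> I'"] by simp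
  with c1 have c2: "card ({1..d} - (I \<union> I')) = Suc (card (I \<inter> I'))" using d(1) by simp
  show ?thesis
  proof (cases "I \<inter> I' = {}")
    case True
    with c2 have "card ({1..d} - (I \<union> I')) = 1" by simp
    then obtain y where y: "{1..d} - (I \<union> I') = {y}" by (auto simp: card_1_singleton_iff)
    interpret complementary d n v v' I I' y
      by unfold_locales (use n True y sub in auto)
    show ?thesis using sum_T_cup[OF d(2)] unfolding pair_cob_cob by simp
  next
    case False
    have 0: "coef (cob d (v, I)) (w, {1..d} - I') = 0" if "I \<inter> I' \<noteq> {}" for v w I I'
      by (rule coef_cob_0) (use that in auto)
    have r: "coef (cob d (v, I)) (shift v' I', {1..d} - I') = 0" "coef (cob d (v', I')) (shift v I, {1..d} - I) = 0"
      using 0 False by (auto simp: Int_commute)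
    have "(\<Sum>j\<in>{1..d} - I. \<Sum>j'\<in>{1..d} - I'. cube_sum d n (v, I) (v', I') j j') = 0"
    proof (cases "card (I \<inter> I') = 1")
      case True
      then obtain c where c: "I \<inter> I' = {c}" by (auto simp: card_1_singleton_iff)
      from True c2 have "card ({1..d} - (I \<union> I')) = 2" by simp
      then obtain y z where yz: "{1..d} - (I \<union> I') = {y, z}" "y \<noteq> z" by (auto simp: card_2_iff)
      have zero: "cube_sum d n (v, I) (v', I') j j' = 0" if "\<not> (j = y \<and> j' = z \<or> j = z \<and> j' = y)" for j j'
      proof (rule cube_sum_0, rule disjI1, rule notI)
        assume *: "insert j I \<union> insert j' I' = {1..d}"
        have "y \<in> {1..d}" "z \<in> {1..d}" "y \<notin> I \<union> I'" "z \<notin> I \<union> I'" using yz by auto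
        then have "y = j \<or> y = j'" "z = j \<or> z = j'" unfolding *[symmetric] by blast+
        then show False using that yz(2) by auto
      qed
      have eq: "(\<Sum>j'\<in>{1..d} - I'. cube_sum d n (v, I) (v', I') j j') = 
         (if j = y then cube_sum d n (v, I) (v', I') y z else if j = z then cube_sum d n (v, I) (v', I') z y else 0)" for j
      proof -
        have in': "y \<in> {1..d} - I'" "z \<in> {1..d} - I'" using yz by auto
        have "(\<Sum>j'\<in>{1..d} - I'. cube_sum d n (v, I) (v', I') j j') = (\<Sum>j'\<in>{y,z}. cube_sum d n (v, I) (v', I') j j')"
          by (rule sum.mono_neutral_right) (use in' zero in auto)
        then show ?thesis using zero yz by auto
      qed
      have in': "y \<in> {1..d} - I" "z \<in> {1..d} - I" using yz by auto
      have "(\<Sum>j\<in>{1..d} - I. \<Sum>j'\<in>{1..d} - I'. cube_sum d n (v, I) (v', I') j j') = 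
        (\<Sum>j\<in>{y,z}. if j = y then cube_sum d n (v, I) (v', I') y z else if j = z then cube_sum d n (v, I) (v', I') z y else 0)"
        unfolding eq by (rule sum.mono_neutral_right) (use in' in auto)
      then show ?thesis using sum_T_overlap[OF n sub c yz, of v v'] yz(2) by simp
    next
      case f: False
      have "cube_sum d n (v, I) (v', I') j j' = 0" for j j'
      proof (rule cube_sum_0, rule disjI2)
        have "card (I \<inter> I') \<noteq> 0" using False fin by simp
        moreover have "card (I \<inter> I') \<le> card (insert j I \<inter> insert j' I')"
          by (rule card_mono) (use fin in auto)
        ultimately show "card (insert j I \<inter> insert j' I') \<noteq> 1" using f by linarith
      qed
      then show ?thesis by simp
    qed
    then show ?thesis unfolding pair_cob_cob r by simp
  qed
qed

section \<open>Coboundaries of dual cells\<close>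

lemma pair_cmul_right: "pair z (\<lambda>i. c * f i) = c * pair z f"
  by (simp add: pair_def sum_distrib_left mult.left_commute)

text \<open>The \<open>n\<close>-cell \<open>(v - e_I, I)\<close> with complementary directions \<open>I\<close> is the only one whose cup product with
  \<open>(v, J)\<close> has a nonzero integral; the sign is that integral.\<close>

definition dual_cob :: "nat \<Rightarrow> cell \<Rightarrow> (cell \<Rightarrow>\<^sub>0 int)" where
  "dual_cob d = (\<lambda>(v, J). frag_cmul ((-1) ^ inv_count J ({1..d} - J))
     (cob d (unshift v ({1..d} - J), {1..d} - J)))"

text \<open>The maps \<open>U\<close> and \<open>W\<close>: the form \<open>cup1_entry\<close> as a function of its second and of its first
  argument. One of the cells and the shared direction determine the other cell.\<close>

definition cup1_right :: "nat \<Rightarrow> nat \<Rightarrow> cell \<Rightarrow> (cell \<Rightarrow>\<^sub>0 int)" where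
  "cup1_right d n = (\<lambda>(w, K). \<Sum>c\<in>K. frag_cmul ((-1) ^ (n + inv_count ({1..d} - K) (K - {c})))
     (frag_of (shift (unshift w {j\<in>{1..d} - K. c < j}) {i\<in>K. i < c}, insert c ({1..d} - K))))"

definition cup1_left :: "nat \<Rightarrow> nat \<Rightarrow> cell \<Rightarrow> (cell \<Rightarrow>\<^sub>0 int)" where
  "cup1_left d n = (\<lambda>(w, L). \<Sum>c\<in>L. frag_cmul ((-1) ^ (n + inv_count (L - {c}) ({1..d} - L)))
     (frag_of (shift (unshift w {i\<in>{1..d} - L. i < c}) {j\<in>L. c < j}, insert c ({1..d} - L))))"

lemma shift_unshift: "shift (unshift v I) I = v" "unshift (shift v I) I = v"
  by (simp_all add: shift_def unshift_def)

lemma eq_shift_iff: "v = shift w I \<longleftrightarrow> w = unshift v I"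
  by (auto simp: shift_unshift)

lemma coef_cup1_right:
  assumes "K \<subseteq> {1..d}" "L \<subseteq> {1..d}"
  shows "coef (cup1_right d n (w, K)) (w', L) = cup1_entry d n (w, K) (w', L)"
proof -
  have "coef (cup1_right d n (w, K)) (w', L) = (\<Sum>c\<in>K. of_bool (K \<union> L = {1..d} \<and> K \<inter> L = {c} \<and>
       unshift w {j\<in>L. c < j} = unshift w' {i\<in>K. i < c}) * (-1) ^ (n + inv_count (L - {c}) (K - {c})))"
    unfolding cup1_right_def prod.case lookup_sum
  proof (rule sum.cong)
    fix c assume c: "c \<in> K"
    have 1: "L = insert c ({1..d} - K) \<longleftrightarrow> K \<union> L = {1..d} \<and> K \<inter> L = {c}"
      using assms c by blast
    have 2: "{j\<in>{1..d} - K. c < j} = {j\<in>L. c < j}" "{1..d} - K = L - {c}" if "K \<union> L = {1..d}" "K \<inter> L = {c}"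
    proof -
      have *: "L = insert c ({1..d} - K)" using 1 that by blast
      show "{1..d} - K = L - {c}" using c unfolding * by blast
      show "{j\<in>{1..d} - K. c < j} = {j\<in>L. c < j}" unfolding * by auto
    qed
    show "coef (frag_cmul ((-1) ^ (n + inv_count ({1..d} - K) (K - {c})))
       (frag_of (shift (unshift w {j\<in>{1..d} - K. c < j}) {i\<in>K. i < c}, insert c ({1..d} - K)))) (w', L) =
       of_bool (K \<union> L = {1..d} \<and> K \<inter> L = {c} \<and>
       unshift w {j\<in>L. c < j} = unshift w' {i\<in>K. i < c}) * (-1) ^ (n + inv_count (L - {c}) (K - {c}))"
    proof (cases "K \<union> L = {1..d} \<and> K \<inter> L = {c}")
      case True
      have "w' = shift (unshift w {j\<in>L. c < j}) {i\<in>K. i < c} \<longleftrightarrow> unshift w {j\<in>L. c < j} = unshift w' {i\<in>K. i < c}"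
        by (rule eq_shift_iff)
      with True 1 2 show ?thesis by simp
    next
      case False
      then have "L \<noteq> insert c ({1..d} - K)" using 1 by (simp only: not_False_eq_True)
      moreover have "\<not> (K \<union> L = {1..d} \<and> K \<inter> L = {c} \<and> P)" for P using False by blast
      ultimately show ?thesis by (simp only: lookup_frag_cmul lookup_frag_of prod.inject simp_thms if_False of_bool_eq(1) mult_zero_left mult_zero_right)
    qed
  qed simp
  also have "\<dots> = cup1_entry d n (w, K) (w', L)"
    unfolding cup1_entry_def prod.case
    by (rule sum.mono_neutral_right) (use assms finite_subset in \<open>auto simp del: atLeastAtMost_iff\<close>)
  finally show ?thesis .
qed

lemma coef_cup1_left:
  assumes "K \<subseteq> {1..d}" "L \<subseteq> {1..d}"
  shows "coef (cup1_left d n (w', L)) (w, K) = cup1_entry d n (w, K) (w', L)"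
proof -
  have "coef (cup1_left d n (w', L)) (w, K) = (\<Sum>c\<in>L. of_bool (K \<union> L = {1..d} \<and> K \<inter> L = {c} \<and>
       unshift w {j\<in>L. c < j} = unshift w' {i\<in>K. i < c}) * (-1) ^ (n + inv_count (L - {c}) (K - {c})))"
    unfolding cup1_left_def prod.case lookup_sum
  proof (rule sum.cong)
    fix c assume c: "c \<in> L"
    have 1: "K = insert c ({1..d} - L) \<longleftrightarrow> K \<union> L = {1..d} \<and> K \<inter> L = {c}"
      using assms c by blast
    have 2: "{i\<in>{1..d} - L. i < c} = {i\<in>K. i < c}" "{1..d} - L = K - {c}" if "K \<union> L = {1..d}" "K \<inter> L = {c}"
    proof -
      have *: "K = insert c ({1..d} - L)" using 1 that by blast
      show "{1..d} - L = K - {c}" using c unfolding * by blast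
      show "{j\<in>{1..d} - L. j < c} = {j\<in>K. j < c}" unfolding * by auto
    qed
    show "coef (frag_cmul ((-1) ^ (n + inv_count (L - {c}) ({1..d} - L)))
     (frag_of (shift (unshift w' {i\<in>{1..d} - L. i < c}) {j\<in>L. c < j}, insert c ({1..d} - L)))) (w, K) =
       of_bool (K \<union> L = {1..d} \<and> K \<inter> L = {c} \<and>
       unshift w {j\<in>L. c < j} = unshift w' {i\<in>K. i < c}) * (-1) ^ (n + inv_count (L - {c}) (K - {c}))"
    proof (cases "K \<union> L = {1..d} \<and> K \<inter> L = {c}")
      case True
      have "w = shift (unshift w' {i\<in>K. i < c}) {j\<in>L. c < j} \<longleftrightarrow> unshift w {j\<in>L. c < j} = unshift w' {i\<in>K. i < c}"
        by (subst eq_shift_iff) (rule eq_commute)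
      with True 1 2 show ?thesis by simp
    next
      case False
      then have "K \<noteq> insert c ({1..d} - L)" using 1 by (simp only: not_False_eq_True)
      moreover have "\<not> (K \<union> L = {1..d} \<and> K \<inter> L = {c} \<and> P)" for P using False by blast
      ultimately show ?thesis by (simp only: lookup_frag_cmul lookup_frag_of prod.inject simp_thms if_False of_bool_eq(1) mult_zero_left mult_zero_right)
    qed
  qed simp
  also have "\<dots> = cup1_entry d n (w, K) (w', L)"
    unfolding cup1_entry_def prod.case
    by (rule sum.mono_neutral_right) (use assms finite_subset in \<open>auto simp del: atLeastAtMost_iff\<close>)
  finally show ?thesis .
qed

lemma cell_compl:
  assumes "(v, J) \<in> cells d (n + 1)" "d = 2 * n + 1"
  shows "card ({1..d} - J) = n" "{1..d} - ({1..d} - J) = J" "J \<subseteq> {1..d}" "finite J"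
proof -
  show J: "J \<subseteq> {1..d}" and fin: "finite J" using assms finite_subset by (auto simp: cells_def)
  show "card ({1..d} - J) = n" using assms J fin by (simp add: card_Diff_subset cells_def)
  show "{1..d} - ({1..d} - J) = J" using J by blast
qed

text \<open>A signed bijection relates cells to their duals, so pairing a dual cell against a cochain
  recovers the value on the original cell, and \<open>cup1_cob\<close> turns into a statement about \<open>dual_cob\<close> alone.\<close>

lemma cup1_dual_cob:
  assumes d: "d = 2 * n + 1" "odd n" and st: "s \<in> cells d (n + 1)" "t \<in> cells d (n + 1)"
  shows "pair (dual_cob d s) (\<lambda>a. pair (dual_cob d t) (\<lambda>b. cup1_entry d n a b)) =
    coef (dual_cob d s) t - coef (dual_cob d t) s"
proof -
  obtain v J v' J' where s: "s = (v, J)" and t: "t = (v', J')" by fastforce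
  note J = cell_compl[OF st(1)[unfolded s] d(1)] and J' = cell_compl[OF st(2)[unfolded t] d(1)]
  let ?r = "(unshift v ({1..d} - J), {1..d} - J)" and ?r' = "(unshift v' ({1..d} - J'), {1..d} - J')"
  let ?e = "(-1) ^ inv_count J ({1..d} - J) :: int" and ?e' = "(-1) ^ inv_count J' ({1..d} - J') :: int"
  have "pair (cob d ?r) (\<lambda>a. pair (cob d ?r') (\<lambda>b. cup1_entry d n a b)) = ?e' * coef (cob d ?r) (v', J') - ?e * coef (cob d ?r') (v, J)"
    using cup1_cob[OF d J(1) J'(1), of "unshift v ({1..d} - J)" "unshift v' ({1..d} - J')"]
    by (simp only: J J' shift_unshift Diff_subset)
  moreover have "?e * ?e = 1" "?e' * ?e' = 1" by (simp_all flip: power_add)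
  moreover have "e' * (e * (e' * x - e * y)) = e * x * (e' * e') - e' * y * (e * e)" for e e' x y :: int
    by (simp add: algebra_simps)
  ultimately show ?thesis unfolding s t dual_cob_def prod.case
    by (simp only: pair_cmul pair_cmul_right lookup_frag_cmul mult_1_right)
qed

text \<open>If the cells \<open>s\<close> and \<open>t\<close> share the single direction \<open>j\<close>, both coefficients are differences over
  the two faces in direction \<open>j\<close>. The faces exchange their roles, and for odd \<open>n\<close> the signs are opposite.\<close>

lemma dual_cob_transpose:
  assumes d: "d = 2 * n + 1" "odd n" and st: "(v, J) \<in> cells d (n + 1)" "(v', J') \<in> cells d (n + 1)"
  shows "coef (dual_cob d (shift v' {1..d}, J')) (v, J) = coef (dual_cob d (v, J)) (v', J')"
proof (cases "J \<union> J' = {1..d} \<and> (\<exists>j. J \<inter> J' = {j})")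
  case True
  then obtain j where j: "J \<inter> J' = {j}" and un: "J \<union> J' = {1..d}" by blast
  note J = cell_compl[OF st(1) d(1)] and J' = cell_compl[OF st(2) d(1)]
  define I I' where "I = {1..d} - J" and "I' = {1..d} - J'"
  have mem: "j \<in> J" "j \<in> J'" using j by auto
  have I: "J' = insert j I" "J = insert j I'" "j \<in> {1..d} - I" "j \<in> {1..d} - I'" "I \<inter> I' = {}"
    using mem j un J J' unfolding I_def I'_def by blast+
  have fin: "finite I" "finite I'" by (simp_all add: I_def I'_def)
  have tot: "{1..d} = insert j (I \<union> I')" using un I by auto
  have ni: "j \<notin> I" "j \<notin> I'" using I by auto
  have card: "card I = n" "card I' = n" using J J' by (simp_all add: I_def I'_def)
  have sgn: "(-1) ^ inv_count J' I' * (-1) ^ Suc (count_below I' j) = - ((-1) ^ inv_count J I * (-1) ^ Suc (count_below I j) :: int)"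
    unfolding power_add[symmetric]
  proof (rule sign_minusI)
    have "inv_count J' I' = inv_count I I' + count_above I' j" "inv_count J I = inv_count I' I + count_above I j"
      unfolding I(1,2) using fin ni by (simp_all add: inv_count_insert_left)
    moreover have "count_below I j + count_above I j = n" "count_below I' j + count_above I' j = n" using count_below_plus_above fin ni card by simp_all
    moreover have "inv_count I I' + inv_count I' I = n * n" using inv_count_swap[of I I'] fin I card by simp
    moreover have "odd (n * n)" using d(2) by simp
    ultimately show "odd (inv_count J' I' + Suc (count_below I' j) + (inv_count J I + Suc (count_below I j)))"
      by presburger
  qed
  have 1: "v = unshift (shift v' {1..d}) I' \<longleftrightarrow> v' = unshift (unshift v I) {j}"
    "v = unshift (unshift (shift v' {1..d}) I') {j} \<longleftrightarrow> v' = unshift v I"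
    unfolding tot shift_def unshift_def fun_eq_iff
    by (intro all_cong1; use I(5) ni in \<open>auto simp: of_bool_def\<close>)+
  have "coef (dual_cob d (shift v' {1..d}, J')) (v, J) = (-1) ^ inv_count J' I' * (-1) ^ Suc (count_below I' j) *
     (of_bool (v' = unshift (unshift v I) {j}) - of_bool (v' = unshift v I))"
    unfolding dual_cob_def prod.case I'_def[symmetric] lookup_frag_cmul I(2)
    unfolding coef_cob_insert[OF I(4)] 1 by (simp only: mult.assoc)
  moreover have "coef (dual_cob d (v, J)) (v', J') = (-1) ^ inv_count J I * (-1) ^ Suc (count_below I j) *
     (of_bool (v' = unshift v I) - of_bool (v' = unshift (unshift v I) {j}))"
    unfolding dual_cob_def prod.case I_def[symmetric] lookup_frag_cmul I(1)
    unfolding coef_cob_insert[OF I(3)] by (simp only: mult.assoc)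
  moreover have "- (a * b) * (x - y) = a * b * (y - x)" for a b x y :: int by (simp add: algebra_simps)
  ultimately show ?thesis by (simp only: sgn)
next
  case False
  note J = cell_compl[OF st(1) d(1)] and J' = cell_compl[OF st(2) d(1)]
  have *: "coef (dual_cob d (v, J)) (v', J') = 0"
    if J: "J \<subseteq> {1..d}" and neq: "\<not> (J \<union> J' = {1..d} \<and> (\<exists>j. J \<inter> J' = {j}))" for v v' J J'
  proof -
    have "J' \<noteq> insert j ({1..d} - J)" if "j \<in> {1..d} - ({1..d} - J)" for j
      using neq J that by blast
    then have "coef (cob d (unshift v ({1..d} - J), {1..d} - J)) (v', J') = 0" by (rule coef_cob_0)
    then show ?thesis unfolding dual_cob_def prod.case lookup_frag_cmul by (simp only: mult_zero_right)
  qed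
  show ?thesis using *[OF J(3)] *[OF J'(3)] False by (simp add: Int_commute Un_commute)
qed


definition near :: "cell \<Rightarrow> cell \<Rightarrow> bool" where
  "near s t \<longleftrightarrow> (\<forall>i. \<bar>fst t i - fst s i\<bar> \<le> 1)"

lemma supp_dual_cob:
  assumes "s \<in> cells d (n + 1)" "d = 2 * n + 1" "t \<in> supp (dual_cob d s)"
  shows "t \<in> cells d (n + 1) \<and> near s t"
proof -
  obtain v J where s: "s = (v, J)" by fastforce
  note J = cell_compl[OF assms(1)[unfolded s] assms(2)]
  define I where "I = {1..d} - J"
  obtain v' J' where t: "t = (v', J')" by fastforce
  have nz: "coef (dual_cob d (v, J)) (v', J') \<noteq> 0" using assms s t by (simp add: in_keys_iff)
  have "\<exists>j\<in>{1..d} - I. J' = insert j I"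
  proof (rule ccontr)
    assume "\<not> ?thesis"
    then have "coef (cob d (unshift v I, I)) (v', J') = 0" by (intro coef_cob_0) auto
    then show False using nz by (simp add: dual_cob_def I_def)
  qed
  then obtain j where j: "j \<in> {1..d} - I" "J' = insert j I" by blast
  have "v' = unshift v I \<or> v' = unshift (unshift v I) {j}"
    using nz unfolding dual_cob_def prod.case I_def[symmetric] lookup_frag_cmul j(2) coef_cob_insert[OF j(1)] by auto
  moreover have "card J' = n + 1" using j J(1) by (simp add: I_def)
  moreover have "J' \<subseteq> {1..d}" using j by (auto simp: I_def)
  moreover have "v i = 0" if "i \<notin> {1..d}" for i using assms(1) s that by (auto simp: cells_def)
  ultimately show ?thesis
    unfolding s t near_def cells_def using j by (auto simp: unshift_def I_def)
qed

lemma supp_cup1_right: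
  assumes "s \<in> cells d (n + 1)" "d = 2 * n + 1" "t \<in> supp (cup1_right d n s)"
  shows "t \<in> cells d (n + 1) \<and> near s t"
proof -
  obtain v K where s: "s = (v, K)" by fastforce
  note K = cell_compl[OF assms(1)[unfolded s] assms(2)]
  have "supp (cup1_right d n s) \<subseteq> (\<Union>c\<in>K. {(shift (unshift v {j\<in>{1..d} - K. c < j}) {i\<in>K. i < c}, insert c ({1..d} - K))})"
    unfolding s cup1_right_def prod.case
    by (rule order_trans[OF keys_sum], rule UN_mono) (auto simp: keys_cmul_iff)
  then obtain c where c: "c \<in> K" "t = (shift (unshift v {j\<in>{1..d} - K. c < j}) {i\<in>K. i < c}, insert c ({1..d} - K))"
    using assms(3) by blast
  have "v i = 0" if "i \<notin> {1..d}" for i using assms(1) s that by (auto simp: cells_def)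
  then show ?thesis
    unfolding s c(2) near_def cells_def using K c(1) by (auto simp: unshift_def shift_def)
qed

lemma supp_cup1_left:
  assumes "s \<in> cells d (n + 1)" "d = 2 * n + 1" "t \<in> supp (cup1_left d n s)"
  shows "t \<in> cells d (n + 1) \<and> near s t"
proof -
  obtain v K where s: "s = (v, K)" by fastforce
  note K = cell_compl[OF assms(1)[unfolded s] assms(2)]
  have "supp (cup1_left d n s) \<subseteq> (\<Union>c\<in>K. {(shift (unshift v {i\<in>{1..d} - K. i < c}) {j\<in>K. c < j}, insert c ({1..d} - K))})"
    unfolding s cup1_left_def prod.case
    by (rule order_trans[OF keys_sum], rule UN_mono) (auto simp: keys_cmul_iff)
  then obtain c where c: "c \<in> K" "t = (shift (unshift v {i\<in>{1..d} - K. i < c}) {j\<in>K. c < j}, insert c ({1..d} - K))"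
    using assms(3) by blast
  have "v i = 0" if "i \<notin> {1..d}" for i using assms(1) s that by (auto simp: cells_def)
  then show ?thesis
    unfolding s c(2) near_def cells_def using K c(1) by (auto simp: unshift_def shift_def)
qed

section \<open>The linear map and its inverse\<close>

lemma pair_swap: "pair x (\<lambda>s. pair y (f s)) = pair y (\<lambda>t. pair x (\<lambda>s. f s t))"
  unfolding pair_def sum_distrib_left by (subst sum.swap) (simp add: mult.left_commute)

lemma supp_frag_extend: "supp x \<subseteq> Q \<Longrightarrow> (\<And>s. s \<in> Q \<Longrightarrow> supp (M s) \<subseteq> Q') \<Longrightarrow> supp (frag_extend M x) \<subseteq> Q'"
  using keys_frag_extend[of M x] by blast

lemma supp_ops:
  "supp x \<subseteq> Q \<Longrightarrow> supp y \<subseteq> Q \<Longrightarrow> supp (x + y) \<subseteq> Q"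
  "supp x \<subseteq> Q \<Longrightarrow> supp y \<subseteq> Q \<Longrightarrow> supp (x - y) \<subseteq> Q"
  "supp x \<subseteq> Q \<Longrightarrow> supp (frag_cmul c x) \<subseteq> Q"
  "supp x \<subseteq> Q \<Longrightarrow> supp (- x) \<subseteq> Q"
  using Poly_Mapping.keys_add[of x y] keys_diff[of x y] keys_cmul[of c x] by auto

lemma pair_coef_linear:
  "pair z (coef (x + y)) = pair z (coef x) + pair z (coef y)"
  "pair z (coef (x - y)) = pair z (coef x) - pair z (coef y)"
  "pair z (coef (frag_cmul c x)) = c * pair z (coef x)"
  "pair z (coef (- x)) = - pair z (coef x)"
  by (simp_all add: pair_commute[of z] pair_linear)

lemmas frag_extend_linear = frag_extend_add frag_extend_diff frag_extend_cmul

text \<open>The exponent of the phase in the commutation relation of the Pauli operators \<open>(x, z)\<close> and \<open>(x', z')\<close>.\<close>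

definition commutator_form :: "('a \<Rightarrow>\<^sub>0 int) \<Rightarrow> ('a \<Rightarrow>\<^sub>0 int) \<Rightarrow> ('a \<Rightarrow>\<^sub>0 int) \<Rightarrow> ('a \<Rightarrow>\<^sub>0 int) \<Rightarrow> int" where
  "commutator_form x z x' z' = pair z (coef x') - pair z' (coef x)"

text \<open>The hypotheses are those properties of \<open>dual_cob\<close> and of the cup-1 form that the rest of the
  argument depends on.\<close>

locale cup1_duality =
  fixes Q :: "'q set" and u :: "'q \<Rightarrow> 'q \<Rightarrow> int" and D U W :: "'q \<Rightarrow> ('q \<Rightarrow>\<^sub>0 int)" and \<tau> :: "'q \<Rightarrow> 'q"
  assumes D_supp: "s \<in> Q \<Longrightarrow> supp (D s) \<subseteq> Q"
    and U_supp: "s \<in> Q \<Longrightarrow> supp (U s) \<subseteq> Q"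
    and W_supp: "s \<in> Q \<Longrightarrow> supp (W s) \<subseteq> Q"
    and \<tau>_in: "s \<in> Q \<Longrightarrow> \<tau> s \<in> Q"
    and U_coef: "s \<in> Q \<Longrightarrow> t \<in> Q \<Longrightarrow> coef (U s) t = u s t"
    and W_coef: "s \<in> Q \<Longrightarrow> t \<in> Q \<Longrightarrow> coef (W t) s = u s t"
    and u_D_D: "s \<in> Q \<Longrightarrow> t \<in> Q \<Longrightarrow> pair (D s) (\<lambda>a. pair (D t) (u a)) = coef (D s) t - coef (D t) s"
    and D_transpose: "s \<in> Q \<Longrightarrow> t \<in> Q \<Longrightarrow> coef (D (\<tau> t)) s = coef (D s) t"
begin

abbreviation "DD \<equiv> frag_extend D"
abbreviation "UU \<equiv> frag_extend U"
abbreviation "WW \<equiv> frag_extend W"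
abbreviation "TT \<equiv> frag_extend (\<lambda>s. frag_of (\<tau> s))"

lemma supp_ext [intro]:
  assumes "supp x \<subseteq> Q"
  shows "supp (DD x) \<subseteq> Q" "supp (UU x) \<subseteq> Q" "supp (WW x) \<subseteq> Q" "supp (TT x) \<subseteq> Q"
  by (rule supp_frag_extend[OF assms]; use D_supp U_supp W_supp \<tau>_in in simp)+

definition ub where "ub x y = pair x (\<lambda>s. pair y (u s))"

lemma adj_U:
  assumes "supp x \<subseteq> Q" "supp y \<subseteq> Q" shows "pair (UU x) (coef y) = ub x y"
proof -
  have "pair (UU x) (coef y) = pair x (\<lambda>s. pair y (coef (U s)))"
    unfolding pair_frag_extend by (simp add: pair_commute)
  also have "\<dots> = ub x y"
    unfolding ub_def by (intro pair_cong) (use assms U_coef in blast)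
  finally show ?thesis .
qed

lemma adj_W:
  assumes "supp x \<subseteq> Q" "supp y \<subseteq> Q" shows "pair (WW y) (coef x) = ub x y"
proof -
  have "pair (WW y) (coef x) = pair y (\<lambda>t. pair x (coef (W t)))"
    unfolding pair_frag_extend by (simp add: pair_commute)
  also have "\<dots> = pair y (\<lambda>t. pair x (\<lambda>s. u s t))"
    by (intro pair_cong) (use assms W_coef in blast)
  finally show ?thesis unfolding ub_def by (subst pair_swap)
qed

lemma ub_D_D:
  assumes "supp x \<subseteq> Q" "supp y \<subseteq> Q"
  shows "ub (DD x) (DD y) = pair (DD x) (coef y) - pair (DD y) (coef x)"
proof -
  have "ub (DD x) (DD y) = pair x (\<lambda>s. pair y (\<lambda>t. pair (D s) (\<lambda>a. pair (D t) (u a))))"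
    unfolding ub_def pair_frag_extend by (subst pair_swap) (rule refl)
  also have "\<dots> = pair x (\<lambda>s. pair y (\<lambda>t. coef (D s) t - coef (D t) s))"
    by (intro pair_cong u_D_D) (use assms in auto)
  also have "\<dots> = pair x (\<lambda>s. pair y (coef (D s))) - pair x (\<lambda>s. pair y (\<lambda>t. coef (D t) s))"
    by (simp add: pair_def algebra_simps sum_subtractf)
  also have "pair x (\<lambda>s. pair y (coef (D s))) = pair (DD x) (coef y)"
    unfolding pair_frag_extend by (simp add: pair_commute)
  also have "pair x (\<lambda>s. pair y (\<lambda>t. coef (D t) s)) = pair (DD y) (coef x)"
    unfolding pair_frag_extend by (subst pair_swap) (simp add: pair_commute)
  finally show ?thesis .
qed

lemma D_T:
  assumes "supp x \<subseteq> Q" "supp y \<subseteq> Q"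
  shows "pair (DD (TT y)) (coef x) = pair (DD x) (coef y)"
proof -
  have "pair (DD (TT y)) (coef x) = pair y (\<lambda>t. pair x (coef (D (\<tau> t))))"
    unfolding pair_frag_extend pair_frag_of by (simp add: pair_commute)
  also have "\<dots> = pair y (\<lambda>t. pair x (\<lambda>s. coef (D s) t))"
    by (intro pair_cong D_transpose) (use assms in auto)
  also have "\<dots> = pair x (\<lambda>s. pair (D s) (coef y))"
    by (subst pair_swap) (simp add: pair_commute)
  finally show ?thesis unfolding pair_frag_extend .
qed

lemma frag_eqI:
  assumes "supp x \<subseteq> Q" "supp y \<subseteq> Q" "\<And>t. t \<in> Q \<Longrightarrow> coef x t = coef y t"
  shows "x = y"
proof (rule poly_mapping_eqI)
  fix t show "coef x t = coef y t"
    using assms by (metis in_keys_iff subsetD)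
qed

text \<open>Testing against a basis vector \<open>y\<close>, the transpose rule \<open>D_T\<close> turns the left-hand side into
  \<open>u(D \<tau> x, D \<tau> y) - u(D \<tau> y, D \<tau> x)\<close>, which \<open>ub_D_D\<close> expresses through \<open>D\<close> alone.\<close>

lemma D_UW_D_T:
  assumes x: "supp x \<subseteq> Q"
  shows "DD (UU (DD (TT x)) - WW (DD (TT x))) = frag_cmul 2 (DD x - DD (TT x))" (is "?l = ?r")
proof (rule frag_eqI)
  show "supp ?l \<subseteq> Q" "supp ?r \<subseteq> Q" using x by (simp_all add: supp_ops supp_ext)
next
  fix t assume "t \<in> Q"
  then have t: "supp (frag_of t) \<subseteq> Q" by simp
  let ?y = "frag_of t" and ?v = "DD (TT x)"
  have v: "supp ?v \<subseteq> Q" using x by (intro supp_ext)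
  have "coef ?l t = pair ?l (coef ?y)" by (rule pair_coef_frag_of[symmetric])
  also have "\<dots> = pair (UU ?v) (coef (DD (TT ?y))) - pair (WW ?v) (coef (DD (TT ?y)))"
  proof -
    have "pair ?l (coef ?y) = pair (DD (TT ?y)) (coef (UU ?v - WW ?v))"
      by (rule D_T[symmetric]) (use t v in \<open>simp_all add: supp_ops supp_ext\<close>)
    then show ?thesis by (simp only: pair_commute[of "DD (TT ?y)"] pair_diff)
  qed
  also have "\<dots> = ub ?v (DD (TT ?y)) - ub (DD (TT ?y)) ?v"
    using t v by (simp only: adj_U adj_W supp_ext)
  also have "\<dots> = 2 * (pair ?v (coef (TT ?y)) - pair (DD (TT ?y)) (coef (TT x)))"
    using t x by (simp add: ub_D_D supp_ext del: frag_extend_of pair_coef_frag_of)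
  also have "pair ?v (coef (TT ?y)) = pair (DD (TT ?y)) (coef x)"
    by (rule D_T) (use t x in \<open>simp_all only: supp_ext\<close>)
  also have "\<dots> = pair (DD x) (coef ?y)"
    by (rule D_T) (use t x in \<open>simp_all only: supp_ext\<close>)
  also have "pair (DD (TT ?y)) (coef (TT x)) = pair (DD (TT x)) (coef ?y)"
    by (rule D_T) (use t x in \<open>simp_all only: supp_ext\<close>)
  finally show "coef ?l t = coef ?r t" by (simp only: pair_coef_frag_of lookup_minus lookup_frag_cmul)
qed

end

locale duality_mod = cup1_duality +
  fixes p k h h' :: int
  assumes h: "[2 * h = 1] (mod p)" and h': "[2 * k * h' = 1] (mod p)"
begin

text \<open>\<open>F (x, z) = (x + D g, z + k U D g)\<close> with \<open>g = G x z\<close>. The exponents of both families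
  of operators in the theorem arise by applying this map to generators, and the form of the map already shows
  that only \<open>D g\<close> has to be controlled.\<close>

definition G where "G x z = frag_cmul h' z - frag_cmul h (WW x)"
definition F1 where "F1 x z = x + DD (G x z)"
definition F2 where "F2 x z = z + frag_cmul k (UU (DD (G x z)))"

lemma supp_G [intro]: "supp x \<subseteq> Q \<Longrightarrow> supp z \<subseteq> Q \<Longrightarrow> supp (G x z) \<subseteq> Q"
  unfolding G_def by (intro supp_ops supp_ext)
lemma supp_F [intro]:
  assumes "supp x \<subseteq> Q" "supp z \<subseteq> Q" shows "supp (F1 x z) \<subseteq> Q" "supp (F2 x z) \<subseteq> Q"
  unfolding F1_def F2_def using assms by (simp_all add: supp_ops supp_ext supp_G)

lemma G_linear:
  "G (x + x') (z + z') = G x z + G x' z'" "G (x - x') (z - z') = G x z - G x' z'"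
  "G (frag_cmul c x) (frag_cmul c z) = frag_cmul c (G x z)"
  unfolding G_def
  by (rule poly_mapping_eqI, simp add: frag_extend_linear lookup_add lookup_minus algebra_simps)+

lemma F_linear:
  "F1 (x + x') (z + z') = F1 x z + F1 x' z'" "F1 (x - x') (z - z') = F1 x z - F1 x' z'"
  "F1 (frag_cmul c x) (frag_cmul c z) = frag_cmul c (F1 x z)"
  "F2 (x + x') (z + z') = F2 x z + F2 x' z'" "F2 (x - x') (z - z') = F2 x z - F2 x' z'"
  "F2 (frag_cmul c x) (frag_cmul c z) = frag_cmul c (F2 x z)"
  unfolding F1_def F2_def G_linear
  by (rule poly_mapping_eqI, simp add: frag_extend_linear lookup_add lookup_minus algebra_simps)+

text \<open>Writing \<open>q = D g\<close>, the new terms are linear in \<open>q\<close> except for \<open>k (u(q, q') - u(q', q))\<close>. By \<open>ub_D_D\<close>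
  that term is \<open>2 k\<close> times a difference of pairings of \<open>g\<close> and \<open>g'\<close> with \<open>q'\<close> and \<open>q\<close>, and
  \<open>2 k g\<close> is congruent to \<open>z - k W x\<close>, which is what the linear terms contain.\<close>

lemma commutator_form_F:
  assumes x: "supp x \<subseteq> Q" "supp z \<subseteq> Q" "supp x' \<subseteq> Q" "supp z' \<subseteq> Q"
  shows "[commutator_form (F1 x z) (F2 x z) (F1 x' z') (F2 x' z') = commutator_form x z x' z'] (mod p)"
proof -
  define g g' where "g = G x z" and "g' = G x' z'"
  define q q' where "q = DD g" and "q' = DD g'"
  have s: "supp g \<subseteq> Q" "supp g' \<subseteq> Q" "supp q \<subseteq> Q" "supp q' \<subseteq> Q"
    unfolding q_def q'_def g_def g'_def using x by (simp_all add: supp_ext supp_G)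
  have UW: "pair (UU q) (coef x') = pair (WW x') (coef q)" "pair (UU q') (coef x) = pair (WW x) (coef q')"
    using adj_U adj_W s x by metis+
  have Uqq: "pair (UU q) (coef q') - pair (UU q') (coef q) = 2 * (pair q (coef g') - pair q' (coef g))"
    using s unfolding q_def q'_def by (simp add: adj_U ub_D_D supp_ext)
  have comm: "pair q (coef g') = pair g' (coef q)" "pair q' (coef g) = pair g (coef q')"
    by (rule pair_commute)+
  have gz: "[2 * k * pair g (coef a) = pair z (coef a) - k * pair (WW x) (coef a)] (mod p)"
     if g: "g = G x z" for g x z a
  proof -
    have "2 * k * pair g (coef a) = (2 * k * h') * pair z (coef a) - k * (2 * h) * pair (WW x) (coef a)"
      unfolding g G_def by (simp add: pair_linear algebra_simps)
    also have "[\<dots> = 1 * pair z (coef a) - k * 1 * pair (WW x) (coef a)] (mod p)"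
      by (rule cong_diff[OF cong_mult[OF h' cong_refl] cong_mult[OF cong_mult[OF cong_refl h] cong_refl]])
    finally show ?thesis by simp
  qed
  have cancel: "a + b - c + (c - b) = a" for a b c :: int by simp
  have step: "[c + a - b + (e - f) = c + a - b + (b - a)] (mod p)" if "[e = b] (mod p)" "[f = a] (mod p)"
    for a b c e f :: int
    by (rule cong_add[OF cong_refl cong_diff[OF that]])
  have e1: "commutator_form (F1 x z) (F2 x z) (F1 x' z') (F2 x' z') =
     commutator_form x z x' z' + (pair z (coef q') - k * pair (WW x) (coef q')) - (pair z' (coef q) - k * pair (WW x') (coef q))
      + k * (pair (UU q) (coef q') - pair (UU q') (coef q))"
    unfolding commutator_form_def F1_def F2_def g_def[symmetric] g'_def[symmetric] q_def[symmetric] q'_def[symmetric]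
    unfolding pair_linear pair_coef_linear UW by (simp only: algebra_simps)
  have e2: "commutator_form x z x' z' + (pair z (coef q') - k * pair (WW x) (coef q')) - (pair z' (coef q) - k * pair (WW x') (coef q))
      + k * (pair (UU q) (coef q') - pair (UU q') (coef q)) = commutator_form x z x' z' + (pair z (coef q') - k * pair (WW x) (coef q')) - (pair z' (coef q) - k * pair (WW x') (coef q))
      + (2 * k * pair g' (coef q) - 2 * k * pair g (coef q'))"
    unfolding Uqq comm by (simp add: algebra_simps)
  have e3: "[commutator_form x z x' z' + (pair z (coef q') - k * pair (WW x) (coef q')) - (pair z' (coef q) - k * pair (WW x') (coef q))
      + (2 * k * pair g' (coef q) - 2 * k * pair g (coef q')) = commutator_form x z x' z' + (pair z (coef q') - k * pair (WW x) (coef q')) - (pair z' (coef q) - k * pair (WW x') (coef q))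
      + ((pair z' (coef q) - k * pair (WW x') (coef q)) - (pair z (coef q') - k * pair (WW x) (coef q')))] (mod p)"
    by (rule step[OF gz[OF g'_def] gz[OF g_def]])
  show ?thesis unfolding e1 e2 using e3 by (simp only: cancel)
qed

text \<open>A preimage is found by solving \<open>q = D (G (x - q) (z - k U q))\<close> modulo \<open>p\<close>. With \<open>q = D \<tau> g\<close> and
  \<open>g = G x z\<close> the right-hand side is \<open>D g - (D (U - W) D \<tau> g) / 2\<close>, which is \<open>q\<close> by \<open>D_UW_D_T\<close>.\<close>

lemma F_surj:
  assumes x: "supp x \<subseteq> Q" "supp z \<subseteq> Q"
  obtains y w a b where "supp y \<subseteq> Q" "supp w \<subseteq> Q" "supp a \<subseteq> Q" "supp b \<subseteq> Q"
    "F1 y w = x + frag_cmul p a" "F2 y w = z + frag_cmul p b"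
proof -
  define g q where "g = G x z" and "q = DD (TT g)"
  have s: "supp g \<subseteq> Q" "supp q \<subseteq> Q"
    unfolding q_def g_def using x by (simp_all add: supp_ext supp_G)
  obtain c where c: "2 * h = 1 + p * c" using h by (metis cong_iff_lin cong_sym)
  obtain c' where c': "2 * k * h' = 1 + p * c'" using h' by (metis cong_iff_lin cong_sym)
  \<comment> \<open>The integers \<open>c\<close>, \<open>c'\<close> and \<open>a\<close> keep track of the multiples of \<open>p\<close>, so that the equations below hold over the integers.\<close>
  define a where "a = h' * k * - c + c' * h"
  have a: "h' * k = h + p * a"
  proof -
    have "h + p * a = h * (2 * k * h') - (h' * k) * (p * c)"
      unfolding c' a_def by (simp add: algebra_simps)
    also have "\<dots> = h' * k * (2 * h) - (h' * k) * (p * c)" by simp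
    also have "\<dots> = h' * k" unfolding c by (simp add: algebra_simps)
    finally show ?thesis by simp
  qed
  define y w where "y = x - q" and "w = z - frag_cmul k (UU q)"
  define e where "e = frag_cmul (- c) (DD g - q) - frag_cmul a (DD (UU q))"
  have "DD (UU q) - DD (WW q) = frag_cmul 2 (DD g - q)"
    using D_UW_D_T[OF s(1)] by (simp add: q_def frag_extend_diff)
  then have UW: "coef (DD (UU q)) t - coef (DD (WW q)) t = 2 * (coef (DD g) t - coef q t)" for t
    by (metis lookup_frag_cmul lookup_minus)
  have Dg: "DD (G y w) = q + frag_cmul p e"
  proof (rule poly_mapping_eqI)
    fix t
    have "coef (DD (G y w)) t = coef (DD g) t - (h' * k) * coef (DD (UU q)) t + h * coef (DD (WW q)) t"
      unfolding y_def w_def G_def g_def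
      by (simp add: frag_extend_linear lookup_minus algebra_simps)
    also have "\<dots> = coef (DD g) t - h * (coef (DD (UU q)) t - coef (DD (WW q)) t) - p * a * coef (DD (UU q)) t"
      unfolding a by (simp add: algebra_simps)
    also have "\<dots> = coef (DD g) t - (2 * h) * (coef (DD g) t - coef q t) - p * a * coef (DD (UU q)) t"
      unfolding UW by simp
    also have "\<dots> = coef (q + frag_cmul p e) t"
      unfolding c e_def by (simp add: lookup_add lookup_minus algebra_simps)
    finally show "coef (DD (G y w)) t = coef (q + frag_cmul p e) t" .
  qed
  have se: "supp e \<subseteq> Q" unfolding e_def using s by (intro supp_ops supp_ext)
  have "F1 y w = x + frag_cmul p e" unfolding F1_def Dg unfolding y_def by simp
  moreover have "F2 y w = z + frag_cmul p (frag_cmul k (UU e))"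
    unfolding F2_def Dg unfolding w_def
    by (rule poly_mapping_eqI) (simp add: frag_extend_linear lookup_add lookup_minus algebra_simps)
  ultimately show thesis
    using that[of y w e "frag_cmul k (UU e)"] s se x unfolding y_def w_def
    by (simp add: supp_ops supp_ext)
qed

end

section \<open>Integrals of cup products of cells\<close>

lemma pair_indicator [simp]: "pair z (indicator {r}) = coef z r"
proof -
  have "pair z (indicator {r}) = pair z (coef (frag_of r))"
    by (rule pair_cong) (simp add: indicator_def)
  then show ?thesis by (simp only: pair_coef_frag_of)
qed

lemma coboundary_indicator:
  assumes "I \<subseteq> {1..d}" "J \<subseteq> {1..d}"
  shows "coboundary (indicator {(v, I)}) (v', J) = coef (cob d (v, I)) (v', J)"
proof -
  have finJ: "finite J" and finI: "finite I" using assms finite_subset by blast+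
  have "coboundary (indicator {(v, I)}) (v', J) = coef (boundary (v', J)) (v, I)"
    using pair_indicator[of "boundary (v', J)" "(v, I)"] unfolding coboundary_def pair_def .
  also have "\<dots> = (\<Sum>i\<in>J. of_bool (I = J - {i}) * ((-1) ^ card {j\<in>J. j \<le> i} *
      (of_bool (v' = v) - of_bool (v' = unshift v {i}))))"
    unfolding boundary_def prod.case lookup_sum
    by (rule sum.cong) (auto simp: lookup_minus eq_shift_iff eq_commute[of v])
  also have "\<dots> = coef (cob d (v, I)) (v', J)"
  proof (cases "\<exists>j\<in>{1..d} - I. J = insert j I")
    case True
    then obtain j where j: "j \<in> {1..d} - I" "J = insert j I" by blast
    have "i \<in> J \<Longrightarrow> I = J - {i} \<longleftrightarrow> i = j" for i using j by blast
    then have "(\<Sum>i\<in>J. of_bool (I = J - {i}) * ((-1) ^ card {j\<in>J. j \<le> i} * (of_bool (v' = v) - of_bool (v' = unshift v {i})))) =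
      (\<Sum>i\<in>J. if i = j then (-1) ^ card {i\<in>J. i \<le> j} * (of_bool (v' = v) - of_bool (v' = unshift v {j})) else (0::int))"
      by (intro sum.cong) auto
    also have "\<dots> = (-1) ^ card {i\<in>J. i \<le> j} * (of_bool (v' = v) - of_bool (v' = unshift v {j}))"
      using finJ j by (subst sum.delta) auto
    also have "card {i\<in>J. i \<le> j} = Suc (count_below I j)" unfolding j(2) using card_le_insert[OF finI] j(1) by blast
    finally show ?thesis unfolding j(2) coef_cob_insert[OF j(1)] .
  next
    case False
    have "of_bool (I = J - {i}) = (0::int)" if "i \<in> J" for i
    proof -
      have "I \<noteq> J - {i}"
      proof
        assume "I = J - {i}"
        then have "i \<in> {1..d} - I" "J = insert i I" using that assms by auto
        then show False using False by blast
      qed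
      then show ?thesis by simp
    qed
    then have "(\<Sum>i\<in>J. of_bool (I = J - {i}) * ((-1) ^ card {j\<in>J. j \<le> i} * (of_bool (v' = v) - of_bool (v' = unshift v {i})))) = (0::int)"
      by (intro sum.neutral) simp
    also have "0 = coef (cob d (v, I)) (v', J)"
      by (rule coef_cob_0[symmetric]) (use False in blast)
    finally show ?thesis .
  qed
  finally show ?thesis .
qed

text \<open>Evaluating the integral on an explicit finite set of base points avoids determining its support exactly.\<close>

lemma integral_top_superset:
  assumes "finite V" "\<And>v. v \<in> V \<Longrightarrow> \<forall>i. i \<notin> {1..d} \<longrightarrow> v i = 0"
    "\<And>v. f (v, {1..d}) \<noteq> 0 \<Longrightarrow> v \<in> V"
  shows "integral_top d f = (\<Sum>v\<in>V. f (v, {1..d}))"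
proof -
  have cells: "cells d d = {(v, {1..d}) | v. \<forall>i. i \<notin> {1..d} \<longrightarrow> v i = 0}"
    unfolding cells_def using card_subset_eq[of "{1..d}"] by auto
  have "integral_top d f = (\<Sum>c\<in>(\<lambda>v. (v, {1..d})) ` V. f c)"
    unfolding integral_top_def
  proof (rule sum.mono_neutral_left)
    show "finite ((\<lambda>v. (v, {1..d})) ` V)" using assms(1) by simp
    show "{c \<in> cells d d. f c \<noteq> 0} \<subseteq> (\<lambda>v. (v, {1..d})) ` V" unfolding cells using assms(3) by auto
    show "\<forall>i\<in>(\<lambda>v. (v, {1..d})) ` V - {c \<in> cells d d. f c \<noteq> 0}. f i = 0"
      unfolding cells using assms(2) by auto
  qed
  also have "\<dots> = (\<Sum>v\<in>V. f (v, {1..d}))"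
    by (subst sum.reindex) (auto simp: inj_on_def)
  finally show ?thesis .
qed

lemma int_cup_eq:
  assumes l: "l \<ge> 1" and d: "d = 4 * l - 1"
    and r: "r \<in> gauge_cells l" and s: "(v, J) \<in> qudits l"
  shows "int_cup l r (v, J) = (if r = (unshift v ({1..d} - J), {1..d} - J) then (-1) ^ inv_count J ({1..d} - J) else 0)"
proof -
  obtain w I where rw: "r = (w, I)" by fastforce
  have I: "I \<subseteq> {1..d}" "card I = 2 * l - 1" "\<forall>i. i \<notin> {1..d} \<longrightarrow> w i = 0" and J: "J \<subseteq> {1..d}"
    using r s unfolding rw gauge_cells_def qudits_def cells_def d[symmetric] by auto
  have "cup (2 * l - 1) (indicator {(w, I)}) (indicator {(v, J)}) (x, {1..d}) =
     of_bool (x = w \<and> shift w I = v \<and> {1..d} - I = J) * (-1) ^ inv_count J ({1..d} - J)" for x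
  proof -
    have "cup (2 * l - 1) (indicator {(w, I)}) (indicator {(v, J)}) (x, {1..d}) =
      (\<Sum>I0 | I0 \<subseteq> {1..d} \<and> card I0 = 2 * l - 1. if I0 = I then (-1) ^ inv_count ({1..d} - I) I * of_bool (x = w \<and> shift w I = v \<and> {1..d} - I = J) else 0)"
      unfolding cup_def prod.case by (rule sum.cong) (auto simp: indicator_def)
    also have "\<dots> = (-1) ^ inv_count ({1..d} - I) I * of_bool (x = w \<and> shift w I = v \<and> {1..d} - I = J)"
      by (subst sum.delta) (use I in \<open>auto simp del: atLeastAtMost_iff\<close>)
    also have "\<dots> = of_bool (x = w \<and> shift w I = v \<and> {1..d} - I = J) * (-1) ^ inv_count J ({1..d} - J)"
    proof (cases "{1..d} - I = J")
      case True
      then have "{1..d} - J = I" using I by blast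
      with True show ?thesis by simp
    qed simp
    finally show ?thesis .
  qed
  then have "int_cup l r (v, J) = of_bool (shift w I = v \<and> {1..d} - I = J) * (-1) ^ inv_count J ({1..d} - J)"
    unfolding int_cup_def rw d[symmetric]
    by (subst integral_top_superset[of "{w}"]) (use I in auto)
  moreover have "shift w I = v \<and> {1..d} - I = J \<longleftrightarrow> r = (unshift v ({1..d} - J), {1..d} - J)"
    unfolding rw prod.inject using I(1) J
    by (metis double_diff eq_shift_iff order_refl)
  ultimately show ?thesis by simp
qed

text \<open>With a single cell \<open>s = (w, L)\<close> as second factor, each shared
  direction \<open>c \<in> L\<close> determines the first cell completely, so the integral is a finite sum of values of \<open>a\<close>.\<close>

lemma int_cup1_indicator:
  assumes l: "l \<ge> 1" and d: "d = 4 * l - 1" and n: "n = 2 * l - 1" and s: "s \<in> qudits l"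
  shows "int_cup1 l a (indicator {s}) = pair (cup1_left d n s) a"
proof -
  obtain w L where sw: "s = (w, L)" by fastforce
  have dn: "d = 2 * n + 1" using l d n by simp
  have "(w, L) \<in> cells d (n + 1)" using s l unfolding sw qudits_def d n by simp
  note L = cell_compl[OF this dn]
  have w0: "w i = 0" if "i \<notin> {1..d}" for i using s that unfolding sw qudits_def cells_def d by simp
  define vc where "vc c = unshift w {i\<in>{1..d} - L. i < c}" for c
  define g where "g c v = (-1) ^ (n + inv_count (L - {c}) ({1..d} - L)) * a (shift v {j\<in>L. c < j}, insert c ({1..d} - L))" for c v
  have cup1: "cup1 (2 * l) (2 * l) a (indicator {(w, L)}) (v, {1..d}) = (\<Sum>c\<in>L. if v = vc c then g c v else 0)" for v
  proof -
    have inner: "(\<Sum>I | I \<subseteq> {1..d} - {c} \<and> card I = 2 * l - 1.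
     (let J = {1..d} - {c} - I in
       (-1) ^ (2 * l - 1 + inv_count J I)
         * a (shift v {j \<in> J. c < j}, insert c I)
         * indicator {(w, L)} (shift v {i \<in> I. i < c}, insert c J))) = (if c \<in> L \<and> v = vc c then g c v else 0)"
      (is "(\<Sum>I | I \<subseteq> {1..d} - {c} \<and> card I = 2 * l - 1. ?f I) = _") if c: "c \<in> {1..d}" for c
    proof -
      have f: "?f I = (if I = {1..d} - L then (if c \<in> L \<and> v = vc c then g c v else 0) else 0)" if I: "I \<subseteq> {1..d} - {c}" for I
      proof -
        have *: "insert c ({1..d} - {c} - I) = L \<longleftrightarrow> c \<in> L \<and> I = {1..d} - L"
          using I c L(3) by blast
        show ?thesis
        proof (cases "c \<in> L \<and> I = {1..d} - L")
          case True
          then have IL: "I = {1..d} - L" and cL: "c \<in> L" by auto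
          have J: "{1..d} - {c} - I = L - {c}" unfolding IL using L(3) by blast
          have c2: "{j \<in> L - {c}. c < j} = {j\<in>L. c < j}" by auto
          have "(shift v {i \<in> I. i < c}, insert c (L - {c})) = (w, L) \<longleftrightarrow> shift v {i \<in> I. i < c} = w"
            using insert_Diff[OF cL] by simp
          also have "\<dots> \<longleftrightarrow> v = vc c"
            unfolding vc_def IL by (subst eq_commute) (rule eq_shift_iff)
          finally have "(shift v {i \<in> I. i < c}, insert c (L - {c})) = (w, L) \<longleftrightarrow> v = vc c" .
          then show ?thesis using True unfolding Let_def J c2 g_def n
            by (simp add: indicator_def)
        next
          case False
          then have "insert c ({1..d} - {c} - I) \<noteq> L" using * by blast
          then show ?thesis using False unfolding Let_def by (auto simp: indicator_def)
        qed
      qed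
      show ?thesis
      proof (cases "c \<in> L")
        case True
        have "(\<Sum>I | I \<subseteq> {1..d} - {c} \<and> card I = 2 * l - 1. ?f I) =
            (\<Sum>I | I \<subseteq> {1..d} - {c} \<and> card I = 2 * l - 1. if I = {1..d} - L then (if c \<in> L \<and> v = vc c then g c v else 0) else 0)"
          using f by (intro sum.cong) auto
        also have "\<dots> = (if c \<in> L \<and> v = vc c then g c v else 0)"
        proof (subst sum.delta)
          show "finite {I. I \<subseteq> {1..d} - {c} \<and> card I = 2 * l - 1}" by simp
          have "{1..d} - L \<subseteq> {1..d} - {c}" using True by blast
          then have "{1..d} - L \<in> {I. I \<subseteq> {1..d} - {c} \<and> card I = 2 * l - 1}" using L(1) n by (simp only: mem_Collect_eq simp_thms)
          then show "(if {1..d} - L \<in> {I. I \<subseteq> {1..d} - {c} \<and> card I = 2 * l - 1} then if c \<in> L \<and> v = vc c then g c v else 0 else 0) =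
            (if c \<in> L \<and> v = vc c then g c v else 0)" by (simp only: if_True)
        qed
        finally show ?thesis .
      next
        case False
        then have "?f I = 0" if "I \<subseteq> {1..d} - {c}" for I unfolding f[OF that] by simp
        then have "(\<Sum>I | I \<subseteq> {1..d} - {c} \<and> card I = 2 * l - 1. ?f I) = 0"
          by (intro sum.neutral) blast
        then show ?thesis by (simp only: False simp_thms if_False)
      qed
    qed
    have "cup1 (2 * l) (2 * l) a (indicator {(w, L)}) (v, {1..d}) = (\<Sum>c\<in>{1..d}. if c \<in> L \<and> v = vc c then g c v else 0)"
      unfolding cup1_def prod.case using inner by (intro sum.cong) auto
    also have "\<dots> = (\<Sum>c\<in>L. if c \<in> L \<and> v = vc c then g c v else 0)"
      by (rule sum.mono_neutral_right) (use L(3) in auto)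
    finally show ?thesis by simp
  qed
  have "int_cup1 l a (indicator {s}) = (\<Sum>v\<in>vc ` L. \<Sum>c\<in>L. if v = vc c then g c v else 0)"
    unfolding int_cup1_def sw d[symmetric] cup1[symmetric]
  proof (rule integral_top_superset)
    show "finite (vc ` L)" using L by simp
    show "\<forall>i. i \<notin> {1..d} \<longrightarrow> v i = 0" if "v \<in> vc ` L" for v
      using that w0 by (auto simp: vc_def unshift_def)
    show "v \<in> vc ` L" if "cup1 (2 * l) (2 * l) a (indicator {(w, L)}) (v, {1..d}) \<noteq> 0" for v
    proof (rule ccontr)
      assume "v \<notin> vc ` L"
      then have "(\<Sum>c\<in>L. if v = vc c then g c v else 0) = 0" by (intro sum.neutral) auto
      then show False using that cup1 by simp
    qed
  qed
  also have "\<dots> = (\<Sum>c\<in>L. \<Sum>v\<in>vc ` L. if v = vc c then g c v else 0)" by (rule sum.swap)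
  also have "\<dots> = (\<Sum>c\<in>L. g c (vc c))"
    by (rule sum.cong) (use L in \<open>simp_all add: sum.delta\<close>)
  also have "\<dots> = pair (cup1_left d n s) a"
    unfolding sw cup1_left_def prod.case g_def vc_def by (simp add: pair_linear)
  finally show ?thesis .
qed

section \<open>Pauli operators modulo phases\<close>

locale paulis =
  fixes Q :: "'q set" and p :: nat
  assumes p: "p > 0"
begin

definition \<chi> :: "int \<Rightarrow> complex" where
  "\<chi> a = exp (2 * of_real pi * \<i> / of_nat p) powi a"

lemma chi_exp: "\<chi> a = exp (\<i> * of_real (2 * pi * of_int a / of_nat p))"
  unfolding \<chi>_def by (subst exp_power_int) (simp add: field_simps)

lemma chi_add: "\<chi> (a + b) = \<chi> a * \<chi> b"
  unfolding \<chi>_def by (rule power_int_add) simp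
lemma chi_0 [simp]: "\<chi> 0 = 1" by (simp add: \<chi>_def)
lemma chi_nonzero [simp]: "\<chi> a \<noteq> 0" by (simp add: \<chi>_def)
lemma norm_chi [simp]: "cmod (\<chi> a) = 1" by (simp add: chi_exp)

lemma chi_eq_1_iff: "\<chi> a = 1 \<longleftrightarrow> int p dvd a"
proof
  assume "\<chi> a = 1"
  then have "Re (\<chi> a) = 1" by simp
  then have "cos (2 * pi * of_int a / of_nat p) = 1" unfolding chi_exp by (simp add: Re_exp)
  then obtain n :: int where "2 * pi * of_int a / of_nat p = of_int n * 2 * pi"
    using cos_one_2pi_int by auto
  then have "real_of_int a = of_int n * of_nat p" using p by (simp add: field_simps)
  then have "a = n * int p" by (metis of_int_eq_iff of_int_mult of_int_of_nat_eq)
  then show "int p dvd a" by simp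
next
  assume "int p dvd a"
  then obtain n where "a = int p * n" by blast
  then have "\<chi> a = cis (2 * pi * of_int n)" unfolding chi_exp cis_conv_exp using p by (simp add: mult.assoc)
  then show "\<chi> a = 1" by (simp add: cis_multiple_2pi)
qed

lemma chi_diff: "\<chi> (a - b) = \<chi> a / \<chi> b"
  using chi_add[of "a - b" b] by (simp add: field_simps)

lemma chi_minus: "\<chi> (- a) = inverse (\<chi> a)"
  using chi_diff[of 0 a] by (simp add: field_simps)

lemma chi_eq_iff: "\<chi> a = \<chi> b \<longleftrightarrow> int p dvd a - b"
  using chi_eq_1_iff[of "a - b"] by (simp add: chi_diff)

lemma chi_cong: "[a = b] (mod int p) \<Longrightarrow> \<chi> a = \<chi> b"
  by (simp add: chi_eq_iff cong_iff_dvd_diff)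

lemma pair_cong_mod:
  assumes "\<And>i. i \<in> supp z \<Longrightarrow> [f i = g i] (mod m)"
  shows "[pair z f = pair z g] (mod m)"
  unfolding pair_def by (intro cong_sum cong_mult cong_refl assms)

definition translate :: "('q \<Rightarrow>\<^sub>0 int) \<Rightarrow> ('q \<Rightarrow> int) \<Rightarrow> 'q \<Rightarrow> int" where
  "translate x \<phi> = (\<lambda>i\<in>Q. (\<phi> i - coef x i) mod int p)"

lemma translate_configs [simp]: "translate x \<phi> \<in> configs Q p"
  using p by (auto simp: translate_def configs_def)

lemma translate_translate: "translate x' (translate x \<phi>) = translate (x + x') \<phi>"
  unfolding translate_def
  by (rule restrict_ext) (simp add: lookup_add mod_diff_left_eq algebra_simps)

lemma translate_0: "\<phi> \<in> configs Q p \<Longrightarrow> translate 0 \<phi> = \<phi>"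
  unfolding translate_def configs_def
  by (rule ext) (auto simp: PiE_iff extensional_def restrict_def)

lemma chi_pair_translate:
  assumes "supp z \<subseteq> Q"
  shows "\<chi> (pair z (translate x \<phi>)) = \<chi> (pair z \<phi> - pair z (coef x))"
proof (rule chi_cong)
  have "[pair z (translate x \<phi>) = pair z (\<lambda>i. \<phi> i - coef x i)] (mod int p)"
    by (rule pair_cong_mod) (use assms in \<open>auto simp: translate_def cong_def\<close>)
  then show "[pair z (translate x \<phi>) = pair z \<phi> - pair z (coef x)] (mod int p)"
    by (simp add: pair_def algebra_simps sum_subtractf)
qed

text \<open>The normal form: a phase, times Z-operators with exponents \<open>z\<close>, times X-operators with
  exponents \<open>x\<close>.\<close>

definition pauli :: "complex \<Rightarrow> ('q \<Rightarrow>\<^sub>0 int) \<Rightarrow> ('q \<Rightarrow>\<^sub>0 int) \<Rightarrow> 'q operator" where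
  "pauli c x z = (\<lambda>\<psi>\<in>states Q p. \<lambda>\<phi>\<in>configs Q p. c * \<chi> (pair z \<phi>) * \<psi> (translate x \<phi>))"

abbreviation "B \<equiv> BijGroup (states Q p)"

lemma pauli_states: "\<psi> \<in> states Q p \<Longrightarrow> pauli c x z \<psi> \<in> states Q p"
  by (simp add: pauli_def states_def)

lemma compose_pauli:
  assumes "supp z' \<subseteq> Q"
  shows "compose (states Q p) (pauli c x z) (pauli c' x' z') =
    pauli (c * c' * \<chi> (- pair z' (coef x))) (x + x') (z + z')"
proof (rule ext)
  fix \<psi>
  show "compose (states Q p) (pauli c x z) (pauli c' x' z') \<psi> =
    pauli (c * c' * \<chi> (- pair z' (coef x))) (x + x') (z + z') \<psi>"
  proof (cases "\<psi> \<in> states Q p")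
    case True
    have "pauli c x z (pauli c' x' z' \<psi>) = pauli (c * c' * \<chi> (- pair z' (coef x))) (x + x') (z + z') \<psi>"
    proof (rule ext)
      fix \<phi>
      show "pauli c x z (pauli c' x' z' \<psi>) \<phi> = pauli (c * c' * \<chi> (- pair z' (coef x))) (x + x') (z + z') \<psi> \<phi>"
        using True pauli_states[OF True, of c' x' z']
        by (simp add: pauli_def[of c] pauli_def[of "c * _"] restrict_def)
          (simp add: pauli_def chi_pair_translate[OF assms] translate_translate pair_add chi_add chi_diff
            chi_diff[of 0, simplified] mult_ac divide_simps)
    qed
    then show ?thesis using True by (simp add: compose_def)
  next
    case False
    then show ?thesis by (simp add: compose_def pauli_def)
  qed
qed

lemma pauli_1: "pauli 1 0 0 = (\<lambda>\<psi>\<in>states Q p. \<psi>)"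
proof (rule ext)
  fix \<psi> show "pauli 1 0 0 \<psi> = (\<lambda>\<psi>\<in>states Q p. \<psi>) \<psi>"
    by (auto simp: pauli_def translate_0 states_def PiE_iff extensional_def restrict_def fun_eq_iff)
qed

lemma pauli_inverse:
  assumes "supp z \<subseteq> Q" "c \<noteq> 0"
  shows "compose (states Q p) (pauli (inverse c * \<chi> (- pair z (coef x))) (- x) (- z)) (pauli c x z) = (\<lambda>\<psi>\<in>states Q p. \<psi>)"
    "compose (states Q p) (pauli c x z) (pauli (inverse c * \<chi> (- pair z (coef x))) (- x) (- z)) = (\<lambda>\<psi>\<in>states Q p. \<psi>)"
  using assms pauli_1
  by (simp_all add: compose_pauli pair_minus pair_commute[of z "- x"] pair_commute[of x] chi_minus field_simps)

lemma pauli_Bij: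
  assumes "supp z \<subseteq> Q" "c \<noteq> 0"
  shows "pauli c x z \<in> Bij (states Q p)"
proof -
  let ?S = "states Q p" and ?R = "pauli (inverse c * \<chi> (- pair z (coef x))) (- x) (- z)"
  have "bij_betw (pauli c x z) ?S ?S"
  proof (rule bij_betw_byWitness[where f' = ?R])
    show "\<forall>\<psi>\<in>?S. ?R (pauli c x z \<psi>) = \<psi>"
    proof
      fix \<psi> assume "\<psi> \<in> ?S"
      with fun_cong[OF pauli_inverse(1)[OF assms, of x], of \<psi>] show "?R (pauli c x z \<psi>) = \<psi>" by (simp add: compose_def)
    qed
    show "\<forall>\<psi>\<in>?S. pauli c x z (?R \<psi>) = \<psi>"
    proof
      fix \<psi> assume "\<psi> \<in> ?S"
      with fun_cong[OF pauli_inverse(2)[OF assms, of x], of \<psi>] show "pauli c x z (?R \<psi>) = \<psi>" by (simp add: compose_def)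
    qed
  qed (auto simp: pauli_states)
  then show ?thesis by (simp add: Bij_def pauli_def)
qed

lemma mult_pauli:
  assumes "supp z \<subseteq> Q" "supp z' \<subseteq> Q" "c \<noteq> 0" "c' \<noteq> 0"
  shows "pauli c x z \<otimes>\<^bsub>B\<^esub> pauli c' x' z' = pauli (c * c' * \<chi> (- pair z' (coef x))) (x + x') (z + z')"
  using assms by (simp add: BijGroup_def pauli_Bij compose_pauli)

lemma one_pauli: "\<one>\<^bsub>B\<^esub> = pauli 1 0 0"
  by (simp add: BijGroup_def pauli_1)

lemma phase_op_pauli: "phase_op Q p c = pauli c 0 0"
  unfolding phase_op_def pauli_def
  by (intro restrict_ext) (simp add: translate_0)

lemma X_op_pauli: "s \<in> Q \<Longrightarrow> X_op Q p s = pauli 1 (frag_of s) 0"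
proof -
  assume s: "s \<in> Q"
  have "\<phi>(s := (\<phi> s - 1) mod int p) = translate (frag_of s) \<phi>" if "\<phi> \<in> configs Q p" for \<phi>
    using that s unfolding translate_def configs_def
    by (auto simp: fun_eq_iff PiE_iff extensional_def)
  then show ?thesis
    unfolding X_op_def pauli_def by (intro restrict_ext) simp
qed

lemma Z_op_pauli: "Z_op Q p s = pauli 1 0 (frag_of s)"
  unfolding Z_op_def pauli_def \<chi>_def
  by (intro restrict_ext) (simp add: translate_0)

definition paulis :: "'q operator set" where
  "paulis = {pauli c x z | c x z. cmod c = 1 \<and> supp x \<subseteq> Q \<and> supp z \<subseteq> Q}"

lemma pauli_in_paulis [intro]:
  "cmod c = 1 \<Longrightarrow> supp x \<subseteq> Q \<Longrightarrow> supp z \<subseteq> Q \<Longrightarrow> pauli c x z \<in> paulis"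
  unfolding paulis_def by blast

lemma norm_1_nonzero: "cmod c = 1 \<Longrightarrow> c \<noteq> 0" by auto

lemma inv_pauli:
  assumes "supp z \<subseteq> Q" "cmod c = 1"
  shows "inv\<^bsub>B\<^esub> (pauli c x z) = pauli (inverse c * \<chi> (- pair z (coef x))) (- x) (- z)"
proof (rule group.inv_equality[OF group_BijGroup])
  have c: "c \<noteq> 0" using assms by auto
  show "pauli (inverse c * \<chi> (- pair z (coef x))) (- x) (- z) \<otimes>\<^bsub>B\<^esub> pauli c x z = \<one>\<^bsub>B\<^esub>"
    using pauli_inverse(1)[OF assms(1) c] assms c by (simp add: BijGroup_def pauli_Bij supp_ops)
  show "pauli c x z \<in> carrier B" "pauli (inverse c * \<chi> (- pair z (coef x))) (- x) (- z) \<in> carrier B"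
    using assms c by (simp_all add: BijGroup_def pauli_Bij supp_ops)
qed

lemma subgroup_paulis: "subgroup paulis B"
proof (rule group.subgroupI[OF group_BijGroup])
  show "paulis \<subseteq> carrier B" unfolding paulis_def by (auto simp: BijGroup_def intro!: pauli_Bij)
  show "paulis \<noteq> {}" using pauli_in_paulis[of 1 0 0] by auto
  show "inv\<^bsub>B\<^esub> a \<in> paulis" if a: "a \<in> paulis" for a
  proof -
    obtain c x z where "a = pauli c x z" "cmod c = 1" "supp x \<subseteq> Q" "supp z \<subseteq> Q" using a unfolding paulis_def by blast
    then show ?thesis by (simp add: inv_pauli pauli_in_paulis supp_ops norm_mult norm_inverse)
  qed
  show "a \<otimes>\<^bsub>B\<^esub> b \<in> paulis" if ab: "a \<in> paulis" "b \<in> paulis" for a b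
  proof -
    obtain c x z where a: "a = pauli c x z" "cmod c = 1" "supp x \<subseteq> Q" "supp z \<subseteq> Q" using ab unfolding paulis_def by blast
    obtain c' x' z' where b: "b = pauli c' x' z'" "cmod c' = 1" "supp x' \<subseteq> Q" "supp z' \<subseteq> Q" using ab unfolding paulis_def by blast
    show ?thesis unfolding a(1) b(1)
      by (subst mult_pauli) (use a b in \<open>simp_all add: pauli_in_paulis supp_ops norm_mult norm_1_nonzero\<close>)
  qed
qed

lemma carrier_pauli_group: "carrier (pauli_group Q p) = paulis"
proof -
  let ?gens = "phases Q p \<union> X_op Q p ` Q \<union> Z_op Q p ` Q"
  have gens: "?gens \<subseteq> paulis"
    unfolding phases_def by (auto simp: phase_op_pauli X_op_pauli Z_op_pauli intro!: pauli_in_paulis)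
  interpret B: group B by (rule group_BijGroup)
  have sub: "subgroup (generate B ?gens) B"
    using gens subgroup.subset[OF subgroup_paulis] by (intro B.generate_is_subgroup) blast
  have pX: "pauli 1 x 0 \<in> generate B ?gens" if "supp x \<subseteq> Q" for x
    using that
  proof (induction x rule: frag_induction)
    case zero show ?case using subgroup.one_closed[OF sub] by (simp add: one_pauli)
  next
    case (one s)
    then have "X_op Q p s \<in> generate B ?gens" by (intro generate.incl) blast
    then show ?case using X_op_pauli[OF one] by simp
  next
    case (diff a b)
    have "pauli 1 a 0 \<otimes>\<^bsub>B\<^esub> inv\<^bsub>B\<^esub> (pauli 1 b 0) = pauli 1 (a - b) 0"
      by (simp add: inv_pauli mult_pauli)
    then show ?case using subgroup.m_closed[OF sub diff(1) subgroup.m_inv_closed[OF sub diff(2)]] by simp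
  qed
  have pZ: "pauli 1 0 z \<in> generate B ?gens \<and> supp z \<subseteq> Q" if "supp z \<subseteq> Q" for z
    using that
  proof (induction z rule: frag_induction)
    case zero show ?case using subgroup.one_closed[OF sub] by (simp add: one_pauli)
  next
    case (one s)
    then have "Z_op Q p s \<in> generate B ?gens" by (intro generate.incl) blast
    then show ?case using Z_op_pauli[of s] one by simp
  next
    case (diff a b)
    have "pauli 1 0 a \<otimes>\<^bsub>B\<^esub> inv\<^bsub>B\<^esub> (pauli 1 0 b) = pauli 1 0 (a - b)"
      using diff by (simp add: inv_pauli mult_pauli supp_ops pair_def)
    then show ?case using diff subgroup.m_closed[OF sub _ subgroup.m_inv_closed[OF sub]] supp_ops(2) by metis
  qed
  have "pauli c x z \<in> generate B ?gens" if "cmod c = 1" "supp x \<subseteq> Q" "supp z \<subseteq> Q" for c x z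
  proof -
    have "pauli c 0 0 \<in> generate B ?gens"
      using that by (intro generate.incl) (auto simp: phases_def phase_op_pauli[symmetric])
    moreover have "pauli c 0 0 \<otimes>\<^bsub>B\<^esub> (pauli 1 0 z \<otimes>\<^bsub>B\<^esub> pauli 1 x 0) = pauli c x z"
      using that by (simp add: mult_pauli norm_1_nonzero pair_def)
    ultimately show ?thesis using pX pZ that subgroup.m_closed[OF sub] by metis
  qed
  then have "paulis \<subseteq> generate B ?gens" unfolding paulis_def by blast
  moreover have "generate B ?gens \<subseteq> paulis" by (rule B.generate_subgroup_incl[OF gens subgroup_paulis])
  ultimately show ?thesis by (simp add: pauli_group_def)
qed

lemma pauli_group_eq: "pauli_group Q p = B\<lparr>carrier := paulis\<rparr>"
  using carrier_pauli_group unfolding pauli_group_def by simp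

lemma mult_pauli_group [simp]: "mult (pauli_group Q p) = mult B"
  by (simp add: pauli_group_def)

lemma group_pauli_group: "group (pauli_group Q p)"
  unfolding pauli_group_eq by (rule subgroup.subgroup_is_group[OF subgroup_paulis group_BijGroup])

definition cls :: "('q \<Rightarrow>\<^sub>0 int) \<Rightarrow> ('q \<Rightarrow>\<^sub>0 int) \<Rightarrow> 'q operator set" where
  "cls x z = {pauli c x z | c. cmod c = 1}"

lemma phases_cls: "phases Q p = cls 0 0"
  by (simp add: phases_def cls_def phase_op_pauli)

lemma coset_pauli:
  assumes "supp z \<subseteq> Q" "cmod c = 1"
  shows "phases Q p #>\<^bsub>pauli_group Q p\<^esub> pauli c x z = cls x z"
proof -
  have eq: "pauli c' 0 0 \<otimes>\<^bsub>B\<^esub> pauli c x z = pauli (c' * c) x z" if "cmod c' = 1" for c'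
    using that assms by (simp add: mult_pauli norm_1_nonzero pair_def)
  show ?thesis
  proof (intro Set.set_eqI iffI)
    fix A assume "A \<in> phases Q p #>\<^bsub>pauli_group Q p\<^esub> pauli c x z"
    then obtain c' where "cmod c' = 1" "A = pauli (c' * c) x z"
      unfolding r_coset_def phases_cls cls_def using eq by auto
    then show "A \<in> cls x z" unfolding cls_def using assms by (auto simp: norm_mult)
  next
    fix A assume "A \<in> cls x z"
    then obtain c' where c': "cmod c' = 1" "A = pauli c' x z" unfolding cls_def by blast
    have "cmod (c' / c) = 1" "c' / c * c = c'" using c' assms by (auto simp: norm_divide)
    then show "A \<in> phases Q p #>\<^bsub>pauli_group Q p\<^esub> pauli c x z"
      unfolding r_coset_def phases_cls cls_def mult_pauli_group using eq[of "c' / c"] c' by force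
  qed
qed

lemma X_cls_eq: "s \<in> Q \<Longrightarrow> X_cls Q p s = cls (frag_of s) 0"
  by (simp add: X_cls_def X_op_pauli coset_pauli)

lemma Z_cls_eq: "s \<in> Q \<Longrightarrow> Z_cls Q p s = cls 0 (frag_of s)"
  by (simp add: Z_cls_def Z_op_pauli coset_pauli)

lemma set_mult_cls:
  assumes "supp z \<subseteq> Q" "supp z' \<subseteq> Q"
  shows "cls x z <#>\<^bsub>pauli_group Q p\<^esub> cls x' z' = cls (x + x') (z + z')"
proof (intro Set.set_eqI iffI)
  fix A assume "A \<in> cls x z <#>\<^bsub>pauli_group Q p\<^esub> cls x' z'"
  then obtain c c' where "cmod c = 1" "cmod c' = 1" "A = pauli c x z \<otimes>\<^bsub>B\<^esub> pauli c' x' z'"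
    unfolding set_mult_def cls_def by auto
  then show "A \<in> cls (x + x') (z + z')" unfolding cls_def
    using assms by (auto simp: mult_pauli norm_1_nonzero norm_mult intro!: exI[of _ "c * c' * \<chi> (- pair z' (coef x))"])
next
  fix A assume "A \<in> cls (x + x') (z + z')"
  then obtain c where c: "cmod c = 1" "A = pauli c (x + x') (z + z')" unfolding cls_def by blast
  have "A = pauli (c * \<chi> (pair z' (coef x))) x z \<otimes>\<^bsub>B\<^esub> pauli 1 x' z'"
    using c assms by (simp add: mult_pauli norm_1_nonzero mult.assoc flip: chi_add)
  moreover have "cmod (c * \<chi> (pair z' (coef x))) = 1" using c by (simp add: norm_mult)
  ultimately have "\<exists>a\<in>cls x z. \<exists>b\<in>cls x' z'. A = a \<otimes>\<^bsub>B\<^esub> b"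
    unfolding cls_def using norm_one[where 'a = complex] by blast
  then show "A \<in> cls x z <#>\<^bsub>pauli_group Q p\<^esub> cls x' z'"
    unfolding set_mult_def mult_pauli_group by simp
qed

lemma normal_phases: "phases Q p \<lhd> pauli_group Q p"
proof -
  interpret G: group "pauli_group Q p" by (rule group_pauli_group)
  have sub: "subgroup (phases Q p) (pauli_group Q p)"
  proof (rule G.subgroupI)
    show "phases Q p \<subseteq> carrier (pauli_group Q p)" unfolding carrier_pauli_group phases_cls cls_def by auto
    show "phases Q p \<noteq> {}" unfolding phases_cls cls_def using norm_one by blast
    show "a \<otimes>\<^bsub>pauli_group Q p\<^esub> b \<in> phases Q p" if "a \<in> phases Q p" "b \<in> phases Q p" for a b
      using that set_mult_cls[of 0 0 0 0] unfolding phases_cls set_mult_def by auto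
    show "inv\<^bsub>pauli_group Q p\<^esub> a \<in> phases Q p" if a: "a \<in> phases Q p" for a
    proof -
      obtain c where c: "cmod c = 1" "a = pauli c 0 0" using a unfolding phases_cls cls_def by blast
      have "inv\<^bsub>pauli_group Q p\<^esub> a = inv\<^bsub>B\<^esub> a"
        unfolding pauli_group_eq
        by (rule group.m_inv_consistent[OF group_BijGroup subgroup_paulis]) (use c in auto)
      then show ?thesis using c unfolding phases_cls cls_def by (auto simp: inv_pauli norm_inverse)
    qed
  qed
  show ?thesis
  proof (rule G.normalI[OF sub], intro ballI)
    fix A assume "A \<in> carrier (pauli_group Q p)"
    then obtain c x z where A: "A = pauli c x z" "cmod c = 1" "supp x \<subseteq> Q" "supp z \<subseteq> Q"
      unfolding carrier_pauli_group paulis_def by blast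
    have "h \<otimes>\<^bsub>B\<^esub> A = A \<otimes>\<^bsub>B\<^esub> h" if "h \<in> phases Q p" for h
      using that A unfolding phases_cls cls_def by (auto simp: mult_pauli norm_1_nonzero pair_def mult.commute)
    then show "phases Q p #>\<^bsub>pauli_group Q p\<^esub> A = A <#\<^bsub>pauli_group Q p\<^esub> phases Q p"
      unfolding r_coset_def l_coset_def by auto
  qed
qed

abbreviation "P \<equiv> pauli_mod Q p"

lemma carrier_P: "carrier P = {cls x z | x z. supp x \<subseteq> Q \<and> supp z \<subseteq> Q}"
proof (intro Set.set_eqI iffI)
  fix g assume "g \<in> carrier P"
  then show "g \<in> {cls x z | x z. supp x \<subseteq> Q \<and> supp z \<subseteq> Q}"
    unfolding pauli_mod_def carrier_FactGroup carrier_pauli_group paulis_def using coset_pauli by blast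
next
  fix g assume "g \<in> {cls x z | x z. supp x \<subseteq> Q \<and> supp z \<subseteq> Q}"
  then obtain x z where "supp x \<subseteq> Q" "supp z \<subseteq> Q" "g = cls x z" by blast
  then show "g \<in> carrier P"
    unfolding pauli_mod_def carrier_FactGroup carrier_pauli_group
    using coset_pauli[of z 1 x] pauli_in_paulis[of 1 x z] by (metis image_eqI norm_one)
qed

lemma cls_carrier [simp]: "supp x \<subseteq> Q \<Longrightarrow> supp z \<subseteq> Q \<Longrightarrow> cls x z \<in> carrier P"
  unfolding carrier_P by blast

lemma mult_cls: "supp z \<subseteq> Q \<Longrightarrow> supp z' \<subseteq> Q \<Longrightarrow> cls x z \<otimes>\<^bsub>P\<^esub> cls x' z' = cls (x + x') (z + z')"
  unfolding pauli_mod_def mult_FactGroup by (rule set_mult_cls)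

lemma one_cls: "\<one>\<^bsub>P\<^esub> = cls 0 0"
  by (simp add: pauli_mod_def phases_cls)

lemma comm_group_P: "comm_group P"
proof -
  interpret group P
    unfolding pauli_mod_def by (rule normal.factorgroup_is_group[OF normal_phases])
  show ?thesis
  proof (rule group_comm_groupI)
    fix g h assume "g \<in> carrier P" "h \<in> carrier P"
    then show "g \<otimes>\<^bsub>P\<^esub> h = h \<otimes>\<^bsub>P\<^esub> g"
      unfolding carrier_P by (auto simp: mult_cls add.commute)
  qed
qed

sublocale P: comm_group P by (rule comm_group_P)

lemma inv_cls: "supp x \<subseteq> Q \<Longrightarrow> supp z \<subseteq> Q \<Longrightarrow> inv\<^bsub>P\<^esub> (cls x z) = cls (- x) (- z)"
  by (rule P.inv_equality) (simp_all add: mult_cls supp_ops one_cls)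

lemma nat_pow_cls: "supp x \<subseteq> Q \<Longrightarrow> supp z \<subseteq> Q \<Longrightarrow> cls x z [^]\<^bsub>P\<^esub> (n::nat) = cls (frag_cmul (int n) x) (frag_cmul (int n) z)"
proof (induction n)
  case 0 then show ?case by (simp add: one_cls)
next
  case (Suc n)
  then have "cls x z [^]\<^bsub>P\<^esub> Suc n = cls (frag_cmul (int n) x) (frag_cmul (int n) z) \<otimes>\<^bsub>P\<^esub> cls x z" by simp
  also have "\<dots> = cls (frag_cmul (int n) x + x) (frag_cmul (int n) z + z)"
    by (rule mult_cls) (use Suc.prems supp_ops(3) in blast)+
  finally show ?case
    using frag_cmul_distrib[of "int n" 1 x] frag_cmul_distrib[of "int n" 1 z] by (simp add: add.commute)
qed

lemma int_pow_cls:
  assumes "supp x \<subseteq> Q" "supp z \<subseteq> Q"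
  shows "cls x z [^]\<^bsub>P\<^esub> (n::int) = cls (frag_cmul n x) (frag_cmul n z)"
proof (cases "n < 0")
  case True
  then have "cls x z [^]\<^bsub>P\<^esub> n = inv\<^bsub>P\<^esub> (cls x z [^]\<^bsub>P\<^esub> nat (- n))" by (subst int_pow_def2) simp
  also have "\<dots> = cls (frag_cmul n x) (frag_cmul n z)"
    unfolding nat_pow_cls[OF assms] using True assms by (simp add: inv_cls supp_ops)
  finally show ?thesis .
next
  case False
  then have eq: "cls x z [^]\<^bsub>P\<^esub> n = cls x z [^]\<^bsub>P\<^esub> nat n" by (subst int_pow_def2) simp
  show ?thesis unfolding eq nat_pow_cls[OF assms] using False by simp
qed

lemma gfinprod_cls:
  assumes J: "finite J" "J \<subseteq> I"
    and g: "\<And>i. i \<in> I \<Longrightarrow> g i = cls (x i) (z i) \<and> supp (x i) \<subseteq> Q \<and> supp (z i) \<subseteq> Q"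
    and out: "\<And>i. i \<in> I - J \<Longrightarrow> x i = 0 \<and> z i = 0"
  shows "gfinprod P g I = cls (\<Sum>i\<in>J. x i) (\<Sum>i\<in>J. z i) \<and> supp (\<Sum>i\<in>J. x i) \<subseteq> Q \<and> supp (\<Sum>i\<in>J. z i) \<subseteq> Q"
proof -
  have "gfinprod P g I = gfinprod P g J"
    by (rule P.gfinprod_mono_neutral_cong_right) (use J g out in \<open>auto simp: one_cls\<close>)
  moreover have "gfinprod P g J = cls (\<Sum>i\<in>J. x i) (\<Sum>i\<in>J. z i) \<and> supp (\<Sum>i\<in>J. x i) \<subseteq> Q \<and> supp (\<Sum>i\<in>J. z i) \<subseteq> Q"
    using J
  proof (induction J rule: finite_induct)
    case empty show ?case by (simp add: one_cls)
  next
    case (insert i J)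
    have "gfinprod P g (insert i J) = g i \<otimes>\<^bsub>P\<^esub> gfinprod P g J"
      by (subst P.gfinprod_insert) (use insert g in auto)
    then show ?case using insert g by (simp add: mult_cls supp_ops)
  qed
  ultimately show ?thesis by simp
qed

lemma pauli_scalar_eq:
  assumes "pauli c x z = pauli c' x z" shows "c = c'"
proof -
  let ?\<psi> = "\<lambda>\<phi>\<in>configs Q p. (1::complex)" and ?\<phi> = "\<lambda>i\<in>Q. (0::int)"
  have "?\<psi> \<in> states Q p" "?\<phi> \<in> configs Q p" using p by (auto simp: states_def configs_def)
  then show ?thesis
    using fun_cong[OF fun_cong[OF assms, of ?\<psi>], of ?\<phi>] by (simp add: pauli_def)
qed

text \<open>A commutation relation determines its phase, because a multiple of a Pauli operator by a scalar
  determines the scalar. This is also the way in which exponents modulo \<open>p\<close> are recovered from operators.\<close>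

lemma commute_cls:
  assumes "supp x \<subseteq> Q" "supp z \<subseteq> Q" "supp x' \<subseteq> Q" "supp z' \<subseteq> Q" "cmod u = 1"
  shows "commute_with_phase Q p u (cls x z) (cls x' z') \<longleftrightarrow> u = \<chi> (commutator_form x z x' z')"
proof -
  have *: "pauli a x z \<otimes>\<^bsub>B\<^esub> pauli b x' z' = phase_op Q p u \<otimes>\<^bsub>B\<^esub> (pauli b x' z' \<otimes>\<^bsub>B\<^esub> pauli a x z) \<longleftrightarrow>
     u = \<chi> (commutator_form x z x' z')" if "cmod a = 1" "cmod b = 1" for a b
  proof -
    have nz: "a \<noteq> 0" "b \<noteq> 0" "u \<noteq> 0" using that assms by auto
    have l: "pauli a x z \<otimes>\<^bsub>B\<^esub> pauli b x' z' = pauli (a * b * \<chi> (- pair z' (coef x))) (x + x') (z + z')"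
      using assms nz by (simp add: mult_pauli)
    have r: "phase_op Q p u \<otimes>\<^bsub>B\<^esub> (pauli b x' z' \<otimes>\<^bsub>B\<^esub> pauli a x z) = pauli (u * (b * a * \<chi> (- pair z (coef x')))) (x + x') (z + z')"
      using assms nz by (simp add: mult_pauli phase_op_pauli supp_ops add.commute pair_def[of _ "coef 0"])
    have "a * b * \<chi> (- pair z' (coef x)) = u * (b * a * \<chi> (- pair z (coef x'))) \<longleftrightarrow> u = \<chi> (commutator_form x z x' z')"
      using nz unfolding commutator_form_def chi_diff chi_minus by (auto simp: field_simps)
    then show ?thesis unfolding l r using pauli_scalar_eq by metis
  qed
  show ?thesis unfolding commute_with_phase_def mult_pauli_group
  proof
    assume "\<forall>A\<in>cls x z. \<forall>B'\<in>cls x' z'. A \<otimes>\<^bsub>B\<^esub> B' = phase_op Q p u \<otimes>\<^bsub>B\<^esub> (B' \<otimes>\<^bsub>B\<^esub> A)"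
    moreover have "pauli 1 x z \<in> cls x z" "pauli 1 x' z' \<in> cls x' z'"
      unfolding cls_def using norm_one[where 'a = complex] by blast+
    ultimately show "u = \<chi> (commutator_form x z x' z')" using *[of 1 1] by simp
  next
    assume "u = \<chi> (commutator_form x z x' z')"
    then show "\<forall>A\<in>cls x z. \<forall>B'\<in>cls x' z'. A \<otimes>\<^bsub>B\<^esub> B' = phase_op Q p u \<otimes>\<^bsub>B\<^esub> (B' \<otimes>\<^bsub>B\<^esub> A)"
      using * unfolding cls_def by auto
  qed
qed

lemma generate_cls:
  assumes S: "S \<subseteq> Q"
  shows "generate P (X_cls Q p ` S \<union> Z_cls Q p ` S) = {cls x z | x z. supp x \<subseteq> S \<and> supp z \<subseteq> S}" (is "generate P ?g = ?R")
proof
  show "generate P ?g \<subseteq> ?R"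
  proof
    fix g assume "g \<in> generate P ?g"
    then show "g \<in> ?R"
    proof induction
      case one then show ?case unfolding one_cls by (intro CollectI exI[of _ 0]) simp
    next
      case (incl h)
      then obtain s where s: "s \<in> S" "h = cls (frag_of s) 0 \<or> h = cls 0 (frag_of s)"
        using S by (auto simp: X_cls_eq Z_cls_eq subset_iff)
      have "supp (frag_of s) \<subseteq> S" "supp (0 :: 'q \<Rightarrow>\<^sub>0 int) \<subseteq> S" using s(1) by simp_all
      then show ?case using s(2) by blast
    next
      case (inv h)
      then obtain s where s: "s \<in> S" "h = cls (frag_of s) 0 \<or> h = cls 0 (frag_of s)"
        using S by (auto simp: X_cls_eq Z_cls_eq subset_iff)
      then have "s \<in> Q" using S by blast
      then have "inv\<^bsub>P\<^esub> h = cls (- frag_of s) 0 \<or> inv\<^bsub>P\<^esub> h = cls 0 (- frag_of s)"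
        using s(2) inv_cls[of "frag_of s" 0] inv_cls[of 0 "frag_of s"] by auto
      moreover have "supp (- frag_of s) \<subseteq> S" "supp (0 :: 'q \<Rightarrow>\<^sub>0 int) \<subseteq> S" using s(1) by simp_all
      ultimately show ?case by blast
    next
      case (eng g h)
      then obtain x z x' z' where e: "g = cls x z" "h = cls x' z'" "supp x \<subseteq> S" "supp z \<subseteq> S" "supp x' \<subseteq> S" "supp z' \<subseteq> S" by blast
      then have "g \<otimes>\<^bsub>P\<^esub> h = cls (x + x') (z + z')" using S by (simp add: mult_cls)
      then show ?case using e supp_ops(1) by blast
    qed
  qed
  have sub: "subgroup (generate P ?g) P"
    by (rule P.generate_is_subgroup) (use S in \<open>auto simp: X_cls_eq Z_cls_eq subset_iff\<close>)
  have gX: "cls x 0 \<in> generate P ?g \<and> supp x \<subseteq> Q" if "supp x \<subseteq> S" for x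
    using that
  proof (induction x rule: frag_induction)
    case zero show ?case using subgroup.one_closed[OF sub] by (simp add: one_cls)
  next
    case (one s) then show ?case using S X_cls_eq[of s] generate.incl[of "X_cls Q p s" ?g P] by (auto simp: subset_iff)
  next
    case (diff a b)
    have "cls a 0 \<otimes>\<^bsub>P\<^esub> inv\<^bsub>P\<^esub> (cls b 0) = cls (a - b) 0"
      using diff by (simp add: inv_cls mult_cls)
    then show ?case using diff subgroup.m_closed[OF sub _ subgroup.m_inv_closed[OF sub]] supp_ops(2) by metis
  qed
  have gZ: "cls 0 z \<in> generate P ?g \<and> supp z \<subseteq> Q" if "supp z \<subseteq> S" for z
    using that
  proof (induction z rule: frag_induction)
    case zero show ?case using subgroup.one_closed[OF sub] by (simp add: one_cls)
  next
    case (one s) then show ?case using S Z_cls_eq[of s] generate.incl[of "Z_cls Q p s" ?g P] by (auto simp: subset_iff)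
  next
    case (diff a b)
    have "cls 0 a \<otimes>\<^bsub>P\<^esub> inv\<^bsub>P\<^esub> (cls 0 b) = cls 0 (a - b)"
      using diff by (simp add: inv_cls mult_cls supp_ops)
    then show ?case using diff subgroup.m_closed[OF sub _ subgroup.m_inv_closed[OF sub]] supp_ops(2) by metis
  qed
  show "?R \<subseteq> generate P ?g"
  proof
    fix g assume "g \<in> ?R"
    then obtain x z where g: "g = cls x z" "supp x \<subseteq> S" "supp z \<subseteq> S" by blast
    then have "g = cls x 0 \<otimes>\<^bsub>P\<^esub> cls 0 z" using S by (simp add: mult_cls)
    then show "g \<in> generate P ?g" using gX gZ g subgroup.m_closed[OF sub] by metis
  qed
qed

lemma frag_cmul_dvdE:
  assumes "\<And>i. c dvd coef y i"
  obtains a where "y = frag_cmul c a" "supp a \<subseteq> supp y"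
proof
  let ?a = "\<Sum>i\<in>supp y. frag_cmul (coef y i div c) (frag_of i)"
  have "y = (\<Sum>i\<in>supp y. frag_cmul (coef y i) (frag_of i))"
    using frag_expansion[of y] unfolding frag_extend_def .
  also have "\<dots> = frag_cmul c ?a"
    unfolding frag_cmul_sum by (rule sum.cong) (simp_all add: assms)
  finally show "y = frag_cmul c ?a" .
  show "supp ?a \<subseteq> supp y"
    by (rule order_trans[OF keys_sum]) (auto simp: keys_frag_of)
qed

lemma cls_add_multiple:
  assumes "supp a \<subseteq> Q" "supp b \<subseteq> Q"
  shows "cls (x + frag_cmul (int p) a) (z + frag_cmul (int p) b) = cls x z"
proof -
  have "translate (x + frag_cmul (int p) a) \<phi> = translate x \<phi>" for \<phi>
    unfolding translate_def
    by (rule restrict_ext) (simp add: lookup_add mod_eq_dvd_iff algebra_simps)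
  moreover have "\<chi> (pair (z + frag_cmul (int p) b) \<phi>) = \<chi> (pair z \<phi>)" for \<phi>
    by (rule chi_cong) (simp add: pair_linear cong_iff_dvd_diff)
  ultimately show ?thesis unfolding cls_def pauli_def by simp
qed

text \<open>The form is nondegenerate modulo \<open>p\<close>: commutation with the generators reads off every exponent.\<close>

lemma congruent_from_phases:
  assumes x: "supp x \<subseteq> Q" "supp z \<subseteq> Q" "supp x' \<subseteq> Q" "supp z' \<subseteq> Q"
    and eq: "\<And>y w. supp y \<subseteq> Q \<Longrightarrow> supp w \<subseteq> Q \<Longrightarrow> \<chi> (commutator_form x z y w) = \<chi> (commutator_form x' z' y w)"
  obtains a b where "x = x' + frag_cmul (int p) a" "z = z' + frag_cmul (int p) b" "supp a \<subseteq> Q" "supp b \<subseteq> Q"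
proof -
  have *: "int p dvd commutator_form x z y w - commutator_form x' z' y w" if "supp y \<subseteq> Q" "supp w \<subseteq> Q" for y w
    using eq[OF that] by (simp add: chi_eq_iff)
  have "int p dvd coef (x - x') i" for i
  proof (cases "i \<in> Q")
    case True
    then have "int p dvd commutator_form x z 0 (frag_of i) - commutator_form x' z' 0 (frag_of i)" by (intro *) auto
    then show ?thesis by (simp add: commutator_form_def lookup_minus pair_def[of _ "coef 0"] dvd_diff_commute)
  next
    case False
    then have "coef x i = 0" "coef x' i = 0" using x by (auto simp: in_keys_iff subset_iff)
    then show ?thesis by (simp add: lookup_minus)
  qed
  then obtain a where a: "x - x' = frag_cmul (int p) a" "supp a \<subseteq> supp (x - x')" by (rule frag_cmul_dvdE)
  have "int p dvd coef (z - z') i" for i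
  proof (cases "i \<in> Q")
    case True
    then have "int p dvd commutator_form x z (frag_of i) 0 - commutator_form x' z' (frag_of i) 0" by (intro *) auto
    then show ?thesis by (simp add: commutator_form_def lookup_minus del: lookup_frag_of)
  next
    case False
    then have "coef z i = 0" "coef z' i = 0" using x by (auto simp: in_keys_iff subset_iff)
    then show ?thesis by (simp add: lookup_minus)
  qed
  then obtain b where b: "z - z' = frag_cmul (int p) b" "supp b \<subseteq> supp (z - z')" by (rule frag_cmul_dvdE)
  show thesis
  proof (rule that)
    show "x = x' + frag_cmul (int p) a" "z = z' + frag_cmul (int p) b" by (simp_all flip: a(1) b(1))
    show "supp a \<subseteq> Q" "supp b \<subseteq> Q" using a b x supp_ops(2) by blast+
  qed
qed

lemma cls_eqD:
  assumes x: "supp x \<subseteq> Q" "supp z \<subseteq> Q" "supp x' \<subseteq> Q" "supp z' \<subseteq> Q" and eq: "cls x z = cls x' z'"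
  obtains a b where "x = x' + frag_cmul (int p) a" "z = z' + frag_cmul (int p) b" "supp a \<subseteq> Q" "supp b \<subseteq> Q"
proof (rule congruent_from_phases[OF x])
  fix y w :: "'q \<Rightarrow>\<^sub>0 int" assume y: "supp y \<subseteq> Q" "supp w \<subseteq> Q"
  then have "commute_with_phase Q p (\<chi> (commutator_form x z y w)) (cls x z) (cls y w)"
    using x by (simp add: commute_cls)
  then show "\<chi> (commutator_form x z y w) = \<chi> (commutator_form x' z' y w)"
    unfolding eq using x y by (simp add: commute_cls)
qed (rule that)

lemma cls_eqI:
  assumes "supp x \<subseteq> Q" "supp z \<subseteq> Q" "supp x' \<subseteq> Q" "supp z' \<subseteq> Q"
    and "\<And>y w. supp y \<subseteq> Q \<Longrightarrow> supp w \<subseteq> Q \<Longrightarrow> \<chi> (commutator_form x z y w) = \<chi> (commutator_form x' z' y w)"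
  shows "cls x z = cls x' z'"
  using congruent_from_phases[OF assms] by (metis cls_add_multiple)

end

text \<open>An additive map on exponents that preserves the form and is surjective modulo \<open>p\<close> induces an
  automorphism of the Pauli group modulo phases. Injectivity follows from nondegeneracy of the form.\<close>

locale symplectic_automorphism = paulis Q p for Q :: "'q set" and p :: nat +
  fixes F1 F2 :: "('q \<Rightarrow>\<^sub>0 int) \<Rightarrow> ('q \<Rightarrow>\<^sub>0 int) \<Rightarrow> ('q \<Rightarrow>\<^sub>0 int)"
  assumes F_supp: "supp x \<subseteq> Q \<Longrightarrow> supp z \<subseteq> Q \<Longrightarrow> supp (F1 x z) \<subseteq> Q \<and> supp (F2 x z) \<subseteq> Q"
    and F_add: "F1 (x + x') (z + z') = F1 x z + F1 x' z'" "F2 (x + x') (z + z') = F2 x z + F2 x' z'"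
    and F_cmul: "F1 (frag_cmul c x) (frag_cmul c z) = frag_cmul c (F1 x z)" "F2 (frag_cmul c x) (frag_cmul c z) = frag_cmul c (F2 x z)"
    and form_preserved: "supp x \<subseteq> Q \<Longrightarrow> supp z \<subseteq> Q \<Longrightarrow> supp x' \<subseteq> Q \<Longrightarrow> supp z' \<subseteq> Q \<Longrightarrow>
      [commutator_form (F1 x z) (F2 x z) (F1 x' z') (F2 x' z') = commutator_form x z x' z'] (mod int p)"
    and surjective_mod: "supp x \<subseteq> Q \<Longrightarrow> supp z \<subseteq> Q \<Longrightarrow> \<exists>y w a b. supp y \<subseteq> Q \<and> supp w \<subseteq> Q \<and> supp a \<subseteq> Q \<and> supp b \<subseteq> Q \<and>
      F1 y w = x + frag_cmul (int p) a \<and> F2 y w = z + frag_cmul (int p) b"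
begin

text \<open>A class has many exponent vectors. They differ by multiples of \<open>p\<close>, so their images all have the
  same class.\<close>

definition \<alpha> :: "'q operator set \<Rightarrow> 'q operator set" where
  "\<alpha> = (\<lambda>g\<in>carrier P. THE h. \<exists>x z. supp x \<subseteq> Q \<and> supp z \<subseteq> Q \<and> g = cls x z \<and> h = cls (F1 x z) (F2 x z))"

lemma alpha_cls:
  assumes "supp x \<subseteq> Q" "supp z \<subseteq> Q"
  shows "\<alpha> (cls x z) = cls (F1 x z) (F2 x z)"
proof -
  have "(THE h. \<exists>x' z'. supp x' \<subseteq> Q \<and> supp z' \<subseteq> Q \<and> cls x z = cls x' z' \<and> h = cls (F1 x' z') (F2 x' z')) = cls (F1 x z) (F2 x z)"
  proof (rule the_equality)
    show "\<exists>x' z'. supp x' \<subseteq> Q \<and> supp z' \<subseteq> Q \<and> cls x z = cls x' z' \<and> cls (F1 x z) (F2 x z) = cls (F1 x' z') (F2 x' z')"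
      using assms by blast
  next
    fix h assume "\<exists>x' z'. supp x' \<subseteq> Q \<and> supp z' \<subseteq> Q \<and> cls x z = cls x' z' \<and> h = cls (F1 x' z') (F2 x' z')"
    then obtain x' z' where x': "supp x' \<subseteq> Q" "supp z' \<subseteq> Q" "cls x z = cls x' z'" and h: "h = cls (F1 x' z') (F2 x' z')" by blast
    obtain a b where ab: "x = x' + frag_cmul (int p) a" "z = z' + frag_cmul (int p) b" "supp a \<subseteq> Q" "supp b \<subseteq> Q"
      by (rule cls_eqD[OF assms x'])
    have "cls (F1 x z) (F2 x z) = cls (F1 x' z' + frag_cmul (int p) (F1 a b)) (F2 x' z' + frag_cmul (int p) (F2 a b))"
      unfolding ab(1,2) F_add F_cmul ..
    also have "\<dots> = h" unfolding h using F_supp[OF ab(3,4)] by (intro cls_add_multiple) auto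
    finally show "h = cls (F1 x z) (F2 x z)" ..
  qed
  then show ?thesis unfolding \<alpha>_def using assms by simp
qed

lemma alpha_hom: "\<alpha> \<in> hom P P"
proof (rule homI)
  fix g assume "g \<in> carrier P"
  then show "\<alpha> g \<in> carrier P" unfolding carrier_P using F_supp by (auto simp: alpha_cls) blast
next
  fix g g' assume "g \<in> carrier P" "g' \<in> carrier P"
  then show "\<alpha> (g \<otimes>\<^bsub>P\<^esub> g') = \<alpha> g \<otimes>\<^bsub>P\<^esub> \<alpha> g'"
    unfolding carrier_P using F_supp by (auto simp: alpha_cls mult_cls supp_ops F_add)
qed

lemma alpha_commutation: "commutation_preserving Q p \<alpha>"
  unfolding commutation_preserving_def
proof (intro ballI allI impI)
  fix g g' and v :: complex assume "g \<in> carrier P" "g' \<in> carrier P" and v: "cmod v = 1"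
  then obtain x z x' z' where g: "g = cls x z" "g' = cls x' z'" and s: "supp x \<subseteq> Q" "supp z \<subseteq> Q" "supp x' \<subseteq> Q" "supp z' \<subseteq> Q"
    unfolding carrier_P by blast
  have "\<chi> (commutator_form (F1 x z) (F2 x z) (F1 x' z') (F2 x' z')) = \<chi> (commutator_form x z x' z')"
    by (rule chi_cong[OF form_preserved[OF s]])
  then show "commute_with_phase Q p v (\<alpha> g) (\<alpha> g') \<longleftrightarrow> commute_with_phase Q p v g g'"
    unfolding g using s v F_supp by (simp add: alpha_cls commute_cls)
qed

lemma alpha_inj: "inj_on \<alpha> (carrier P)"
proof (rule inj_onI)
  fix g g' assume gg: "g \<in> carrier P" "g' \<in> carrier P" and eq: "\<alpha> g = \<alpha> g'"
  obtain x z x' z' where g: "g = cls x z" "g' = cls x' z'" and s: "supp x \<subseteq> Q" "supp z \<subseteq> Q" "supp x' \<subseteq> Q" "supp z' \<subseteq> Q"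
    using gg unfolding carrier_P by blast
  have *: "\<chi> (commutator_form x z y w) = \<chi> (commutator_form x' z' y w)" if "supp y \<subseteq> Q" "supp w \<subseteq> Q" for y w
  proof -
    have "commute_with_phase Q p (\<chi> (commutator_form x z y w)) g (cls y w)" using s that g by (simp add: commute_cls)
    then have "commute_with_phase Q p (\<chi> (commutator_form x z y w)) (\<alpha> g) (\<alpha> (cls y w))"
      using alpha_commutation gg that unfolding commutation_preserving_def by simp
    then have "commute_with_phase Q p (\<chi> (commutator_form x z y w)) g' (cls y w)"
      using alpha_commutation gg that unfolding commutation_preserving_def eq by simp
    then show ?thesis using s that g by (simp add: commute_cls)
  qed
  show "g = g'" unfolding g by (rule cls_eqI[OF s *])
qed

lemma alpha_auto: "\<alpha> \<in> auto P"
proof -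
  have "\<alpha> ` carrier P = carrier P"
  proof
    show "\<alpha> ` carrier P \<subseteq> carrier P" using alpha_hom by (auto simp: hom_def)
    show "carrier P \<subseteq> \<alpha> ` carrier P"
    proof
      fix g assume "g \<in> carrier P"
      then obtain x z where g: "g = cls x z" "supp x \<subseteq> Q" "supp z \<subseteq> Q" unfolding carrier_P by blast
      from surjective_mod[OF g(2,3)] obtain y w a b where y: "supp y \<subseteq> Q" "supp w \<subseteq> Q" "supp a \<subseteq> Q" "supp b \<subseteq> Q"
        "F1 y w = x + frag_cmul (int p) a" "F2 y w = z + frag_cmul (int p) b" by blast
      then have "\<alpha> (cls y w) = g" unfolding g by (simp add: alpha_cls cls_add_multiple)
      then show "g \<in> \<alpha> ` carrier P" using y by (metis cls_carrier image_eqI)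
    qed
  qed
  then show ?thesis using alpha_hom alpha_inj unfolding auto_def Bij_def bij_betw_def by (simp add: \<alpha>_def)
qed

end

context paulis begin
lemma auto_eqI:
  assumes "\<alpha> \<in> auto P" "\<beta> \<in> auto P"
    and X: "\<And>s. s \<in> Q \<Longrightarrow> \<alpha> (X_cls Q p s) = \<beta> (X_cls Q p s)" and Z: "\<And>s. s \<in> Q \<Longrightarrow> \<alpha> (Z_cls Q p s) = \<beta> (Z_cls Q p s)"
  shows "\<alpha> = \<beta>"
proof (rule extensionalityI)
  show "\<alpha> \<in> extensional (carrier P)" "\<beta> \<in> extensional (carrier P)"
    using assms by (simp_all add: auto_def Bij_def)
  fix g assume "g \<in> carrier P"
  then have "g \<in> generate P (X_cls Q p ` Q \<union> Z_cls Q p ` Q)" unfolding carrier_P generate_cls[OF order_refl] .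
  moreover have "group_hom P P \<alpha>" "group_hom P P \<beta>"
    using assms P.group_axioms by (simp_all add: group_hom_def group_hom_axioms_def auto_def)
  moreover have gens: "X_cls Q p ` Q \<union> Z_cls Q p ` Q \<subseteq> carrier P" by (auto simp: X_cls_eq Z_cls_eq)
  ultimately show "\<alpha> g = \<beta> g"
  proof (induction rule: generate.induct)
    case one then show ?case by (simp add: group_hom.hom_one)
  next
    case (incl h) then show ?case using X Z by blast
  next
    case (inv h)
    then have "h \<in> carrier P" "\<alpha> h = \<beta> h" using X Z by blast+
    then show ?case using inv by (simp add: group_hom.hom_inv)
  next
    case (eng h1 h2)
    then have "h1 \<in> carrier P" "h2 \<in> carrier P" using P.generate_in_carrier gens by blast+
    then show ?case using eng by (simp add: group_hom.hom_mult)
  qed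
qed
end

section \<open>The quantum cellular automaton\<close>

lemma neighbourhood_0: "S \<subseteq> Q \<Longrightarrow> S \<subseteq> neighbourhood Q 0 S"
  by (auto simp: neighbourhood_def intro!: bexI)

lemma neighbourhood_mono: "R \<le> R' \<Longrightarrow> neighbourhood Q R S \<subseteq> neighbourhood Q R' S"
proof
  fix t assume R: "R \<le> R'" and "t \<in> neighbourhood Q R S"
  then obtain s where s: "t \<in> Q" "s \<in> S" "\<bar>fst t i - fst s i\<bar> \<le> int R" for i
    unfolding neighbourhood_def by blast
  have "\<bar>fst t i - fst s i\<bar> \<le> int R'" for i using s(3)[of i] R by simp
  then show "t \<in> neighbourhood Q R' S" unfolding neighbourhood_def using s(1,2) by blast
qed

lemma supp_frag_extend_near:
  assumes x: "supp x \<subseteq> neighbourhood Q R S"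
    and M: "\<And>s t. s \<in> Q \<Longrightarrow> t \<in> supp (M s) \<Longrightarrow> t \<in> Q \<and> near s t"
  shows "supp (frag_extend M x) \<subseteq> neighbourhood Q (R + 1) S"
proof
  fix t assume "t \<in> supp (frag_extend M x)"
  then obtain s where s: "s \<in> supp x" "t \<in> supp (M s)" using keys_frag_extend[of M x] by blast
  then have "s \<in> neighbourhood Q R S" using x by blast
  then obtain r where r: "s \<in> Q" "r \<in> S" "\<bar>fst s i - fst r i\<bar> \<le> int R" for i
    unfolding neighbourhood_def by blast
  have t: "t \<in> Q" "\<bar>fst t i - fst s i\<bar> \<le> 1" for i using M[OF r(1) s(2)] unfolding near_def by blast+
  have "\<bar>fst t i - fst r i\<bar> \<le> int (R + 1)" for i using r(3)[of i] t(2)[of i] by simp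
  then show "t \<in> neighbourhood Q (R + 1) S" unfolding neighbourhood_def using t(1) r(2) by blast
qed

locale construction =
  fixes p l :: nat and k :: int
  assumes prime_p: "prime p" and odd_p: "odd p" and coprime_k: "coprime k (int p)" and l: "l \<ge> 1"
begin

definition "d = 4 * l - 1"
definition "n = 2 * l - 1"
abbreviation "Q \<equiv> qudits l"
abbreviation "half \<equiv> modular_inverse (int p) 2"
abbreviation "half_k \<equiv> modular_inverse (int p) (2 * k)"
abbreviation "\<tau> \<equiv> \<lambda>(v, J). (shift v {1..d}, J)"

lemma dn: "d = 2 * n + 1" "odd n" using l by (auto simp: d_def n_def)

lemma Q_eq: "Q = cells d (n + 1)" unfolding qudits_def d_def n_def using l by simp

lemma gauge_eq: "gauge_cells l = cells d n" unfolding gauge_cells_def d_def n_def ..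

sublocale duality_mod Q "cup1_entry d n" "dual_cob d" "cup1_right d n" "cup1_left d n" \<tau> "int p" k half half_k
proof
  fix s t :: cell assume s: "s \<in> Q"
  show "supp (dual_cob d s) \<subseteq> Q" "supp (cup1_right d n s) \<subseteq> Q" "supp (cup1_left d n s) \<subseteq> Q"
    using supp_dual_cob supp_cup1_right supp_cup1_left s dn(1) unfolding Q_eq by blast+
  show "\<tau> s \<in> Q" using s unfolding Q_eq cells_def by (auto simp: shift_def)
  assume t: "t \<in> Q"
  obtain v J w L where st: "s = (v, J)" "t = (w, L)" by fastforce
  have sub: "J \<subseteq> {1..d}" "L \<subseteq> {1..d}" using s t unfolding st Q_eq cells_def by blast+
  show "coef (cup1_right d n s) t = cup1_entry d n s t" "coef (cup1_left d n t) s = cup1_entry d n s t"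
    unfolding st using sub by (simp_all add: coef_cup1_right coef_cup1_left)
  show "pair (dual_cob d s) (\<lambda>a. pair (dual_cob d t) (cup1_entry d n a)) = coef (dual_cob d s) t - coef (dual_cob d t) s"
    using cup1_dual_cob dn s t unfolding Q_eq by blast
  show "coef (dual_cob d (\<tau> t)) s = coef (dual_cob d s) t"
    using dual_cob_transpose[OF dn s[unfolded Q_eq st] t[unfolded Q_eq st]] unfolding st by simp
next
  have 2: "coprime 2 (int p)" using odd_p by simp
  show "[2 * half = 1] (mod int p)" by (rule cong_modular_inverse1[OF 2])
  show "[2 * k * half_k = 1] (mod int p)" by (rule cong_modular_inverse1) (use 2 coprime_k in simp)
qed

sublocale symplectic_automorphism Q p F1 F2
proof
  show "p > 0" using prime_p prime_gt_0_nat by blast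
  fix x z x' z' :: "cell \<Rightarrow>\<^sub>0 int" and c :: int
  show "F1 (x + x') (z + z') = F1 x z + F1 x' z'" "F2 (x + x') (z + z') = F2 x z + F2 x' z'"
    "F1 (frag_cmul c x) (frag_cmul c z) = frag_cmul c (F1 x z)" "F2 (frag_cmul c x) (frag_cmul c z) = frag_cmul c (F2 x z)"
    by (rule F_linear)+
  assume x: "supp x \<subseteq> Q" "supp z \<subseteq> Q"
  then show "supp (F1 x z) \<subseteq> Q \<and> supp (F2 x z) \<subseteq> Q" by (simp add: supp_F)
  show "\<exists>y w a b. supp y \<subseteq> Q \<and> supp w \<subseteq> Q \<and> supp a \<subseteq> Q \<and> supp b \<subseteq> Q \<and>
      F1 y w = x + frag_cmul (int p) a \<and> F2 y w = z + frag_cmul (int p) b"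
    using F_surj[OF x] by metis
  assume "supp x' \<subseteq> Q" "supp z' \<subseteq> Q"
  with x show "[commutator_form (F1 x z) (F2 x z) (F1 x' z') (F2 x' z') = commutator_form x z x' z'] (mod int p)"
    by (rule commutator_form_F)
qed

lemma supp_cob: "r \<in> gauge_cells l \<Longrightarrow> supp (cob d r) \<subseteq> Q"
proof
  fix s assume r: "r \<in> gauge_cells l" and s: "s \<in> supp (cob d r)"
  obtain v I v' J where rs: "r = (v, I)" "s = (v', J)" by fastforce
  have I: "I \<subseteq> {1..d}" "card I = n" "\<And>i. i \<notin> {1..d} \<Longrightarrow> v i = 0" using r unfolding rs gauge_eq cells_def by auto
  have "\<exists>j\<in>{1..d} - I. J = insert j I"
  proof (rule ccontr)
    assume "\<not> ?thesis"
    then have "coef (cob d (v, I)) (v', J) = 0" by (intro coef_cob_0) auto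
    then show False using s by (simp add: rs in_keys_iff)
  qed
  then obtain j where j: "j \<in> {1..d} - I" "J = insert j I" by blast
  have "v' = v \<or> v' = unshift v {j}"
    using s coef_cob_insert[OF j(1), of v v'] unfolding rs j(2) by (auto simp: in_keys_iff)
  moreover have "card J = n + 1" "J \<subseteq> {1..d}" using j I finite_subset[OF I(1)] by auto
  ultimately show "s \<in> Q" using I(3) j(1) unfolding rs Q_eq cells_def by (auto simp: unshift_def)
qed

lemma sum_expansion: "finite J \<Longrightarrow> supp x \<subseteq> J \<Longrightarrow> (\<Sum>s\<in>J. frag_cmul (coef x s) (M s)) = frag_extend M x"
  unfolding frag_extend_def by (rule sum.mono_neutral_right) (auto simp: in_keys_iff)

lemma int_cup1_coboundary:
  assumes r: "r \<in> gauge_cells l" and s: "s \<in> Q"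
  shows "int_cup1 l (coboundary (indicator {r})) (indicator {s}) = coef (UU (cob d r)) s"
proof -
  have "int_cup1 l (coboundary (indicator {r})) (indicator {s}) = pair (cup1_left d n s) (coboundary (indicator {r}))"
    using int_cup1_indicator[OF l d_def n_def s] .
  also have "\<dots> = pair (cup1_left d n s) (coef (cob d r))"
  proof (rule pair_cong)
    fix t assume "t \<in> supp (cup1_left d n s)"
    then have "t \<in> Q" using W_supp[OF s] by blast
    then show "coboundary (indicator {r}) t = coef (cob d r) t"
      using r coboundary_indicator[of "snd r" d "snd t" "fst r" "fst t"]
      unfolding Q_eq gauge_eq cells_def by (auto simp: case_prod_beta)
  qed
  also have "\<dots> = pair (cob d r) (coef (cup1_left d n s))" by (rule pair_commute)
  also have "\<dots> = pair (cob d r) (\<lambda>t. coef (cup1_right d n t) s)"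
  proof (rule pair_cong)
    fix t assume "t \<in> supp (cob d r)"
    then have "t \<in> Q" using supp_cob[OF r] by blast
    then show "coef (cup1_left d n s) t = coef (cup1_right d n t) s" using s by (simp only: U_coef W_coef)
  qed
  finally show ?thesis by (simp add: coef_frag_extend)
qed

lemma gauge_op_eq:
  assumes r: "r \<in> gauge_cells l"
  shows "gauge_op l p k r = cls (cob d r) (frag_cmul k (UU (cob d r)))"
proof -
  note sc = supp_cob[OF r] and sU = supp_ext(2)[OF supp_cob[OF r]]
  have 1: "gfinprod P (\<lambda>s. X_cls Q p s [^]\<^bsub>P\<^esub> coboundary (indicator {r}) s) Q = cls (cob d r) 0"
  proof -
    have "X_cls Q p s [^]\<^bsub>P\<^esub> coboundary (indicator {r}) s = cls (frag_cmul (coef (cob d r) s) (frag_of s)) 0" if "s \<in> Q" for s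
    proof -
      have "coboundary (indicator {r}) s = coef (cob d r) s"
        using r that coboundary_indicator[of "snd r" d "snd s" "fst r" "fst s"]
        unfolding Q_eq gauge_eq cells_def by (auto simp: case_prod_beta)
      then show ?thesis using that by (simp add: X_cls_eq int_pow_cls)
    qed
    then have "gfinprod P (\<lambda>s. X_cls Q p s [^]\<^bsub>P\<^esub> coboundary (indicator {r}) s) Q =
       cls (\<Sum>s\<in>supp (cob d r). frag_cmul (coef (cob d r) s) (frag_of s)) (\<Sum>s\<in>supp (cob d r). 0)"
      by (intro gfinprod_cls[THEN conjunct1]) (use sc in \<open>auto simp: in_keys_iff\<close>)
    then show ?thesis by (simp add: sum_expansion flip: frag_expansion)
  qed
  have 2: "gfinprod P (\<lambda>s'. Z_cls Q p s' [^]\<^bsub>P\<^esub> (k * int_cup1 l (coboundary (indicator {r})) (indicator {s'}))) Q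
      = cls 0 (frag_cmul k (UU (cob d r)))"
  proof -
    let ?y = "frag_cmul k (UU (cob d r))"
    have sy: "supp ?y \<subseteq> Q" using sU by (simp add: supp_ops)
    have "Z_cls Q p s [^]\<^bsub>P\<^esub> (k * int_cup1 l (coboundary (indicator {r})) (indicator {s})) = cls 0 (frag_cmul (coef ?y s) (frag_of s))" if "s \<in> Q" for s
      using that by (simp add: Z_cls_eq int_pow_cls int_cup1_coboundary[OF r])
    then have "gfinprod P (\<lambda>s'. Z_cls Q p s' [^]\<^bsub>P\<^esub> (k * int_cup1 l (coboundary (indicator {r})) (indicator {s'}))) Q =
       cls (\<Sum>s\<in>supp ?y. 0) (\<Sum>s\<in>supp ?y. frag_cmul (coef ?y s) (frag_of s))"
      by (intro gfinprod_cls[THEN conjunct1]) (use sy in \<open>auto simp: in_keys_iff\<close>)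
    then show ?thesis using sum_expansion[of "supp ?y" ?y frag_of] by (simp flip: frag_expansion)
  qed
  show ?thesis unfolding gauge_op_def Let_def 1 2 using sc sU by (simp add: mult_cls supp_ops)
qed

text \<open>Only the cell dual to \<open>s\<close> contributes to the product over all \<open>(m-1)\<close>-cells, so the sign in its cup product with
  \<open>s\<close> turns the coboundary of that cell into \<open>dual_cob d s\<close>.\<close>

lemma gauge_product:
  assumes s: "s \<in> Q"
  shows "gfinprod P (\<lambda>r. gauge_op l p k r [^]\<^bsub>P\<^esub> (c * int_cup l r s)) (gauge_cells l) =
    cls (frag_cmul c (dual_cob d s)) (frag_cmul (c * k) (UU (dual_cob d s)))"
proof -
  obtain v J where sv: "s = (v, J)" by fastforce
  have sJ: "(v, J) \<in> cells d (n + 1)" using s unfolding sv Q_eq .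
  note J = cell_compl[OF sJ dn(1)]
  let ?r = "(unshift v ({1..d} - J), {1..d} - J)" and ?e = "(-1) ^ inv_count J ({1..d} - J) :: int"
  have r: "?r \<in> gauge_cells l" using sJ J(1) unfolding gauge_eq cells_def by (auto simp: unshift_def)
  have cup: "int_cup l r s = (if r = ?r then ?e else 0)" if "r \<in> gauge_cells l" for r
    unfolding sv using int_cup_eq[OF l d_def that] s sv by blast
  let ?x = "\<lambda>r. frag_cmul (c * int_cup l r s) (cob d r)" and ?z = "\<lambda>r. frag_cmul (c * int_cup l r s) (frag_cmul k (UU (cob d r)))"
  have "gfinprod P (\<lambda>r. gauge_op l p k r [^]\<^bsub>P\<^esub> (c * int_cup l r s)) (gauge_cells l) =
      cls (\<Sum>r\<in>{?r}. ?x r) (\<Sum>r\<in>{?r}. ?z r)"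
  proof (rule gfinprod_cls[THEN conjunct1])
    fix r assume r: "r \<in> gauge_cells l"
    have "supp (cob d r) \<subseteq> Q" "supp (frag_cmul k (UU (cob d r))) \<subseteq> Q"
      using supp_cob[OF r] by (simp_all add: supp_ops supp_ext)
    then show "gauge_op l p k r [^]\<^bsub>P\<^esub> (c * int_cup l r s) = cls (?x r) (?z r) \<and> supp (?x r) \<subseteq> Q \<and> supp (?z r) \<subseteq> Q"
      unfolding gauge_op_eq[OF r] using int_pow_cls supp_ops(3) by blast
  next
    fix r assume "r \<in> gauge_cells l - {?r}"
    then show "?x r = 0 \<and> ?z r = 0" using cup by simp
  qed (use r in simp_all)
  moreover have "dual_cob d s = frag_cmul ?e (cob d ?r)" unfolding sv dual_cob_def by simp
  ultimately show ?thesis using cup[OF r] by (simp add: frag_extend_cmul mult_ac)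
qed

lemma Z_bar_eq:
  assumes s: "s \<in> Q"
  shows "Z_bar l p k s = cls (F1 0 (frag_of s)) (F2 0 (frag_of s))"
proof -
  have "Z_bar l p k s = cls (frag_cmul half_k (dual_cob d s)) (frag_of s + frag_cmul (half_k * k) (UU (dual_cob d s)))"
    unfolding Z_bar_def Let_def gauge_product[OF s] Z_cls_eq[OF s]
    using s D_supp by (simp add: mult_cls supp_ops supp_ext)
  then show ?thesis unfolding F1_def F2_def G_def by (simp add: frag_extend_linear mult.commute)
qed

lemma X_bar_eq:
  assumes t: "t \<in> Q"
  shows "X_bar l p k t = cls (F1 (frag_of t) 0) (F2 (frag_of t) 0)"
proof -
  let ?W = "cup1_left d n t"
  let ?x = "\<lambda>s. frag_cmul (coef ?W s) (frag_cmul (- half) (dual_cob d s))"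
    and ?z = "\<lambda>s. frag_cmul (coef ?W s) (frag_cmul (- half * k) (UU (dual_cob d s)))"
  have int: "int_cup1 l (indicator {s}) (indicator {t}) = coef ?W s" for s
    using int_cup1_indicator[OF l d_def n_def t, of "indicator {s}"] by simp
  have "gfinprod P (\<lambda>s'. gfinprod P (\<lambda>r. gauge_op l p k r [^]\<^bsub>P\<^esub> (- half * int_cup l r s')) (gauge_cells l)
         [^]\<^bsub>P\<^esub> int_cup1 l (indicator {s'}) (indicator {t})) Q = cls (\<Sum>s\<in>supp ?W. ?x s) (\<Sum>s\<in>supp ?W. ?z s)
     \<and> supp (\<Sum>s\<in>supp ?W. ?x s) \<subseteq> Q \<and> supp (\<Sum>s\<in>supp ?W. ?z s) \<subseteq> Q" (is "?g = _ \<and> _")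
  proof (rule gfinprod_cls)
    show "supp ?W \<subseteq> Q" using W_supp[OF t] .
    fix s assume s: "s \<in> Q"
    have "supp (frag_cmul (- half) (dual_cob d s)) \<subseteq> Q" "supp (frag_cmul (- half * k) (UU (dual_cob d s))) \<subseteq> Q"
      by (intro supp_ops supp_ext D_supp[OF s])+
    then show "gfinprod P (\<lambda>r. gauge_op l p k r [^]\<^bsub>P\<^esub> (- half * int_cup l r s)) (gauge_cells l)
         [^]\<^bsub>P\<^esub> int_cup1 l (indicator {s}) (indicator {t}) = cls (?x s) (?z s) \<and> supp (?x s) \<subseteq> Q \<and> supp (?z s) \<subseteq> Q"
      unfolding gauge_product[OF s] int using int_pow_cls supp_ops(3) by blast
  next
    fix s assume "s \<in> Q - supp ?W"
    then have "coef ?W s = 0" by (simp add: in_keys_iff)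
    then show "?x s = 0 \<and> ?z s = 0" by simp
  qed simp
  moreover have "(\<Sum>s\<in>supp ?W. ?x s) = DD (frag_cmul (- half) ?W)"
    unfolding frag_extend_cmul unfolding frag_extend_def frag_cmul_sum by (simp add: mult.commute)
  moreover have "(\<Sum>s\<in>supp ?W. ?z s) = frag_cmul k (UU (DD (frag_cmul (- half) ?W)))"
    unfolding frag_extend_cmul unfolding frag_extend_def[of "dual_cob d"]
    by (simp add: frag_extend_sum frag_extend_cmul frag_cmul_sum mult_ac o_def)
  ultimately have "X_bar l p k t = cls (frag_of t) 0 \<otimes>\<^bsub>P\<^esub> cls (DD (frag_cmul (- half) ?W)) (frag_cmul k (UU (DD (frag_cmul (- half) ?W))))
      \<and> supp (frag_cmul k (UU (DD (frag_cmul (- half) ?W)))) \<subseteq> Q"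
    unfolding X_bar_def Let_def X_cls_eq[OF t] by simp
  moreover have "G (frag_of t) 0 = frag_cmul (- half) ?W"
    unfolding G_def by simp
  ultimately show ?thesis unfolding F1_def F2_def by (simp add: mult_cls)
qed

lemma alpha_X: "s \<in> Q \<Longrightarrow> \<alpha> (X_cls Q p s) = X_bar l p k s"
  by (simp add: X_cls_eq X_bar_eq alpha_cls)

lemma alpha_Z: "s \<in> Q \<Longrightarrow> \<alpha> (Z_cls Q p s) = Z_bar l p k s"
  by (simp add: Z_cls_eq Z_bar_eq alpha_cls)

text \<open>The map composes \<open>W\<close>, \<open>D\<close> and \<open>U\<close>, each of which moves cells by at most one unit in every coordinate.\<close>

lemma alpha_local: "locality_preserving Q p \<alpha>"
  unfolding locality_preserving_def
proof (intro exI[of _ 3] allI impI)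
  fix S g assume S: "S \<subseteq> Q" and "supported_on Q p g S"
  then obtain x z where g: "g = cls x z" "supp x \<subseteq> S" "supp z \<subseteq> S"
    unfolding supported_on_def generate_cls[OF S] by blast
  let ?N = "\<lambda>R. neighbourhood Q R S"
  have mono: "?N 0 \<subseteq> ?N 1" "?N 1 \<subseteq> ?N 3" "?N 2 \<subseteq> ?N 3" by (intro neighbourhood_mono; simp)+
  have xz: "supp x \<subseteq> ?N 0" "supp z \<subseteq> ?N 0" using g neighbourhood_0[OF S] by blast+
  have "supp (WW x) \<subseteq> ?N (0 + 1)"
    by (rule supp_frag_extend_near[OF xz(1)]) (use supp_cup1_left dn(1) in \<open>auto simp: Q_eq\<close>)
  then have "supp (G x z) \<subseteq> ?N 1" unfolding G_def using xz mono by (intro supp_ops) auto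
  then have "supp (DD (G x z)) \<subseteq> ?N (1 + 1)"
    by (rule supp_frag_extend_near) (use supp_dual_cob dn(1) in \<open>auto simp: Q_eq\<close>)
  then have D: "supp (DD (G x z)) \<subseteq> ?N 2" by (simp add: numeral_2_eq_2)
  then have "supp (UU (DD (G x z))) \<subseteq> ?N (2 + 1)"
    by (rule supp_frag_extend_near) (use supp_cup1_right dn(1) in \<open>auto simp: Q_eq\<close>)
  then have U: "supp (UU (DD (G x z))) \<subseteq> ?N 3" by simp
  have "supp (F1 x z) \<subseteq> ?N 3" "supp (F2 x z) \<subseteq> ?N 3"
    unfolding F1_def F2_def using xz mono D U by (intro supp_ops; blast)+
  moreover have "\<alpha> g = cls (F1 x z) (F2 x z)" unfolding g(1) by (rule alpha_cls) (use g S in blast)+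
  moreover have "?N 3 \<subseteq> Q" by (auto simp: neighbourhood_def)
  ultimately show "supported_on Q p (\<alpha> g) (?N 3)"
    unfolding supported_on_def using generate_cls by blast
qed

lemma commute_bar:
  assumes "supp x \<subseteq> Q" "supp z \<subseteq> Q" "supp x' \<subseteq> Q" "supp z' \<subseteq> Q" "a = \<chi> (commutator_form x z x' z')"
  shows "commute_with_phase Q p a (\<alpha> (cls x z)) (\<alpha> (cls x' z'))"
  using alpha_commutation assms unfolding commutation_preserving_def by (simp add: commute_cls)

lemma chi_of_bool: "\<chi> (of_bool b) = exp (2 * of_real pi * \<i> * of_bool b / of_nat p)"
  by (cases b) (simp_all add: \<chi>_def)

lemma bar_relations:
  assumes "s \<in> Q" "s' \<in> Q"
  shows "commute_with_phase Q p 1 (Z_bar l p k s) (Z_bar l p k s')"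
    "commute_with_phase Q p 1 (X_bar l p k s) (X_bar l p k s')"
    "commute_with_phase Q p (exp (2 * of_real pi * \<i> * of_bool (s = s') / of_nat p)) (Z_bar l p k s) (X_bar l p k s')"
  unfolding alpha_X[symmetric, OF assms(1)] alpha_Z[symmetric, OF assms(1)] alpha_X[symmetric, OF assms(2)] alpha_Z[symmetric, OF assms(2)]
    X_cls_eq[OF assms(1)] X_cls_eq[OF assms(2)] Z_cls_eq[OF assms(1)] Z_cls_eq[OF assms(2)] chi_of_bool[symmetric]
  by (rule commute_bar; use assms in \<open>simp add: commutator_form_def pair_def[of _ "coef 0"] of_bool_def\<close>)+

lemma unique_QCA: "\<exists>!\<beta>. clifford_QCA Q p \<beta> \<and>
    (\<forall>s\<in>Q. \<beta> (X_cls Q p s) = X_bar l p k s \<and> \<beta> (Z_cls Q p s) = Z_bar l p k s)"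
proof (rule ex1I[of _ \<alpha>])
  show "clifford_QCA Q p \<alpha> \<and> (\<forall>s\<in>Q. \<alpha> (X_cls Q p s) = X_bar l p k s \<and> \<alpha> (Z_cls Q p s) = Z_bar l p k s)"
    unfolding clifford_QCA_def using alpha_auto alpha_commutation alpha_local alpha_X alpha_Z by blast
  show "\<beta> = \<alpha>" if "clifford_QCA Q p \<beta> \<and> (\<forall>s\<in>Q. \<beta> (X_cls Q p s) = X_bar l p k s \<and> \<beta> (Z_cls Q p s) = Z_bar l p k s)" for \<beta>
    by (rule auto_eqI) (use that alpha_auto alpha_X alpha_Z in \<open>auto simp: clifford_QCA_def\<close>)
qed

end

theorem mainTheorem3:
  fixes p l :: nat and k :: int
  assumes "prime p" and "odd p" and "coprime k (int p)" and "l \<ge> 1"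
  shows "(\<forall>s\<in>qudits l. \<forall>s'\<in>qudits l.
            commute_with_phase (qudits l) p 1 (Z_bar l p k s) (Z_bar l p k s') \<and>
            commute_with_phase (qudits l) p 1 (X_bar l p k s) (X_bar l p k s') \<and>
            commute_with_phase (qudits l) p
              (exp (2 * of_real pi * \<i> * of_bool (s = s') / of_nat p))
              (Z_bar l p k s) (X_bar l p k s')) \<and>
         (\<exists>!\<alpha>. clifford_QCA (qudits l) p \<alpha> \<and>
            (\<forall>s\<in>qudits l. \<alpha> (X_cls (qudits l) p s) = X_bar l p k s \<and>
                          \<alpha> (Z_cls (qudits l) p s) = Z_bar l p k s))"
proof -
  interpret construction p l k by (rule construction.intro[OF assms])
  show ?thesis using bar_relations unique_QCA by blast
qed

end
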